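(* Let $n$ be a prime power, $\mathcal{U}=\mathrm{GF}(n)$, and let $1\le t\le s\le n$. Then for every $m$ the improved Juels–Sudan construction $(\mathsf{SS},\mathsf{Rec})$ described in the context is an average-case $(\mathsf{SDif}_s(\mathcal{U}),\,m,\,m-t\log n,\,t)$-secure sketch. The entropy loss and storage (length of the sketch) of the scheme are at most $t\log n$, and both the sketch generation $\mathsf{SS}$ and the recovery procedure $\mathsf{Rec}$ run in (expected) time polynomial in $s$, $t$ and $\log n$.
   Context: Logarithms are base 2. $\mathsf{SDif}_s(\mathcal{U})$ is the set of all $s$-element subsets of $\mathcal{U}$ with distance $\mathsf{dis}(w,w')=|w\triangle w'|$. Sets are given as lists of elements. Construction. $\mathsf{SS}(w)$ for $w\subseteq\mathcal{U}$, $|w|=s$: let $p'(z)=\prod_{x\in w}(z-x)$, and output the $t$ coefficients of $p'$ of degrees $s-1,s-2,\dots,s-t$ (elements of $\mathrm{GF}(n)$). $\mathsf{Rec}(w',\cdot)$ for $w'=\{a_1,\dots,a_s\}$ and given coefficients $c_{s-1},\dots,c_{s-t}$: (1) let $p_{\mathrm{high}}(z)=z^s+\sum_{i=s-t}^{s-1}c_iz^i$; (2) let $b_i=p_{\mathrm{high}}(a_i)$ for $i=1,\dots,s$; (3) using Reed–Solomon decoding, find a polynomial $p_{\mathrm{low}}$ of degree at most $s-t-1$ with $p_{\mathrm{low}}(a_i)=b_i$ for at least $s-t/2$ of the indices $i$ (if none exists, output "fail"; for $t=s$ only the zero polynomial is allowed); (4) output the set of roots in $\mathrm{GF}(n)$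 of $p_{\mathrm{high}}-p_{\mathrm{low}}$. Average min-entropy: $\tilde{\mathbf{H}}_\infty(A\mid B)=-\log\big(\mathbb{E}_{b\leftarrow B}[\max_a\Pr[A=a\mid B=b]]\big)$. An average-case $(\mathcal{M},m,\tilde m,t)$-secure sketch is a pair of randomized procedures: $\mathsf{SS}$ maps $w\in\mathcal{M}$ to a string; $\mathsf{Rec}$ takes $w'\in\mathcal{M}$ and a string; correctness: if $\mathsf{dis}(w,w')\le t$ then $\mathsf{Rec}(w',\mathsf{SS}(w))=w$; security: for any random variables $W$ over $\mathcal{M}$ and $I$ over $\{0,1\}^*$ with $\tilde{\mathbf{H}}_\infty(W\mid I)\ge m$, $\tilde{\mathbf{H}}_\infty(W\mid(\mathsf{SS}(W),I))\ge\tilde m$. Its entropy loss is $m-\tilde m$. The length of a sketch consisting of $t$ elements of $\mathrm{GF}(n)$ is counted as $t\log n$ bits. *)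

theory Defs
  imports
    "HOL-Probability.Probability"
    "HOL-Library.Log_Nat"
    "HOL-Algebra.Algebra"
begin

section \<open>Average-case secure sketches\<close>

text \<open>A pair of jointly distributed discrete random variables is given by its joint
  distribution.  The supremum over \<open>a\<close> is attained, since the conditional probabilities sum to 1;
  the division by zero for \<open>b\<close> outside the support does not contribute to the expectation.\<close>

definition avg_min_entropy :: "('a \<times> 'b) pmf \<Rightarrow> real" where
  "avg_min_entropy p =
     - log 2 (measure_pmf.expectation (map_pmf snd p)
         (\<lambda>b. SUP a. pmf p (a, b) / pmf (map_pmf snd p) b))"

text \<open>\<open>joint\<close> is the joint distribution of \<open>W\<close> and \<open>I\<close>; the coins of \<open>SS\<close> are independent of both.\<close>

definition avg_case_secure_sketch ::
  "'w set \<Rightarrow> ('w \<Rightarrow> 'w \<Rightarrow> nat) \<Rightarrow> real \<Rightarrow> real \<Rightarrow> nat \<Rightarrow>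
   ('w \<Rightarrow> 'c pmf) \<Rightarrow> ('w \<Rightarrow> 'c \<Rightarrow> 'w option pmf) \<Rightarrow> bool" where
  "avg_case_secure_sketch M dis m m' t SS Rec \<longleftrightarrow>
     (\<forall>w\<in>M. \<forall>w'\<in>M. dis w w' \<le> t \<longrightarrow>
        (\<forall>c\<in>set_pmf (SS w). Rec w' c = return_pmf (Some w))) \<and>
     (\<forall>joint :: ('w \<times> bool list) pmf.
        fst ` set_pmf joint \<subseteq> M \<and> avg_min_entropy joint \<ge> m \<longrightarrow>
        avg_min_entropy (bind_pmf joint (\<lambda>(w, i). map_pmf (\<lambda>c. (w, (c, i))) (SS w))) \<ge> m')"

definition entropy_loss :: "real \<Rightarrow> real \<Rightarrow> real" where
  "entropy_loss m m' = m - m'"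

definition SDif :: "('a, 'b) ring_scheme \<Rightarrow> nat \<Rightarrow> 'a set set" where
  "SDif R s = {w. w \<subseteq> carrier R \<and> card w = s}"

definition set_dist :: "'a set \<Rightarrow> 'a set \<Rightarrow> nat" where
  "set_dist w w' = card (sym_diff w w')"


section \<open>The improved Juels-Sudan construction\<close>

text \<open>Polynomials over \<open>R\<close> are the elements of \<open>univ_poly R (carrier R)\<close>: coefficient lists, leading
  coefficient first, with \<open>[]\<close> for the zero polynomial.  Thus \<open>[\<one>, \<ominus> x]\<close> is $z - x$.\<close>

definition JS_poly :: "'a ring \<Rightarrow> 'a set \<Rightarrow> 'a list" where
  "JS_poly R w = (\<Otimes>\<^bsub>univ_poly R (carrier R)\<^esub> x\<in>w. [\<one>\<^bsub>R\<^esub>, \<ominus>\<^bsub>R\<^esub> x])"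

text \<open>The sketch lists the coefficients of degrees $s-1, \ldots, s-t$ in this order.\<close>

definition JS_SS :: "'a ring \<Rightarrow> nat \<Rightarrow> nat \<Rightarrow> 'a set \<Rightarrow> 'a list pmf" where
  "JS_SS R s t w = return_pmf (map (\<lambda>j. ring.coeff R (JS_poly R w) (s - 1 - j)) [0..<t])"

text \<open>The coefficient list of $z^s + c_{s-1} z^{s-1} + \cdots + c_{s-t} z^{s-t}$.\<close>

definition JS_high :: "'a ring \<Rightarrow> nat \<Rightarrow> nat \<Rightarrow> 'a list \<Rightarrow> 'a list" where
  "JS_high R s t c = \<one>\<^bsub>R\<^esub> # c @ replicate (s - t) \<zero>\<^bsub>R\<^esub>"

text \<open>The condition \<open>degree p + t < s\<close> says that the degree is at most $s-t-1$; for \<open>t = s\<close> it fails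
  for every \<open>p\<close>, so that only the zero polynomial remains.  The second condition is agreement in at
  least $s - t/2$ points, with denominators and subtraction cleared.\<close>

definition JS_low :: "'a ring \<Rightarrow> nat \<Rightarrow> nat \<Rightarrow> 'a set \<Rightarrow> 'a list \<Rightarrow> 'a list \<Rightarrow> bool" where
  "JS_low R s t w' c p \<longleftrightarrow>
     p \<in> carrier (univ_poly R (carrier R)) \<and> (p = [] \<or> Polynomials.degree p + t < s) \<and>
     2 * s \<le> 2 * card {a \<in> w'. ring.eval R p a = ring.eval R (JS_high R s t c) a} + t"

definition JS_Rec :: "'a ring \<Rightarrow> nat \<Rightarrow> nat \<Rightarrow> 'a set \<Rightarrow> 'a list \<Rightarrow> 'a set option pmf" where
  "JS_Rec R s t w' c = return_pmf
     (if \<exists>p. JS_low R s t w' c p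
      then let p = (SOME p. JS_low R s t w' c p) in
        Some {a \<in> carrier R.
          ring.eval R (JS_high R s t c \<ominus>\<^bsub>univ_poly R (carrier R)\<^esub> p) a = \<zero>\<^bsub>R\<^esub>}
      else None)"

definition sketch_bits :: "'a ring \<Rightarrow> 'a list \<Rightarrow> real" where
  "sketch_bits R c = real (length c) * log 2 (real (order R))"


section \<open>Randomized programs over a finite field and their running time\<close>

text \<open>Running time is measured in a probabilistic WHILE language over binary trees (the data of
  Lisp, and of Jones' WHILE language), whose atoms are \<open>nil\<close> and field elements.  The syntax does not
  refer to the field: one program runs over all finite fields.  A program treats field elements as
  opaque, through the operations of the field, equality tests, and uniform sampling.\<close>

datatype 'a val = VNil | VElem 'a | VPair "'a val" "'a val"

datatype exp =
    Var nat
  | Nil_Exp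
  | Pair_Exp exp exp
  | Hd exp
  | Tl exp
  | F_Zero
  | F_One
  | F_Add exp exp
  | F_Neg exp
  | F_Mul exp exp
  | F_Inv exp
  | F_Eq exp exp

text \<open>\<open>Call x c e\<close> runs \<open>c\<close> as a (non-recursive) procedure with a store of its own: its argument, the
  value of \<open>e\<close>, and its result are in variable 0, and the result is assigned to \<open>x\<close>.\<close>

datatype com =
    Skip
  | Assign nat exp
  | Sample nat
  | Seq com com
  | If exp com com
  | While exp com
  | Call nat com exp

text \<open>All partial operations are made total; in particular the inverse of zero is zero, and an
  operation applied to arguments of the wrong kind yields \<open>VNil\<close>.\<close>

fun lift1 :: "('a \<Rightarrow> 'a) \<Rightarrow> 'a val \<Rightarrow> 'a val" where
  "lift1 f (VElem a) = VElem (f a)"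
| "lift1 f _ = VNil"

fun lift2 :: "('a \<Rightarrow> 'a \<Rightarrow> 'a) \<Rightarrow> 'a val \<Rightarrow> 'a val \<Rightarrow> 'a val" where
  "lift2 f (VElem a) (VElem b) = VElem (f a b)"
| "lift2 f _ _ = VNil"

fun val_eq :: "'a val \<Rightarrow> 'a val \<Rightarrow> 'a val" where
  "val_eq (VElem a) (VElem b) = (if a = b then VPair VNil VNil else VNil)"
| "val_eq _ _ = VNil"

fun val_hd :: "'a val \<Rightarrow> 'a val" where
  "val_hd (VPair u v) = u"
| "val_hd _ = VNil"

fun val_tl :: "'a val \<Rightarrow> 'a val" where
  "val_tl (VPair u v) = v"
| "val_tl _ = VNil"

primrec eval_exp :: "'a ring \<Rightarrow> exp \<Rightarrow> (nat \<Rightarrow> 'a val) \<Rightarrow> 'a val" where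
  "eval_exp R (Var x) \<sigma> = \<sigma> x"
| "eval_exp R Nil_Exp \<sigma> = VNil"
| "eval_exp R (Pair_Exp e f) \<sigma> = VPair (eval_exp R e \<sigma>) (eval_exp R f \<sigma>)"
| "eval_exp R (Hd e) \<sigma> = val_hd (eval_exp R e \<sigma>)"
| "eval_exp R (Tl e) \<sigma> = val_tl (eval_exp R e \<sigma>)"
| "eval_exp R F_Zero \<sigma> = VElem \<zero>\<^bsub>R\<^esub>"
| "eval_exp R F_One \<sigma> = VElem \<one>\<^bsub>R\<^esub>"
| "eval_exp R (F_Add e f) \<sigma> = lift2 (\<lambda>a b. a \<oplus>\<^bsub>R\<^esub> b) (eval_exp R e \<sigma>) (eval_exp R f \<sigma>)"
| "eval_exp R (F_Neg e) \<sigma> = lift1 (\<lambda>a. \<ominus>\<^bsub>R\<^esub> a) (eval_exp R e \<sigma>)"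
| "eval_exp R (F_Mul e f) \<sigma> = lift2 (\<lambda>a b. a \<otimes>\<^bsub>R\<^esub> b) (eval_exp R e \<sigma>) (eval_exp R f \<sigma>)"
| "eval_exp R (F_Inv e) \<sigma> =
     lift1 (\<lambda>a. if a = \<zero>\<^bsub>R\<^esub> then \<zero>\<^bsub>R\<^esub> else inv\<^bsub>R\<^esub> a) (eval_exp R e \<sigma>)"
| "eval_exp R (F_Eq e f) \<sigma> = val_eq (eval_exp R e \<sigma>) (eval_exp R f \<sigma>)"

text \<open>A field operation costs the square of the bit length of the order of the field: up to a
  constant factor, this covers the bit operations of schoolbook arithmetic in $\mathrm{GF}(n)$,
  including inversion by the extended Euclidean algorithm.\<close>

definition field_cost :: "'a ring \<Rightarrow> nat" where
  "field_cost R = (floorlog 2 (order R))\<^sup>2"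

primrec exp_cost :: "nat \<Rightarrow> exp \<Rightarrow> nat" where
  "exp_cost \<kappa> (Var x) = 1"
| "exp_cost \<kappa> Nil_Exp = 1"
| "exp_cost \<kappa> (Pair_Exp e f) = 1 + exp_cost \<kappa> e + exp_cost \<kappa> f"
| "exp_cost \<kappa> (Hd e) = 1 + exp_cost \<kappa> e"
| "exp_cost \<kappa> (Tl e) = 1 + exp_cost \<kappa> e"
| "exp_cost \<kappa> F_Zero = \<kappa>"
| "exp_cost \<kappa> F_One = \<kappa>"
| "exp_cost \<kappa> (F_Add e f) = \<kappa> + exp_cost \<kappa> e + exp_cost \<kappa> f"
| "exp_cost \<kappa> (F_Neg e) = \<kappa> + exp_cost \<kappa> e"
| "exp_cost \<kappa> (F_Mul e f) = \<kappa> + exp_cost \<kappa> e + exp_cost \<kappa> f"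
| "exp_cost \<kappa> (F_Inv e) = \<kappa> + exp_cost \<kappa> e"
| "exp_cost \<kappa> (F_Eq e f) = \<kappa> + exp_cost \<kappa> e + exp_cost \<kappa> f"

text \<open>The meaning of a command is the joint subdistribution of final store and running time; the
  missing probability mass is the probability of nontermination.\<close>

context
  fixes test :: "'s \<Rightarrow> bool" and k :: nat and body :: "'s \<Rightarrow> ('s \<times> nat) spmf"
begin

partial_function (spmf) iterate :: "'s \<Rightarrow> ('s \<times> nat) spmf" where
  "iterate \<sigma> =
     (if test \<sigma>
      then bind_spmf (body \<sigma>) (\<lambda>(\<sigma>1, k1).
             map_spmf (\<lambda>(\<sigma>2, k2). (\<sigma>2, k + k1 + k2)) (iterate \<sigma>1))
      else return_spmf (\<sigma>, k))"

end

primrec exec :: "'a ring \<Rightarrow> com \<Rightarrow> (nat \<Rightarrow> 'a val) \<Rightarrow> ((nat \<Rightarrow> 'a val) \<times> nat) spmf" where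
  "exec R Skip \<sigma> = return_spmf (\<sigma>, 1)"
| "exec R (Assign x e) \<sigma> =
     return_spmf (\<sigma>(x := eval_exp R e \<sigma>), 1 + exp_cost (field_cost R) e)"
| "exec R (Sample x) \<sigma> =
     map_spmf (\<lambda>a. (\<sigma>(x := VElem a), 1 + field_cost R)) (spmf_of_set (carrier R))"
| "exec R (Seq c d) \<sigma> =
     bind_spmf (exec R c \<sigma>) (\<lambda>(\<sigma>1, k1).
       map_spmf (\<lambda>(\<sigma>2, k2). (\<sigma>2, k1 + k2)) (exec R d \<sigma>1))"
| "exec R (If e c d) \<sigma> =
     map_spmf (\<lambda>(\<sigma>1, k1). (\<sigma>1, 1 + exp_cost (field_cost R) e + k1))
       (if eval_exp R e \<sigma> \<noteq> VNil then exec R c \<sigma> else exec R d \<sigma>)"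
| "exec R (While e c) \<sigma> =
     iterate (\<lambda>\<sigma>. eval_exp R e \<sigma> \<noteq> VNil) (1 + exp_cost (field_cost R) e) (exec R c) \<sigma>"
| "exec R (Call x c e) \<sigma> =
     map_spmf (\<lambda>(\<sigma>1, k1). (\<sigma>(x := \<sigma>1 0), 1 + exp_cost (field_cost R) e + k1))
       (exec R c ((\<lambda>_. VNil)(0 := eval_exp R e \<sigma>)))"

definition run :: "'a ring \<Rightarrow> com \<Rightarrow> 'a val \<Rightarrow> ('a val \<times> nat) spmf" where
  "run R c v = map_spmf (\<lambda>(\<sigma>, k). (\<sigma> 0, k)) (exec R c ((\<lambda>_. VNil)(0 := v)))"

definition expected_time :: "'a ring \<Rightarrow> com \<Rightarrow> 'a val \<Rightarrow> ennreal" where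
  "expected_time R c v =
     (if lossless_spmf (run R c v)
      then \<integral>\<^sup>+ (y, k). of_nat k \<partial>measure_spmf (run R c v) else \<infinity>)"

definition outputs :: "'a ring \<Rightarrow> com \<Rightarrow> 'a val \<Rightarrow> 'a val spmf" where
  "outputs R c v = map_spmf fst (run R c v)"


subsection \<open>Encoding of inputs and outputs\<close>

fun val_list :: "'a val list \<Rightarrow> 'a val" where
  "val_list [] = VNil"
| "val_list (v # vs) = VPair v (val_list vs)"

definition elem_list :: "'a list \<Rightarrow> 'a val" where
  "elem_list as = val_list (map VElem as)"

text \<open>The numbers $s$ and $t$ may be given in unary, since time polynomial in $s$ and $t$ is allowed;
  $s$ is the length of the input list.  The order $n$ of the field is given in binary, least
  significant bit first.\<close>

definition unary :: "nat \<Rightarrow> 'a val" where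
  "unary k = val_list (replicate k VNil)"

fun binary :: "nat \<Rightarrow> 'a val" where
  "binary k =
     (if k = 0 then VNil
      else VPair (if odd k then VPair VNil VNil else VNil) (binary (k div 2)))"

declare binary.simps [simp del]

definition SS_input :: "'a ring \<Rightarrow> nat \<Rightarrow> 'a list \<Rightarrow> 'a val" where
  "SS_input R t as = val_list [elem_list as, unary t, binary (order R)]"

definition Rec_input :: "'a ring \<Rightarrow> nat \<Rightarrow> 'a list \<Rightarrow> 'a list \<Rightarrow> 'a val" where
  "Rec_input R t as c = val_list [elem_list as, elem_list c, unary t, binary (order R)]"

text \<open>A set is represented by any of its duplicate-free enumerations, and the answer ``fail'' by
  \<open>VNil\<close>.\<close>

definition represents :: "'a val \<Rightarrow> 'a set option \<Rightarrow> bool" where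
  "represents v r \<longleftrightarrow>
     (case r of None \<Rightarrow> v = VNil
      | Some w \<Rightarrow> \<exists>as. distinct as \<and> set as = w \<and> v = VPair VNil (elem_list as))"


subsection \<open>Implementing a construction in expected polynomial time\<close>

text \<open>A quantity is bounded by a polynomial in \<open>s\<close>, \<open>t\<close> and \<open>log n\<close> iff it is at most
  \<open>C * (s + t + log n) ^ d\<close> for some constants, as \<open>s + t \<ge> 1\<close>.  The program and the constants come
  before the field: they are uniform in all finite fields on the type, so for an infinite type such as
  \<open>nat\<close> in all finite fields up to isomorphism.  Times hold for every input, the expectation being over
  the coins of the program only.\<close>

definition SS_expected_poly_time ::
  "('a ring \<Rightarrow> nat \<Rightarrow> nat \<Rightarrow> 'a set \<Rightarrow> 'a list pmf) \<Rightarrow> bool" where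
  "SS_expected_poly_time SS \<longleftrightarrow>
     (\<exists>prog C d. \<forall>R s t as.
        field R \<and> finite (carrier R) \<and> 1 \<le> t \<and> t \<le> s \<and> s \<le> order R \<and>
        distinct as \<and> set as \<in> SDif R s \<longrightarrow>
          outputs R prog (SS_input R t as) = spmf_of_pmf (map_pmf elem_list (SS R s t (set as))) \<and>
          expected_time R prog (SS_input R t as)
            \<le> ennreal (C * (real s + real t + log 2 (real (order R))) ^ d))"

text \<open>The order in which the program lists the set may depend on its coins, so its output is compared
  with that of \<open>Rec\<close> by the lifting of \<open>represents\<close> to distributions.\<close>

definition Rec_expected_poly_time ::
  "('a ring \<Rightarrow> nat \<Rightarrow> nat \<Rightarrow> 'a set \<Rightarrow> 'a list \<Rightarrow> 'a set option pmf) \<Rightarrow> bool" where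
  "Rec_expected_poly_time Rec \<longleftrightarrow>
     (\<exists>prog C d. \<forall>R s t as c.
        field R \<and> finite (carrier R) \<and> 1 \<le> t \<and> t \<le> s \<and> s \<le> order R \<and>
        distinct as \<and> set as \<in> SDif R s \<and> length c = t \<and> set c \<subseteq> carrier R \<longrightarrow>
          rel_spmf represents (outputs R prog (Rec_input R t as c))
            (spmf_of_pmf (Rec R s t (set as) c)) \<and>
          expected_time R prog (Rec_input R t as c)
            \<le> ennreal (C * (real s + real t + log 2 (real (order R))) ^ d))"

end

theory Submission imports Defs begin

text \<open>If \<open>w\<close> and \<open>w'\<close> differ in at most \<open>t\<close> elements, then \<open>p_high\<close> and the polynomial with roots \<open>w\<close>
  differ by a polynomial of degree less than \<open>s - t\<close> that agrees with \<open>p_high\<close> in at least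
  \<open>s - t/2\<close> points of \<open>w'\<close>, and two polynomials with this property coincide. It is found by keeping a
  basis of two rows \<open>(n, w)\<close> of the module of pairs with \<open>n(a) = w(a) h(a)\<close> at the points \<open>a\<close> processed so
  far, whose weighted degrees stay balanced: the low part is then the quotient \<open>n / w\<close>, computed as
  a power series. As there are only \<open>n^t\<close> sketches, revealing one of them multiplies the average
  guessing probability by at most \<open>n^t\<close>.

  The roots of a polynomial \<open>f\<close> are found by taking the greatest common divisor of \<open>f\<close> and \<open>z^n - z\<close> and
  splitting it repeatedly, by the quadratic character of \<open>z + a\<close> or, in characteristic 2, by the trace
  of \<open>a z\<close>, for random \<open>a\<close>. Two distinct roots are separated with probability at least \<open>1/3\<close>, so the
  expected number of rounds is linear in the degree. Everything else is deterministic and written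
  with loops that all run \<open>N\<close> times for one \<open>N\<close> linear in the input size, which makes the running time
  a polynomial in \<open>N\<close> that can be read off the program text.\<close>


section \<open>Deterministic programs with loops of a common length\<close>

text \<open>The time bound holds for every input and demands almost sure termination. Mass lost to
  divergence contributes nothing to an integral, so a bound on expected cost is not enough:
  termination and cost of the one random loop are two arguments about the same potential. Decoding
  is in the style of Welch and Berlekamp. With \<open>k = s - t\<close>, a row (n, w) has weight
  max(deg n, deg w + k - 1), which bounds the degree of n - w p for every admissible p. Balance
  gives 2 D <= 2 s - t + 1 after s points, where D exceeds the smaller weight by one. A solution p
  agrees with \<open>JS_high\<close> in A points with 2 A >= 2 s - t, so D <= A and n = w p. Whether
  p exists is not decided beforehand: a candidate is computed in every case and its errors are
  counted. Splitting follows Cantor and Zassenhaus, in characteristic 2 Berlekamp's trace method.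
  The constant 1/3 covers both: at least n/2 elements separate two roots by the trace, at least
  (n-1)/2 by the character, and (n-1)/2 >= n/3 for odd n >= 3. Since z^n - z has degree exponential
  in log n, only its residue modulo f is computed.\<close>

text \<open>Compiled programs expect a list of length \<open>N\<close> in register 1 and use register 2 as a stack of loop
  counters; their own registers are shifted by 3.\<close>

datatype dcom =
    DSkip
  | DAssign nat exp (infix \<open>::=\<close> 61)
  | DSeq dcom dcom (infixr \<open>;;;\<close> 60)
  | DIf exp dcom dcom
  | DLoop dcom
  | DCall nat dcom exp

primrec shift :: "exp \<Rightarrow> exp" where
  "shift (Var x) = Var (x + 3)"
| "shift Nil_Exp = Nil_Exp"
| "shift (Pair_Exp e f) = Pair_Exp (shift e) (shift f)"
| "shift (Hd e) = Hd (shift e)"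
| "shift (Tl e) = Tl (shift e)"
| "shift F_Zero = F_Zero"
| "shift F_One = F_One"
| "shift (F_Add e f) = F_Add (shift e) (shift f)"
| "shift (F_Neg e) = F_Neg (shift e)"
| "shift (F_Mul e f) = F_Mul (shift e) (shift f)"
| "shift (F_Inv e) = F_Inv (shift e)"
| "shift (F_Eq e f) = F_Eq (shift e) (shift f)"

text \<open>A callee starts with an empty store, so the list that fixes the loop length travels in
  the head of its argument. Register 3 is variable 0 of the source program after the shift.\<close>

definition wrap :: "com \<Rightarrow> com" where
  "wrap c = Seq (Assign 1 (Hd (Var 0))) (Seq (Assign 3 (Tl (Var 0))) (Seq c (Assign 0 (Var 3))))"

text \<open>A loop pushes a copy of the list in register 1 onto the stack in register 2 and consumes
  one cell of it per round, so nested loops do not disturb each other.\<close>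

primrec compile :: "dcom \<Rightarrow> com" where
  "compile DSkip = Skip"
| "compile (x ::= e) = Assign (x + 3) (shift e)"
| "compile (c ;;; d) = Seq (compile c) (compile d)"
| "compile (DIf e c d) = If (shift e) (compile c) (compile d)"
| "compile (DLoop c) =
     Seq (Assign 2 (Pair_Exp (Var 1) (Var 2)))
       (Seq (While (Hd (Var 2))
              (Seq (Assign 2 (Pair_Exp (Tl (Hd (Var 2))) (Tl (Var 2)))) (compile c)))
         (Assign 2 (Tl (Var 2))))"
| "compile (DCall x c e) = Call (x + 3) (wrap (compile c)) (Pair_Exp (Var 1) (shift e))"

abbreviation init :: "'a val \<Rightarrow> nat \<Rightarrow> 'a val" where
  "init v \<equiv> (\<lambda>_. VNil)(0 := v)"

primrec dsem :: "'a ring \<Rightarrow> nat \<Rightarrow> dcom \<Rightarrow> (nat \<Rightarrow> 'a val) \<Rightarrow> nat \<Rightarrow> 'a val" where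
  "dsem R N DSkip \<sigma> = \<sigma>"
| "dsem R N (x ::= e) \<sigma> = \<sigma>(x := eval_exp R e \<sigma>)"
| "dsem R N (c ;;; d) \<sigma> = dsem R N d (dsem R N c \<sigma>)"
| "dsem R N (DIf e c d) \<sigma> = (if eval_exp R e \<sigma> \<noteq> VNil then dsem R N c \<sigma> else dsem R N d \<sigma>)"
| "dsem R N (DLoop c) \<sigma> = (dsem R N c ^^ N) \<sigma>"
| "dsem R N (DCall x c e) \<sigma> = \<sigma>(x := dsem R N c (init (eval_exp R e \<sigma>)) 0)"

definition call :: "'a ring \<Rightarrow> nat \<Rightarrow> dcom \<Rightarrow> 'a val \<Rightarrow> 'a val" where
  "call R N c v = dsem R N c (init v) 0"

text \<open>Keeps callees opaque, together with the deletion of the defining equation below: a proof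
  about a caller rewrites with the rule for \<open>call\<close> of the callee and never unfolds its
  body.\<close>

lemma dsem_call [simp]: "dsem R N (DCall x c e) \<sigma> = \<sigma>(x := call R N c (eval_exp R e \<sigma>))"
  by (simp add: call_def)

declare dsem.simps(6) [simp del]

text \<open>A conditional is charged for both branches, so that only sums and products occur. A loop
  costs 4 to push, 3 for the last test, 3 to pop, and 3 + 7 per round for test and counter; a call
  adds 3 for passing the list and at most 9 for \<open>wrap\<close>.\<close>

primrec tbound :: "nat \<Rightarrow> nat \<Rightarrow> dcom \<Rightarrow> nat" where
  "tbound \<kappa> N DSkip = 1"
| "tbound \<kappa> N (x ::= e) = 1 + exp_cost \<kappa> (shift e)"
| "tbound \<kappa> N (c ;;; d) = tbound \<kappa> N c + tbound \<kappa> N d"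
| "tbound \<kappa> N (DIf e c d) = 1 + exp_cost \<kappa> (shift e) + (tbound \<kappa> N c + tbound \<kappa> N d)"
| "tbound \<kappa> N (DLoop c) = 10 + N * (10 + tbound \<kappa> N c)"
| "tbound \<kappa> N (DCall x c e) = 12 + exp_cost \<kappa> (shift e) + tbound \<kappa> N c"

text \<open>Register 2 is left out because loops push and pop there, register 0 because only the
  calling convention uses it.\<close>

definition simulates :: "'a val list \<Rightarrow> (nat \<Rightarrow> 'a val) \<Rightarrow> (nat \<Rightarrow> 'a val) \<Rightarrow> bool" where
  "simulates us \<tau> \<sigma> \<longleftrightarrow> \<tau> 1 = val_list us \<and> (\<forall>x. \<tau> (x + 3) = \<sigma> x)"

lemma eval_exp_shift:
  assumes "simulates us \<tau> \<sigma>"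
  shows "eval_exp R (shift e) \<tau> = eval_exp R e \<sigma>"
  using assms by (induction e) (simp_all add: simulates_def)

definition runs_to ::
  "'a ring \<Rightarrow> com \<Rightarrow> (nat \<Rightarrow> 'a val) \<Rightarrow> ((nat \<Rightarrow> 'a val) \<Rightarrow> bool) \<Rightarrow> nat \<Rightarrow> bool" where
  "runs_to R c \<tau> Q b \<longleftrightarrow> (\<exists>\<tau>' k. exec R c \<tau> = return_spmf (\<tau>', k) \<and> Q \<tau>' \<and> k \<le> b)"

lemma runs_to_Seq:
  assumes "runs_to R c \<tau> Q b" "\<And>\<tau>'. Q \<tau>' \<Longrightarrow> runs_to R d \<tau>' Q' b'" "b + b' \<le> B"
  shows "runs_to R (Seq c d) \<tau> Q' B"
proof -
  obtain \<tau>1 k1 where 1: "exec R c \<tau> = return_spmf (\<tau>1, k1)" "Q \<tau>1" "k1 \<le> b"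
    using assms(1) by (auto simp: runs_to_def)
  obtain \<tau>2 k2 where "exec R d \<tau>1 = return_spmf (\<tau>2, k2)" "Q' \<tau>2" "k2 \<le> b'"
    using assms(2)[OF 1(2)] by (auto simp: runs_to_def)
  with 1 assms(3) show ?thesis by (auto simp: runs_to_def)
qed

lemma runs_to_Assign:
  assumes "Q (\<tau>(x := eval_exp R e \<tau>))" "1 + exp_cost (field_cost R) e \<le> B"
  shows "runs_to R (Assign x e) \<tau> Q B"
  using assms by (auto simp: runs_to_def)

lemma runs_to_If:
  assumes "eval_exp R e \<tau> \<noteq> VNil \<Longrightarrow> runs_to R c \<tau> Q b"
    and "eval_exp R e \<tau> = VNil \<Longrightarrow> runs_to R d \<tau> Q b'"
    and "1 + exp_cost (field_cost R) e + b + b' \<le> B"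
  shows "runs_to R (If e c d) \<tau> Q B"
proof (cases "eval_exp R e \<tau> = VNil")
  case True
  then obtain \<tau>2 k2 where "exec R d \<tau> = return_spmf (\<tau>2, k2)" "Q \<tau>2" "k2 \<le> b'"
    using assms(2) by (auto simp: runs_to_def)
  with True assms(3) show ?thesis by (auto simp: runs_to_def)
next
  case False
  then obtain \<tau>2 k2 where "exec R c \<tau> = return_spmf (\<tau>2, k2)" "Q \<tau>2" "k2 \<le> b"
    using assms(1) by (auto simp: runs_to_def)
  with False assms(3) show ?thesis by (auto simp: runs_to_def)
qed

text \<open>The index of \<open>J\<close> counts the rounds still to come. The test is evaluated
  once more than the body, hence the first summand of the bound.\<close>

lemma runs_to_While:
  fixes J :: "nat \<Rightarrow> (nat \<Rightarrow> 'a val) \<Rightarrow> bool"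
  assumes "\<And>i \<tau>. J (Suc i) \<tau> \<Longrightarrow> eval_exp R e \<tau> \<noteq> VNil \<and> runs_to R c \<tau> (J i) b"
    and "\<And>\<tau>. J 0 \<tau> \<Longrightarrow> eval_exp R e \<tau> = VNil"
    and "J n \<tau>"
    and "(1 + exp_cost (field_cost R) e) + n * (1 + exp_cost (field_cost R) e + b) \<le> B"
  shows "runs_to R (While e c) \<tau> (J 0) B"
  using assms(3,4)
proof (induction n arbitrary: \<tau> B)
  case 0
  then show ?case using assms(2)[of \<tau>] by (auto simp: runs_to_def iterate.simps)
next
  case (Suc n)
  from assms(1)[OF Suc.prems(1)] obtain \<tau>1 k1
    where 1: "eval_exp R e \<tau> \<noteq> VNil" "exec R c \<tau> = return_spmf (\<tau>1, k1)" "J n \<tau>1" "k1 \<le> b"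
    by (auto simp: runs_to_def)
  from Suc.IH[OF 1(3) order_refl] obtain \<tau>2 k2
    where 2: "exec R (While e c) \<tau>1 = return_spmf (\<tau>2, k2)" "J 0 \<tau>2"
      "k2 \<le> (1 + exp_cost (field_cost R) e) + n * (1 + exp_cost (field_cost R) e + b)"
    by (auto simp: runs_to_def)
  have "exec R (While e c) \<tau> = return_spmf (\<tau>2, 1 + exp_cost (field_cost R) e + k1 + k2)"
    using 1 2 by (simp add: iterate.simps[of _ _ _ \<tau>])
  with 1 2 Suc.prems(2) show ?case by (auto simp: runs_to_def)
qed

lemma runs_to_Call:
  assumes "runs_to R c (init (eval_exp R e \<tau>)) (\<lambda>\<tau>'. Q (\<tau>(x := \<tau>' 0))) b"
    and "1 + exp_cost (field_cost R) e + b \<le> B"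
  shows "runs_to R (Call x c e) \<tau> Q B"
  using assms by (auto simp: runs_to_def)

lemma runs_to_mono:
  assumes "runs_to R c \<tau> Q b" "\<And>\<tau>'. Q \<tau>' \<Longrightarrow> Q' \<tau>'" "b \<le> B"
  shows "runs_to R c \<tau> Q' B"
  using assms unfolding runs_to_def by (meson order_trans)

lemma val_list_eq_VNil [simp]: "val_list vs = VNil \<longleftrightarrow> vs = []"
  by (cases vs) auto

lemma wrap_runs_to:
  assumes c: "\<And>\<tau> \<sigma>. simulates us \<tau> \<sigma> \<Longrightarrow>
      runs_to R c \<tau> (\<lambda>\<tau>'. simulates us \<tau>' (F \<sigma>) \<and> \<tau>' 2 = \<tau> 2) b"
  shows "runs_to R (wrap c) (init (VPair (val_list us) v)) (\<lambda>\<tau>'. \<tau>' 0 = F (init v) 0) (b + 9)"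
  unfolding wrap_def
  apply (rule runs_to_Seq[where b = 3 and b' = "b + 6"
      and Q = "\<lambda>\<tau>. \<tau> = (init (VPair (val_list us) v))(1 := val_list us)"])
    apply (rule runs_to_Assign, simp, simp)
   apply (rule runs_to_Seq[where b = 3 and b' = "b + 3"
      and Q = "\<lambda>\<tau>. \<tau> = (init (VPair (val_list us) v))(1 := val_list us, 3 := v)"])
     apply (rule runs_to_Assign, simp, simp)
    apply (rule runs_to_Seq[where b = b and b' = 3 and Q = "\<lambda>\<tau>'. simulates us \<tau>' (F (init v))"])
      apply (rule runs_to_mono, rule c[where \<sigma> = "init v"])
        apply (auto simp: simulates_def intro: runs_to_Assign)
  apply (rule runs_to_Assign)
   apply (metis add_0 fun_upd_same eval_exp.simps(1))
  apply simp
  done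

text \<open>The conclusion that register 2 is returned unchanged makes the induction work: inside a
  loop the remaining rounds of all enclosing loops lie on that stack.\<close>

lemma compile_runs_to:
  assumes "length us = N" "simulates us \<tau> \<sigma>"
  shows "runs_to R (compile c) \<tau> (\<lambda>\<tau>'. simulates us \<tau>' (dsem R N c \<sigma>) \<and> \<tau>' 2 = \<tau> 2)
           (tbound (field_cost R) N c)"
  using assms(2)
proof (induction c arbitrary: \<tau> \<sigma>)
  case DSkip
  then show ?case by (auto simp: runs_to_def)
next
  case (DAssign x e)
  then show ?case
    by (auto intro!: runs_to_Assign simp: eval_exp_shift[OF DAssign] simp: simulates_def)
next
  case (DSeq c d)
  show ?case unfolding compile.simps dsem.simps tbound.simps
    by (rule runs_to_Seq[OF DSeq.IH(1)[OF DSeq.prems] _ order_refl])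
       (rule runs_to_mono[OF DSeq.IH(2)], auto)
next
  case (DIf e c d)
  show ?case unfolding compile.simps dsem.simps tbound.simps eval_exp_shift[OF DIf.prems]
    using DIf.IH[OF DIf.prems] eval_exp_shift[OF DIf.prems]
    by (auto intro!: runs_to_If)
next
  case (DLoop c)
  let ?S = "\<lambda>i. (dsem R N c ^^ i) \<sigma>"
  \<comment> \<open>After \<open>j\<close> of the \<open>N\<close> rounds, the top of the stack
    holds the \<open>N - j\<close> cells not yet consumed.\<close>
  define J where "J = (\<lambda>i \<tau>'. \<exists>j. i + j = N \<and> simulates us \<tau>' (?S j) \<and>
    \<tau>' 2 = VPair (val_list (drop j us)) (\<tau> 2))"
  show ?case unfolding compile.simps dsem.simps tbound.simps
  proof (rule runs_to_Seq)
    show "runs_to R (Assign 2 (Pair_Exp (Var 1) (Var 2))) \<tau> (J N) 4"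
      using DLoop.prems by (auto intro!: runs_to_Assign exI[of _ 0] simp: J_def simulates_def)
    fix \<tau>' assume J: "J N \<tau>'"
    show "runs_to R (Seq (While (Hd (Var 2))
              (Seq (Assign 2 (Pair_Exp (Tl (Hd (Var 2))) (Tl (Var 2)))) (compile c)))
         (Assign 2 (Tl (Var 2)))) \<tau>' (\<lambda>\<tau>'. simulates us \<tau>' (?S N) \<and> \<tau>' 2 = \<tau> 2)
         (6 + N * (10 + tbound (field_cost R) N c))"
    proof (rule runs_to_Seq[where Q = "J 0"])
      show "runs_to R (While (Hd (Var 2))
              (Seq (Assign 2 (Pair_Exp (Tl (Hd (Var 2))) (Tl (Var 2)))) (compile c))) \<tau>' (J 0)
              (3 + N * (10 + tbound (field_cost R) N c))"
      proof (rule runs_to_While[where b = "7 + tbound (field_cost R) N c" and n = N])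
        fix i \<tau>1 assume "J (Suc i) \<tau>1"
        then obtain j where j: "Suc i + j = N" "simulates us \<tau>1 (?S j)"
          "\<tau>1 2 = VPair (val_list (drop j us)) (\<tau> 2)" by (auto simp: J_def)
        then have d: "drop j us = us ! j # drop (Suc j) us"
          using assms(1) by (intro Cons_nth_drop_Suc[symmetric]) simp
        let ?\<tau> = "\<tau>1(2 := VPair (val_list (drop (Suc j) us)) (\<tau> 2))"
        have s: "simulates us ?\<tau> (?S j)" using j(2) by (simp add: simulates_def)
        have a: "runs_to R (Assign 2 (Pair_Exp (Tl (Hd (Var 2))) (Tl (Var 2)))) \<tau>1 (\<lambda>\<tau>'. \<tau>' = ?\<tau>) 7"
          by (rule runs_to_Assign) (use j d in auto)
        have "runs_to R (Seq (Assign 2 (Pair_Exp (Tl (Hd (Var 2))) (Tl (Var 2)))) (compile c)) \<tau>1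
           (\<lambda>\<tau>'. simulates us \<tau>' (dsem R N c (?S j)) \<and> \<tau>' 2 = ?\<tau> 2) (7 + tbound (field_cost R) N c)"
          by (rule runs_to_Seq[OF a _ order_refl], hypsubst, rule DLoop.IH[OF s])
        then have "runs_to R (Seq (Assign 2 (Pair_Exp (Tl (Hd (Var 2))) (Tl (Var 2)))) (compile c)) \<tau>1
           (J i) (7 + tbound (field_cost R) N c)"
          by (rule runs_to_mono) (use j in \<open>auto simp: J_def intro!: exI[of _ "Suc j"]\<close>)
        then show "eval_exp R (Hd (Var 2)) \<tau>1 \<noteq> VNil \<and>
           runs_to R (Seq (Assign 2 (Pair_Exp (Tl (Hd (Var 2))) (Tl (Var 2)))) (compile c)) \<tau>1
           (J i) (7 + tbound (field_cost R) N c)"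
          using j d by simp
      qed (use J in \<open>auto simp: J_def assms(1)\<close>)
      fix \<tau>2 assume "J 0 \<tau>2"
      then show "runs_to R (Assign 2 (Tl (Var 2))) \<tau>2
          (\<lambda>\<tau>'. simulates us \<tau>' (?S N) \<and> \<tau>' 2 = \<tau> 2) 3"
        by (auto intro!: runs_to_Assign simp: J_def simulates_def)
    qed simp
  qed simp
next
  case (DCall x c e)
  note w = wrap_runs_to[where F = "dsem R N c", OF DCall.IH, where v = "eval_exp R e \<sigma>"]
  have "eval_exp R (Pair_Exp (Var 1) (shift e)) \<tau> = VPair (val_list us) (eval_exp R e \<sigma>)"
    using DCall.prems eval_exp_shift[OF DCall.prems] by (simp add: simulates_def)
  then show ?case unfolding compile.simps tbound.simps
    by (intro runs_to_Call[where b = "tbound (field_cost R) N c + 9"])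
       (use w DCall.prems in \<open>auto elim!: runs_to_mono simp: simulates_def call_def\<close>)
qed

lemma call_runs_to:
  assumes "length us = N"
  shows "runs_to R (wrap (compile c)) (init (VPair (val_list us) v))
           (\<lambda>\<tau>'. \<tau>' 0 = call R N c v) (tbound (field_cost R) N c + 9)"
  unfolding call_def by (rule wrap_runs_to) (rule compile_runs_to[OF assms])


subsection \<open>Polynomial bounds\<close>

definition poly_bounded :: "(nat \<Rightarrow> nat \<Rightarrow> nat) \<Rightarrow> bool" where
  "poly_bounded f \<longleftrightarrow> (\<exists>C d. \<forall>\<kappa> N. f \<kappa> N \<le> C * (\<kappa> + N + 1) ^ d)"

lemma poly_bounded_const: "poly_bounded (\<lambda>_ _. c)"
  unfolding poly_bounded_def by (rule exI[of _ c], rule exI[of _ 0]) simp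

lemma poly_bounded_fst: "poly_bounded (\<lambda>\<kappa> _. \<kappa>)"
  unfolding poly_bounded_def by (rule exI[of _ 1], rule exI[of _ 1]) simp

lemma poly_bounded_snd: "poly_bounded (\<lambda>_ N. N)"
  unfolding poly_bounded_def by (rule exI[of _ 1], rule exI[of _ 1]) simp

lemma poly_bounded_add:
  assumes "poly_bounded f" "poly_bounded g"
  shows "poly_bounded (\<lambda>\<kappa> N. f \<kappa> N + g \<kappa> N)"
proof -
  obtain C d C' d' where b: "\<And>\<kappa> N. f \<kappa> N \<le> C * (\<kappa> + N + 1) ^ d"
    "\<And>\<kappa> N. g \<kappa> N \<le> C' * (\<kappa> + N + 1) ^ d'"
    using assms unfolding poly_bounded_def by blast
  have "f \<kappa> N + g \<kappa> N \<le> (C + C') * (\<kappa> + N + 1) ^ (d + d')" for \<kappa> N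
  proof -
    have "C * (\<kappa> + N + 1) ^ d \<le> C * (\<kappa> + N + 1) ^ (d + d')"
      "C' * (\<kappa> + N + 1) ^ d' \<le> C' * (\<kappa> + N + 1) ^ (d + d')"
      by (intro mult_left_mono power_increasing; simp)+
    then show ?thesis using b[of \<kappa> N] unfolding distrib_right by linarith
  qed
  then show ?thesis unfolding poly_bounded_def by blast
qed

lemma poly_bounded_mult:
  assumes "poly_bounded f" "poly_bounded g"
  shows "poly_bounded (\<lambda>\<kappa> N. f \<kappa> N * g \<kappa> N)"
proof -
  obtain C d C' d' where b: "\<And>\<kappa> N. f \<kappa> N \<le> C * (\<kappa> + N + 1) ^ d"
    "\<And>\<kappa> N. g \<kappa> N \<le> C' * (\<kappa> + N + 1) ^ d'"
    using assms unfolding poly_bounded_def by blast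
  have "f \<kappa> N * g \<kappa> N \<le> (C * C') * (\<kappa> + N + 1) ^ (d + d')" for \<kappa> N
    using mult_mono[OF b(1)[of \<kappa> N] b(2)[of \<kappa> N]] by (simp add: power_add mult_ac)
  then show ?thesis unfolding poly_bounded_def by blast
qed

lemmas poly_bounded_intros =
  poly_bounded_const poly_bounded_fst poly_bounded_snd poly_bounded_add poly_bounded_mult

lemma poly_bounded_exp_cost: "poly_bounded (\<lambda>\<kappa> N. exp_cost \<kappa> e)"
  by (induction e) (simp_all del: add_Suc add_Suc_right add: poly_bounded_intros)

text \<open>Every equation of \<open>tbound\<close> is a sum or product of bounded functions; the
  \<open>Suc\<close> rules are disabled so that sums keep the shape of the closure rules.\<close>

lemma poly_bounded_tbound: "poly_bounded (\<lambda>\<kappa> N. tbound \<kappa> N c)"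
  by (induction c)
     (simp_all del: add_Suc add_Suc_right add: poly_bounded_intros poly_bounded_exp_cost)


section \<open>Drift argument for a randomized loop: almost sure termination and expected
  cost\<close>

section \<open>Expected running time of a randomized loop\<close>

text \<open>Monotone convergence along a chain of subdistributions. The chain may be uncountable,
  but the support of its least upper bound is countable, which allows the exchange of supremum and
  integral.\<close>

lemma nn_integral_lub_spmf:
  assumes chain: "Complete_Partial_Order.chain (ord_spmf (=)) Y" and Y: "Y \<noteq> {}"
  shows "(\<integral>\<^sup>+ x. G x \<partial>measure_spmf (lub_spmf Y)) = (SUP p\<in>Y. \<integral>\<^sup>+ x. G x \<partial>measure_spmf p)"
    (is "?lhs = ?rhs")
proof -
  let ?M = "count_space (set_spmf (lub_spmf Y))"
  have "?lhs = \<integral>\<^sup>+ x. ennreal (spmf (lub_spmf Y) x) * G x \<partial>?M"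
    by (simp add: nn_integral_measure_spmf')
  also have "\<dots> = \<integral>\<^sup>+ x. (SUP y\<in>Y. ennreal (spmf y x) * G x) \<partial>?M"
    by (simp add: ennreal_spmf_lub_spmf[OF chain Y] SUP_mult_right_ennreal)
  also from Y have "\<dots> = (SUP y\<in>Y. \<integral>\<^sup>+ x. ennreal (spmf y x) * G x \<partial>?M)"
  proof (rule nn_integral_monotone_convergence_SUP_countable)
    have "(\<lambda>i x. ennreal (spmf i x) * G x) ` Y
        = (\<lambda>f x. f x * G x) ` (\<lambda>p x. ennreal (spmf p x)) ` Y"
      by (simp add: image_image)
    also have "Complete_Partial_Order.chain (\<le>) \<dots>"
      using chain_ord_spmf_eqD[OF chain]
      by (rule chain_imageI) (auto simp: le_fun_def intro: mult_right_mono)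
    finally show "Complete_Partial_Order.chain (\<le>) ((\<lambda>i x. ennreal (spmf i x) * G x) ` Y)" .
  qed simp
  also have "\<dots> = (SUP y\<in>Y. \<integral>\<^sup>+ x. ennreal (spmf y x) * G x \<partial>count_space UNIV)"
    by (auto simp: nn_integral_count_space_indicator set_lub_spmf[OF chain] spmf_eq_0_set_spmf
        split: split_indicator intro!: arg_cong [of _ _ Sup] image_cong nn_integral_cong)
  also have "\<dots> = ?rhs"
    by (simp add: nn_integral_measure_spmf)
  finally show ?thesis .
qed

text \<open>Makes upper bounds on expectations provable by fixpoint induction on
  \<open>iterate\<close>.\<close>

lemma admissible_nn_integral_le:
  "spmf.admissible (\<lambda>f. \<forall>x. P x \<longrightarrow> (\<integral>\<^sup>+ y. G y \<partial>measure_spmf (f x)) \<le> b x)"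
proof (rule ccpo.admissibleI)
  fix A :: "('a \<Rightarrow> 'b spmf) set"
  assume chain: "Complete_Partial_Order.chain (fun_ord (ord_spmf (=))) A" and A: "A \<noteq> {}"
    and le: "\<forall>f\<in>A. \<forall>x. P x \<longrightarrow> (\<integral>\<^sup>+ y. G y \<partial>measure_spmf (f x)) \<le> b x"
  show "\<forall>x. P x \<longrightarrow> (\<integral>\<^sup>+ y. G y \<partial>measure_spmf (fun_lub lub_spmf A x)) \<le> b x"
  proof safe
    fix x assume "P x"
    have eq: "{y. \<exists>f\<in>A. y = f x} = (\<lambda>f. f x) ` A" by auto
    have c: "Complete_Partial_Order.chain (ord_spmf (=)) ((\<lambda>f. f x) ` A)"
      using chain by (rule chain_imageI) (simp add: fun_ord_def)
    show "(\<integral>\<^sup>+ y. G y \<partial>measure_spmf (fun_lub lub_spmf A x)) \<le> b x"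
      unfolding fun_lub_def eq using le A \<open>P x\<close>
      by (subst nn_integral_lub_spmf[OF c]) (auto intro!: SUP_least)
  qed
qed

lemma nn_integral_bind_map_spmf:
  "(\<integral>\<^sup>+ z. G z \<partial>measure_spmf (bind_spmf p (\<lambda>x. map_spmf (f x) (q x))))
   = (\<integral>\<^sup>+ x. \<integral>\<^sup>+ y. G (f x y) \<partial>measure_spmf (q x) \<partial>measure_spmf p)"
  by (simp add: measure_spmf_bind nn_integral_bind[where B = "count_space UNIV"] o_def
      space_subprob_algebra subprob_space_measure_spmf)

text \<open>The potential never grows and drops with probability at least 1/3 per round, so at most
  three rounds are expected per unit of potential, each costing at most \<open>k + B\<close>. This
  is the shape of \<open>cost_bound\<close>.\<close>

locale progressing_loop =
  fixes test :: "'s \<Rightarrow> bool" and k :: nat and body :: "'s \<Rightarrow> ('s \<times> nat) spmf"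
    and I :: "'s \<Rightarrow> bool" and \<Phi> :: "'s \<Rightarrow> nat" and B :: nat
  assumes body_lossless: "\<And>\<sigma>. I \<sigma> \<Longrightarrow> test \<sigma> \<Longrightarrow> lossless_spmf (body \<sigma>)"
    and body_inv: "\<And>\<sigma> \<sigma>' k'. I \<sigma> \<Longrightarrow> test \<sigma> \<Longrightarrow> (\<sigma>', k') \<in> set_spmf (body \<sigma>) \<Longrightarrow>
      I \<sigma>' \<and> \<Phi> \<sigma>' \<le> \<Phi> \<sigma> \<and> k' \<le> B"
    and body_progress: "\<And>\<sigma>. I \<sigma> \<Longrightarrow> test \<sigma> \<Longrightarrow>
      measure (measure_spmf (body \<sigma>)) {y. \<Phi> (fst y) < \<Phi> \<sigma>} \<ge> 1/3"
begin

abbreviation cost_bound :: "'s \<Rightarrow> nat" where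
  "cost_bound \<sigma> \<equiv> k + 3 * (k + B) * \<Phi> \<sigma>"

text \<open>The infinite penalty lets one finite bound yield two facts: the expected cost, and that
  every final state satisfies the invariant and fails the test.\<close>

definition good_cost :: "'s \<times> nat \<Rightarrow> ennreal" where
  "good_cost y = (if I (fst y) \<and> \<not> test (fst y) then of_nat (snd y) else \<infinity>)"

text \<open>One round pays at most \<open>k + B\<close>, while \<open>3 * (k + B) * \<Phi>\<close>
  drops by at least \<open>3 * (k + B)\<close> with probability 1/3. The expected saving covers the
  payment.\<close>

lemma body_cost_bound:
  assumes "I \<sigma>" "test \<sigma>"
  shows "(\<integral>\<^sup>+ y. of_nat (k + snd y + cost_bound (fst y)) \<partial>measure_spmf (body \<sigma>))
     \<le> of_nat (cost_bound \<sigma>)" (is "?X \<le> _")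
proof -
  let ?M = "measure_spmf (body \<sigma>)" and ?D = "{y. \<Phi> (fst y) < \<Phi> \<sigma>}"
  \<comment> \<open>The saving is added on the left, because subtraction on \<open>ennreal\<close>
    is truncated.\<close>
  have pw: "of_nat (k + snd y + cost_bound (fst y)) + of_nat (3 * (k + B)) * indicator ?D y
      \<le> (of_nat (k + B) + of_nat (cost_bound \<sigma>) :: ennreal)" if "y \<in> set_spmf (body \<sigma>)" for y
  proof -
    have y: "\<Phi> (fst y) \<le> \<Phi> \<sigma>" "snd y \<le> B" using body_inv[OF assms, of "fst y" "snd y"] that by auto
    have "k + snd y + cost_bound (fst y) + 3 * (k + B) * (if y \<in> ?D then 1 else 0)
        \<le> (k + B) + cost_bound \<sigma>"
    proof (cases "y \<in> ?D")
      case True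
      then have "3 * (k + B) * (\<Phi> (fst y) + 1) \<le> 3 * (k + B) * \<Phi> \<sigma>"
        by (intro mult_left_mono) auto
      with True y(2) show ?thesis by (simp add: algebra_simps)
    next
      case False
      then have "3 * (k + B) * \<Phi> (fst y) \<le> 3 * (k + B) * \<Phi> \<sigma>"
        using y(1) by (intro mult_left_mono) auto
      with False y(2) show ?thesis by (simp add: algebra_simps)
    qed
    then have "of_nat (k + snd y + cost_bound (fst y) + 3 * (k + B) * (if y \<in> ?D then 1 else 0))
        \<le> (of_nat ((k + B) + cost_bound \<sigma>) :: ennreal)"
      by (simp only: of_nat_le_iff)
    then show ?thesis by (auto simp: indicator_def)
  qed
  have one: "emeasure ?M (space ?M) = 1"
    using body_lossless[OF assms] by (simp add: measure_spmf.emeasure_eq_measure lossless_spmf_def)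
  have "?X + of_nat (3 * (k + B)) * emeasure ?M ?D
      = (\<integral>\<^sup>+ y. of_nat (k + snd y + cost_bound (fst y)) + of_nat (3 * (k + B)) * indicator ?D y \<partial>?M)"
    by (subst nn_integral_add) (simp_all add: nn_integral_cmult)
  also have "\<dots> \<le> (\<integral>\<^sup>+ y. of_nat (k + B) + of_nat (cost_bound \<sigma>) \<partial>?M)"
    using pw by (intro nn_integral_mono_AE) (auto intro!: AE_I2 simp: AE_measure_spmf_iff)
  also have "\<dots> = of_nat (k + B) + of_nat (cost_bound \<sigma>)"
    by (simp only: nn_integral_const one mult_1_right)
  finally have 1: "?X + of_nat (3 * (k + B)) * emeasure ?M ?D
      \<le> of_nat (k + B) + of_nat (cost_bound \<sigma>)" .
  have "(of_nat (k + B) :: ennreal) = ennreal (real (k + B))"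
    by (simp only: ennreal_of_nat_eq_real_of_nat)
  also have "\<dots> \<le> ennreal (real (3 * (k + B)) * measure ?M ?D)"
  proof (rule ennreal_leI)
    have "real (3 * (k + B)) * (1/3) \<le> real (3 * (k + B)) * measure ?M ?D"
      using body_progress[OF assms] by (intro mult_left_mono) auto
    then show "real (k + B) \<le> real (3 * (k + B)) * measure ?M ?D" by simp
  qed
  also have "\<dots> = of_nat (3 * (k + B)) * emeasure ?M ?D"
    by (simp only: ennreal_mult'' measure_nonneg measure_spmf.emeasure_eq_measure
        ennreal_of_nat_eq_real_of_nat)
  finally have "?X + of_nat (k + B) \<le> of_nat (k + B) + of_nat (cost_bound \<sigma>)"
    using 1 by (meson add_left_mono order_trans)
  then have "of_nat (k + B) + ?X \<le> of_nat (k + B) + of_nat (cost_bound \<sigma>)"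
    by (simp only: add.commute)
  then show ?thesis
    by (simp only: ennreal_add_left_cancel_le) (simp del: of_nat_add of_nat_mult)
qed

lemma iterate_cost:
  assumes "I \<sigma>"
  shows "(\<integral>\<^sup>+ y. good_cost y \<partial>measure_spmf (iterate test k body \<sigma>)) \<le> of_nat (cost_bound \<sigma>)"
proof -
  have "\<forall>\<sigma>. I \<sigma> \<longrightarrow>
    (\<integral>\<^sup>+ y. good_cost y \<partial>measure_spmf (iterate test k body \<sigma>)) \<le> of_nat (cost_bound \<sigma>)"
  proof (induction rule: iterate.fixp_induct)
    case 1
    show ?case by (rule admissible_nn_integral_le)
  next
    case 2
    show ?case by simp
  next
    case (3 it)
    show ?case
    proof safe
      fix \<sigma> assume I: "I \<sigma>"
      show "(\<integral>\<^sup>+ y. good_cost y \<partial>measure_spmf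
          (if test \<sigma> then bind_spmf (body \<sigma>) (\<lambda>(\<sigma>1, k1).
             map_spmf (\<lambda>(\<sigma>2, k2). (\<sigma>2, k + k1 + k2)) (it \<sigma>1))
           else return_spmf (\<sigma>, k))) \<le> of_nat (cost_bound \<sigma>)"
      proof (cases "test \<sigma>")
        case True
        have "(\<integral>\<^sup>+ y. good_cost y \<partial>measure_spmf (bind_spmf (body \<sigma>) (\<lambda>(\<sigma>1, k1).
             map_spmf (\<lambda>(\<sigma>2, k2). (\<sigma>2, k + k1 + k2)) (it \<sigma>1))))
          = (\<integral>\<^sup>+ x. \<integral>\<^sup>+ y. good_cost (fst y, k + snd x + snd y) \<partial>measure_spmf (it (fst x))
               \<partial>measure_spmf (body \<sigma>))"
          by (simp add: split_def nn_integral_bind_map_spmf del: nn_integral_map_spmf)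
        also have "\<dots> \<le> (\<integral>\<^sup>+ x. of_nat (k + snd x + cost_bound (fst x)) \<partial>measure_spmf (body \<sigma>))"
        proof (intro nn_integral_mono_AE, unfold AE_measure_spmf_iff, safe)
          fix x assume x: "x \<in> set_spmf (body \<sigma>)"
          then have I': "I (fst x)" using body_inv[OF I True, of "fst x" "snd x"] by simp
          have "(\<integral>\<^sup>+ y. good_cost (fst y, k + snd x + snd y) \<partial>measure_spmf (it (fst x)))
            = (\<integral>\<^sup>+ y. of_nat (k + snd x) + good_cost y \<partial>measure_spmf (it (fst x)))"
            by (intro nn_integral_cong) (simp add: good_cost_def)
          \<comment> \<open>Only an inequality: the approximation \<open>it\<close> of the loop may
            have total mass below one.\<close>
          also have "\<dots> \<le> of_nat (k + snd x)
              + (\<integral>\<^sup>+ y. good_cost y \<partial>measure_spmf (it (fst x)))"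
            by (subst nn_integral_add)
               (auto intro!: add_right_mono mult_left_le measure_spmf.subprob_emeasure_le_1
                 simp del: of_nat_add space_measure_spmf)
          also have "\<dots> \<le> of_nat (k + snd x) + of_nat (cost_bound (fst x))"
            using 3 I' by (intro add_left_mono) auto
          finally show "(\<integral>\<^sup>+ y. good_cost (fst y, k + snd x + snd y) \<partial>measure_spmf (it (fst x)))
             \<le> of_nat (k + snd x + cost_bound (fst x))"
            by (simp only: of_nat_add)
        qed
        also have "\<dots> \<le> of_nat (cost_bound \<sigma>)" by (rule body_cost_bound[OF I True])
        finally show ?thesis using True by simp
      next
        case False
        then show ?thesis using I by (simp add: good_cost_def measure_spmf_return_spmf nn_integral_return)
      qed
    qed
  qed
  with assms show ?thesis by blast
qed

text \<open>Induction on a bound of the potential. If x is the infimum of the termination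
  probabilities over the states below the bound, one round gives probability at least 1/3 + 2/3 x in
  each of them: with a drop the induction hypothesis yields 1, without one x remains.\<close>

lemma iterate_lossless:
  assumes "I \<sigma>"
  shows "lossless_spmf (iterate test k body \<sigma>)"
proof -
  let ?w = "\<lambda>\<sigma>. weight_spmf (iterate test k body \<sigma>)"
  have unroll: "?w \<sigma> = (\<integral> y. ?w (fst y) \<partial>measure_spmf (body \<sigma>))" if "test \<sigma>" for \<sigma>
  proof -
    have "iterate test k body \<sigma> = bind_spmf (body \<sigma>) (\<lambda>y.
        map_spmf (\<lambda>z. (fst z, k + snd y + snd z)) (iterate test k body (fst y)))"
      using that by (subst iterate.simps) (simp add: split_def)
    then show ?thesis by (simp only: weight_bind_spmf o_def weight_map_spmf)
  qed
  have "\<forall>\<sigma>. I \<sigma> \<longrightarrow> \<Phi> \<sigma> \<le> n \<longrightarrow> ?w \<sigma> = 1" for n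
  proof (induction n rule: less_induct)
    case (less n)
    \<comment> \<open>The element 1 keeps the set nonempty, so that its infimum is
      meaningful.\<close>
    define S where "S = insert 1 (?w ` {\<sigma>. I \<sigma> \<and> \<Phi> \<sigma> \<le> n})"
    have bdd: "bdd_below S"
      by (rule bdd_belowI[of _ 0]) (unfold S_def, auto simp: weight_spmf_nonneg)
    have S01: "0 \<le> Inf S" "Inf S \<le> 1"
      using cInf_lower[OF _ bdd, of 1]
      by (auto intro!: cInf_greatest simp: S_def weight_spmf_nonneg)
    have ge: "1/3 + 2/3 * Inf S \<le> ?w \<sigma>" if I: "I \<sigma>" and n: "\<Phi> \<sigma> \<le> n" for \<sigma>
    proof (cases "test \<sigma>")
      case False
      then have "?w \<sigma> = 1" by (simp add: iterate.simps)
      with S01 show ?thesis by simp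
    next
      case True
      let ?M = "measure_spmf (body \<sigma>)" and ?D = "{y. \<Phi> (fst y) < \<Phi> \<sigma>}"
      have wt: "measure ?M (space ?M) = 1"
        using body_lossless[OF I True] by (simp add: lossless_spmf_def)
      have int: "integrable ?M (\<lambda>y. Inf S + (1 - Inf S) * indicator ?D y)"
        by (intro measure_spmf.integrable_const_bound[where B = "\<bar>Inf S\<bar> + \<bar>1 - Inf S\<bar>"])
           (auto simp: indicator_def)
      have int': "integrable ?M (indicat_real ?D)"
        by (intro measure_spmf.integrable_const_bound[where B = 1]) (auto simp: indicator_def)
      have "1/3 + 2/3 * Inf S \<le> Inf S + (1 - Inf S) * measure ?M ?D"
      proof -
        have "(1 - Inf S) * (1/3) \<le> (1 - Inf S) * measure ?M ?D"
          using body_progress[OF I True] S01 by (intro mult_left_mono) auto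
        then have "1/3 - Inf S * (1/3) \<le> (1 - Inf S) * measure ?M ?D"
          by (simp only: left_diff_distrib mult_1)
        then show ?thesis by linarith
      qed
      also have "\<dots> = (\<integral> y. Inf S + (1 - Inf S) * indicator ?D y \<partial>?M)"
        using wt int' by (subst Bochner_Integration.integral_add) auto
      also have "\<dots> \<le> (\<integral> y. ?w (fst y) \<partial>?M)"
      proof (rule integral_mono_AE[OF int])
        show "integrable ?M (\<lambda>y. ?w (fst y))"
          by (intro measure_spmf.integrable_const_bound[where B = 1])
             (auto simp: weight_spmf_nonneg weight_spmf_le_1)
        show "AE y in ?M. Inf S + (1 - Inf S) * indicator ?D y \<le> ?w (fst y)"
          unfolding AE_measure_spmf_iff
        proof
          fix y assume y: "y \<in> set_spmf (body \<sigma>)"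
          then have I': "I (fst y)" "\<Phi> (fst y) \<le> \<Phi> \<sigma>"
            using body_inv[OF I True, of "fst y" "snd y"] by auto
          show "Inf S + (1 - Inf S) * indicator ?D y \<le> ?w (fst y)"
          proof (cases "y \<in> ?D")
            case True
            then have "\<Phi> (fst y) < n" using n by simp
            then have "?w (fst y) = 1" using less.IH[of "\<Phi> (fst y)"] I'(1) by blast
            then show ?thesis using True by simp
          next
            case False
            have "Inf S \<le> ?w (fst y)"
              using I' n by (intro cInf_lower[OF _ bdd]) (auto simp: S_def)
            then show ?thesis using False by simp
          qed
        qed
      qed
      also have "\<dots> = ?w \<sigma>" using unroll[OF True] by simp
      finally show ?thesis .
    qed
    \<comment> \<open>The infimum satisfies the lower bound as well, which forces it to be
      1.\<close>
    have "1/3 + 2/3 * Inf S \<le> Inf S"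
      using ge S01 by (intro cInf_greatest) (auto simp: S_def)
    then have "Inf S = 1" using S01 by simp
    then show ?case
      using cInf_lower[OF _ bdd] by (auto simp: S_def intro!: antisym weight_spmf_le_1)
  qed
  then show ?thesis using assms by (auto simp: lossless_spmf_def)
qed

text \<open>A function with finite integral is finite on the support, so the penalty of
  \<open>good_cost\<close> never occurs there.\<close>

lemma iterate_set:
  assumes "I \<sigma>" "y \<in> set_spmf (iterate test k body \<sigma>)"
  shows "I (fst y) \<and> \<not> test (fst y)"
proof (rule ccontr)
  assume "\<not> ?thesis"
  then have "good_cost y = \<infinity>" by (simp add: good_cost_def)
  moreover have "(\<integral>\<^sup>+ y. good_cost y \<partial>measure_spmf (iterate test k body \<sigma>)) < \<infinity>"
    using iterate_cost[OF assms(1)] of_nat_less_top[of "cost_bound \<sigma>"]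
    unfolding infinity_ennreal_def by (rule order_le_less_trans)
  then have "AE y in measure_spmf (iterate test k body \<sigma>). good_cost y \<noteq> \<infinity>"
    by (intro nn_integral_noteq_infinite) auto
  ultimately show False using assms(2) by (simp add: AE_measure_spmf_iff)
qed

lemma iterate_expected_cost:
  assumes "I \<sigma>"
  shows "(\<integral>\<^sup>+ y. of_nat (snd y) \<partial>measure_spmf (iterate test k body \<sigma>)) \<le> of_nat (cost_bound \<sigma>)"
proof -
  have "(\<integral>\<^sup>+ y. of_nat (snd y) \<partial>measure_spmf (iterate test k body \<sigma>))
     \<le> (\<integral>\<^sup>+ y. good_cost y \<partial>measure_spmf (iterate test k body \<sigma>))"
    by (intro nn_integral_mono) (auto simp: good_cost_def)
  from order_trans[OF this iterate_cost[OF assms]] show ?thesis .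
qed

end


section \<open>Functional models of the list and polynomial algorithms, and programs computing
  them\<close>

section \<open>Programs for lists of field elements\<close>

lemma dloop:
  assumes "Q st \<sigma>" "\<And>st \<sigma>. Q st \<sigma> \<Longrightarrow> Q (F st) (dsem R N c \<sigma>)"
  shows "Q ((F ^^ N) st) (dsem R N (DLoop c) \<sigma>)"
proof -
  have "Q ((F ^^ m) st) ((dsem R N c ^^ m) \<sigma>)" for m
    using assms by (induction m) auto
  then show ?thesis by simp
qed

text \<open>A loop over a list of length at most \<open>N\<close> in a language whose loops all run
  \<open>N\<close> times: once the list is exhausted, the remaining rounds idle.\<close>

definition dfor :: "nat \<Rightarrow> nat \<Rightarrow> dcom \<Rightarrow> dcom" where
  "dfor y x c = DLoop (DIf (Var x) (y ::= Hd (Var x) ;;; x ::= Tl (Var x) ;;; c) DSkip)"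

text \<open>The encoding is a parameter because loops run over field elements, bits and unary
  numbers alike. The second part of \<open>step\<close> forbids the body to touch the list that
  drives the loop.\<close>

lemma dfor:
  assumes "\<sigma> x = val_list (map enc as)" "length as \<le> N" "x \<noteq> y" "Q as st \<sigma>"
    and step: "\<And>a r st \<sigma>. Q (a # r) st \<sigma> \<Longrightarrow> a \<in> set as \<Longrightarrow>
      Q r (F a st) (dsem R N c (\<sigma>(y := enc a, x := val_list (map enc r)))) \<and>
      dsem R N c (\<sigma>(y := enc a, x := val_list (map enc r))) x = val_list (map enc r)"
  shows "Q [] (fold F as st) (dsem R N (dfor y x c) \<sigma>)"
proof -
  define b where "b = dsem R N (DIf (Var x) (y ::= Hd (Var x) ;;; x ::= Tl (Var x) ;;; c) DSkip)"
  have stop: "(b ^^ m) \<sigma> = \<sigma>" if "\<sigma> x = VNil" for m \<sigma>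
    using that by (induction m) (auto simp: b_def)
  have go: "b \<sigma> = dsem R N c (\<sigma>(y := enc a, x := val_list (map enc r)))"
    if "\<sigma> x = val_list (map enc (a # r))" for a r \<sigma>
    using that assms(3) by (simp add: b_def fun_upd_twist)
  have "Q [] (fold F r st) ((b ^^ m) \<sigma>)"
    if "\<sigma> x = val_list (map enc r)" "length r \<le> m" "Q r st \<sigma>" "set r \<subseteq> set as" for r m \<sigma> st
    using that
  proof (induction m arbitrary: r \<sigma> st)
    case 0
    then show ?case by simp
  next
    case (Suc m)
    show ?case
    proof (cases r)
      case Nil
      then show ?thesis using Suc.prems(1,3) stop[of \<sigma> "Suc m"] by (simp del: funpow.simps)
    next
      case (Cons a r')
      then show ?thesis
        using step[of a r' st \<sigma>] Suc.prems Suc.IH[of "b \<sigma>" r' "F a st"] go[of \<sigma> a r']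
        by (simp add: funpow_swap1)
    qed
  qed
  then show ?thesis using assms(1,2,4) by (simp add: dfor_def b_def)
qed

lemma elem_list_simps [simp]:
  "elem_list [] = VNil"
  "elem_list (a # as) = VPair (VElem a) (elem_list as)"
  "elem_list as = VNil \<longleftrightarrow> as = []"
  "val_tl (elem_list as) = elem_list (tl as)"
  by (cases as; simp add: elem_list_def)+

lemma val_hd_elem_list [simp]: "as \<noteq> [] \<Longrightarrow> val_hd (elem_list as) = VElem (hd as)"
  by (cases as) simp_all

lemma unary_simps [simp]:
  "unary 0 = VNil"
  "unary (Suc k) = VPair VNil (unary k)"
  "unary k = VNil \<longleftrightarrow> k = 0"
  "val_tl (unary k) = unary (k - 1)"
  by (cases k; simp add: unary_def)+

definition finv :: "'a ring \<Rightarrow> 'a \<Rightarrow> 'a" where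
  "finv R a = (if a = \<zero>\<^bsub>R\<^esub> then \<zero>\<^bsub>R\<^esub> else inv\<^bsub>R\<^esub> a)"

lemma eval_F_Inv [simp]: "eval_exp R (F_Inv e) \<sigma> = lift1 (finv R) (eval_exp R e \<sigma>)"
  by (simp add: finv_def[abs_def])

declare eval_exp.simps(11) [simp del]

abbreviation pair3 :: "exp \<Rightarrow> exp \<Rightarrow> exp \<Rightarrow> exp" where
  "pair3 e f g \<equiv> Pair_Exp e (Pair_Exp f g)"

definition REV :: dcom where
  "REV = 1 ::= Var 0 ;;; 0 ::= Nil_Exp ;;; dfor 2 1 (0 ::= Pair_Exp (Var 2) (Var 0))"

lemma call_REV:
  assumes "length as \<le> N"
  shows "call R N REV (val_list (map enc as)) = val_list (map enc (rev as))"
proof -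
  define Q where "Q = (\<lambda>(r :: 'a list) st (\<sigma> :: nat \<Rightarrow> 'b val). \<sigma> 0 = val_list (map enc st))"
  have "Q [] (fold Cons as [])
     (dsem R N (dfor 2 1 (0 ::= Pair_Exp (Var 2) (Var 0)))
       ((init (val_list (map enc as)))(1 := val_list (map enc as), 0 := VNil)))"
    by (rule dfor[where Q = Q]) (use assms in \<open>auto simp: Q_def\<close>)
  then show ?thesis by (simp add: Q_def REV_def call_def fold_Cons_rev)
qed

lemma call_REV_elem [simp]:
  "length as \<le> N \<Longrightarrow> call R N REV (elem_list as) = elem_list (rev as)"
  unfolding elem_list_def by (rule call_REV)

text \<open>This is \<open>ys - c * xs\<close> with heads aligned. For lists with the constant
  coefficient first it is plain subtraction of polynomials; with the leading one first it aligns the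
  leading terms, as in long division. One program serves both.\<close>

fun axpy :: "'a ring \<Rightarrow> 'a \<Rightarrow> 'a list \<Rightarrow> 'a list \<Rightarrow> 'a list" where
  "axpy R c [] ys = ys"
| "axpy R c (x # xs) [] = (\<ominus>\<^bsub>R\<^esub> (c \<otimes>\<^bsub>R\<^esub> x)) # axpy R c xs []"
| "axpy R c (x # xs) (y # ys) = (y \<oplus>\<^bsub>R\<^esub> \<ominus>\<^bsub>R\<^esub> (c \<otimes>\<^bsub>R\<^esub> x)) # axpy R c xs ys"

lemma length_axpy [simp]: "length (axpy R c xs ys) = max (length xs) (length ys)"
  by (induction R c xs ys rule: axpy.induct) auto

lemma axpy_eq_Nil [simp]: "axpy R c xs ys = [] \<longleftrightarrow> xs = [] \<and> ys = []"
  by (induction R c xs ys rule: axpy.induct) auto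

definition AXPY_BODY :: dcom where
  "AXPY_BODY =
     DIf (Var 2)
       (DIf (Var 3)
         (4 ::= Pair_Exp (F_Add (Hd (Var 3)) (F_Neg (F_Mul (Var 1) (Hd (Var 2))))) (Var 4))
         (4 ::= Pair_Exp (F_Neg (F_Mul (Var 1) (Hd (Var 2)))) (Var 4)))
       (DIf (Var 3) (4 ::= Pair_Exp (Hd (Var 3)) (Var 4)) DSkip) ;;;
     2 ::= Tl (Var 2) ;;; 3 ::= Tl (Var 3)"

definition AXPY :: dcom where
  "AXPY = 1 ::= Hd (Var 0) ;;; 2 ::= Hd (Tl (Var 0)) ;;; 3 ::= Tl (Tl (Var 0)) ;;;
     DLoop AXPY_BODY ;;; DCall 0 REV (Var 4)"

lemma AXPY_BODY_iterate:
  assumes "\<sigma> 1 = VElem c" "\<sigma> 2 = elem_list xs" "\<sigma> 3 = elem_list ys" "\<sigma> 4 = elem_list as"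
    and "length xs \<le> m" "length ys \<le> m"
  shows "(dsem R N AXPY_BODY ^^ m) \<sigma> 4 = elem_list (rev (axpy R c xs ys) @ as)"
  using assms
proof (induction m arbitrary: \<sigma> xs ys as)
  case 0
  then show ?case by simp
next
  case (Suc m)
  let ?s = "dsem R N AXPY_BODY \<sigma>"
  define zs where "zs = axpy R c (take 1 xs) (take 1 ys)"
  have s: "?s 1 = VElem c" "?s 2 = elem_list (tl xs)" "?s 3 = elem_list (tl ys)"
    "?s 4 = elem_list (zs @ as)"
    using Suc.prems(1-4) by (cases xs; cases ys; auto simp: AXPY_BODY_def zs_def)+
  have "axpy R c xs ys = zs @ axpy R c (tl xs) (tl ys)"
    by (cases xs; cases ys; simp add: zs_def)
  moreover have "length zs \<le> 1" by (simp add: zs_def)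
  then have "rev zs = zs" by (cases zs) auto
  ultimately show ?case
    using Suc.IH[OF s] Suc.prems(5,6) by (simp add: funpow_swap1)
qed

lemma call_AXPY [simp]:
  assumes "length xs \<le> N" "length ys \<le> N"
  shows "call R N AXPY (VPair (VElem c) (VPair (elem_list xs) (elem_list ys))) =
    elem_list (axpy R c xs ys)"
  using AXPY_BODY_iterate[where \<sigma> = "(init (VPair (VElem c) (VPair (elem_list xs) (elem_list ys))))
      (1 := VElem c, 2 := elem_list xs, 3 := elem_list ys)" and m = N and as = "[]"] assms
  unfolding call_def[of _ _ AXPY] unfolding AXPY_def
    by simp

text \<open>Multiplication by z - a, constant coefficient first. The case \<open>[]\<close> keeps
  the zero polynomial an empty list, on which the degree bound \<open>kbound\<close> for a vanishing
  component relies.\<close>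

definition mull :: "'a ring \<Rightarrow> 'a \<Rightarrow> 'a list \<Rightarrow> 'a list" where
  "mull R a p = (if p = [] then [] else axpy R a p (\<zero>\<^bsub>R\<^esub> # p))"

definition MULL :: dcom where
  "MULL = DIf (Tl (Var 0))
     (DCall 0 AXPY (pair3 (Hd (Var 0)) (Tl (Var 0)) (Pair_Exp F_Zero (Tl (Var 0)))))
     (0 ::= Nil_Exp)"

lemma length_mull: "length (mull R a p) \<le> Suc (length p)"
  by (simp add: mull_def)

lemma call_MULL [simp]:
  assumes "length p < N"
  shows "call R N MULL (VPair (VElem a) (elem_list p)) = elem_list (mull R a p)"
  using assms call_AXPY[of p N "\<zero>\<^bsub>R\<^esub> # p" R a]
  unfolding call_def[of _ _ MULL] unfolding MULL_def
    by (simp add: mull_def)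

text \<open>Horner's rule for a list with the constant coefficient first.\<close>

definition lev :: "'a ring \<Rightarrow> 'a \<Rightarrow> 'a list \<Rightarrow> 'a" where
  "lev R x p = foldr (\<lambda>c acc. (acc \<otimes>\<^bsub>R\<^esub> x) \<oplus>\<^bsub>R\<^esub> c) p \<zero>\<^bsub>R\<^esub>"

definition LEV :: dcom where
  "LEV = DCall 1 REV (Tl (Var 0)) ;;; 2 ::= Hd (Var 0) ;;; 0 ::= F_Zero ;;;
     dfor 3 1 (0 ::= F_Add (F_Mul (Var 0) (Var 2)) (Var 3))"

lemma call_LEV [simp]:
  assumes "length p \<le> N"
  shows "call R N LEV (VPair (VElem x) (elem_list p)) = VElem (lev R x p)"
proof -
  define Q where "Q = (\<lambda>(r :: 'a list) st (\<sigma> :: nat \<Rightarrow> 'a val). \<sigma> 0 = VElem st \<and> \<sigma> 2 = VElem x)"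
  have "Q [] (fold (\<lambda>c acc. (acc \<otimes>\<^bsub>R\<^esub> x) \<oplus>\<^bsub>R\<^esub> c) (rev p) \<zero>\<^bsub>R\<^esub>)
     (dsem R N (dfor 3 1 (0 ::= F_Add (F_Mul (Var 0) (Var 2)) (Var 3)))
       ((init (VPair (VElem x) (elem_list p)))
         (1 := elem_list (rev p), 2 := VElem x, 0 := VElem \<zero>\<^bsub>R\<^esub>)))"
    by (rule dfor[where Q = Q and enc = VElem]) (use assms in \<open>auto simp: Q_def elem_list_def\<close>)
  then show ?thesis
    using assms unfolding call_def[of _ _ LEV] unfolding LEV_def
    by (simp add: Q_def lev_def foldr_conv_fold)
qed


subsection \<open>Sketch generation\<close>

definition rootpoly :: "'a ring \<Rightarrow> 'a list \<Rightarrow> 'a list" where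
  "rootpoly R as = fold (mull R) as [\<one>\<^bsub>R\<^esub>]"

definition ROOTPOLY :: dcom where
  "ROOTPOLY = 1 ::= Var 0 ;;; 0 ::= Pair_Exp F_One Nil_Exp ;;;
     dfor 2 1 (DCall 0 MULL (Pair_Exp (Var 2) (Var 0)))"

lemma call_ROOTPOLY [simp]:
  assumes "length as < N"
  shows "call R N ROOTPOLY (elem_list as) = elem_list (rootpoly R as)"
proof -
  define Q where "Q = (\<lambda>(r :: 'a list) st (\<sigma> :: nat \<Rightarrow> 'a val). \<sigma> 0 = elem_list st \<and> length st + length r < Suc N)"
  have "Q [] (fold (mull R) as [\<one>\<^bsub>R\<^esub>])
     (dsem R N (dfor 2 1 (DCall 0 MULL (Pair_Exp (Var 2) (Var 0))))
       ((init (elem_list as))(1 := elem_list as, 0 := elem_list [\<one>\<^bsub>R\<^esub>])))"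
  proof (rule dfor[where Q = Q and enc = VElem], goal_cases)
    case (5 a r st \<sigma>)
    then show ?case using length_mull[of R a st] by (auto simp: Q_def)
  qed (use assms in \<open>auto simp: Q_def elem_list_def\<close>)
  then show ?thesis
    unfolding call_def[of _ _ ROOTPOLY] unfolding ROOTPOLY_def
    by (simp add: Q_def rootpoly_def)
qed

lemma length_fold_mull: "length (fold (mull R) as p) \<le> length as + length p"
proof (induction as arbitrary: p)
  case (Cons a as)
  show ?case using length_mull[of R a p] Cons.IH[of "mull R a p"] by simp
qed simp

lemma length_rootpoly_le: "length (rootpoly R as) \<le> Suc (length as)"
  using length_fold_mull[of R as "[\<one>\<^bsub>R\<^esub>]"] by (simp add: rootpoly_def)

definition TAKE :: dcom where
  "TAKE = 1 ::= Hd (Var 0) ;;; 2 ::= Tl (Var 0) ;;;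
     dfor 4 1 (3 ::= Pair_Exp (Hd (Var 2)) (Var 3) ;;; 2 ::= Tl (Var 2)) ;;; DCall 0 REV (Var 3)"

lemma call_TAKE [simp]:
  assumes "t \<le> length as" "length as \<le> N"
  shows "call R N TAKE (VPair (unary t) (elem_list as)) = elem_list (take t as)"
proof -
  define Q where "Q = (\<lambda>(r :: 'a val list) st (\<sigma> :: nat \<Rightarrow> 'a val). \<sigma> 3 = elem_list (rev (take st as)) \<and> \<sigma> 2 = elem_list (drop st as) \<and> st + length r = t)"
  have "Q
     [] (fold (\<lambda>_. Suc) (replicate t (VNil :: 'a val)) 0)
     (dsem R N (dfor 4 1 (3 ::= Pair_Exp (Hd (Var 2)) (Var 3) ;;; 2 ::= Tl (Var 2)))
       ((init (VPair (unary t) (elem_list as)))(1 := unary t, 2 := elem_list as)))"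
    by (rule dfor[where Q = Q and enc = id])
       (use assms in \<open>auto simp: Q_def unary_def take_Suc_conv_app_nth hd_drop_conv_nth drop_Suc tl_drop\<close>)
  moreover have "fold (\<lambda>_. Suc) (replicate t (VNil :: 'a val)) 0 = t"
    by (induction t) (simp_all add: fold_replicate)
  ultimately show ?thesis
    using assms unfolding call_def[of _ _ TAKE] unfolding TAKE_def
    by (simp add: Q_def)
qed

text \<open>After reversal the leading coefficient 1 comes first; \<open>Tl\<close> drops it, and
  the coefficients of degree s - 1 and below follow in the order of the sketch.\<close>

definition SKETCH :: dcom where
  "SKETCH = DCall 1 ROOTPOLY (Hd (Var 0)) ;;; DCall 1 REV (Var 1) ;;;
     DCall 0 TAKE (Pair_Exp (Hd (Tl (Var 0))) (Tl (Var 1)))"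

lemma call_SKETCH:
  assumes "t < length (rootpoly R as)" "length as < N"
  shows "call R N SKETCH (SS_input R t as) = elem_list (take t (tl (rev (rootpoly R as))))"
  using assms length_rootpoly_le[of R as]
  unfolding call_def[of _ _ SKETCH] unfolding SKETCH_def
    by (simp add: SS_input_def)


subsection \<open>Interpolation\<close>

text \<open>In this and the next subsection, coefficient lists start with the constant coefficient, in the
  arithmetic modulo a polynomial, as in the library, with the leading one.\<close>

definition highpoly :: "'a ring \<Rightarrow> nat \<Rightarrow> 'a list \<Rightarrow> 'a list" where
  "highpoly R k c = replicate k \<zero>\<^bsub>R\<^esub> @ rev c @ [\<one>\<^bsub>R\<^esub>]"

definition MONIC :: dcom where
  "MONIC = 1 ::= Var 0 ;;; 0 ::= Pair_Exp F_One Nil_Exp ;;; dfor 2 1 (0 ::= Pair_Exp (Var 2) (Var 0))"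

lemma call_MONIC [simp]:
  assumes "length c \<le> N"
  shows "call R N MONIC (elem_list c) = elem_list (rev c @ [\<one>\<^bsub>R\<^esub>])"
proof -
  define Q where "Q = (\<lambda>(r :: 'a list) st (\<sigma> :: nat \<Rightarrow> 'a val). \<sigma> 0 = elem_list st)"
  have "Q [] (fold Cons c [\<one>\<^bsub>R\<^esub>])
     (dsem R N (dfor 2 1 (0 ::= Pair_Exp (Var 2) (Var 0)))
       ((init (elem_list c))(1 := elem_list c, 0 := elem_list [\<one>\<^bsub>R\<^esub>])))"
    by (rule dfor[where Q = Q and enc = VElem]) (use assms in \<open>auto simp: Q_def elem_list_def\<close>)
  then show ?thesis unfolding call_def[of _ _ MONIC] unfolding MONIC_def
    by (simp add: Q_def fold_Cons_rev)
qed

definition DROP :: dcom where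
  "DROP = 1 ::= Hd (Var 0) ;;; 0 ::= Tl (Var 0) ;;; dfor 2 1 (0 ::= Tl (Var 0))"

lemma call_DROP [simp]:
  assumes "length as \<le> N"
  shows "call R N DROP (VPair (val_list (map enc as)) (elem_list bs)) = elem_list (drop (length as) bs)"
proof -
  define Q where "Q = (\<lambda>(r :: 'a list) st (\<sigma> :: nat \<Rightarrow> 'b val). \<sigma> 0 = elem_list (drop st bs))"
  have "Q [] (fold (\<lambda>_. Suc) as 0)
     (dsem R N (dfor 2 1 (0 ::= Tl (Var 0)))
       ((init (VPair (val_list (map enc as)) (elem_list bs)))
         (1 := val_list (map enc as), 0 := elem_list bs)))"
    by (rule dfor[where Q = Q and enc = enc]) (use assms in \<open>auto simp: Q_def drop_Suc tl_drop\<close>)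
  moreover have "fold (\<lambda>_. Suc) as m = length as + m" for m
    by (induction as arbitrary: m) simp_all
  ultimately show ?thesis unfolding call_def[of _ _ DROP] unfolding DROP_def
    by (simp add: Q_def)
qed

lemma call_DROP_unary [simp]:
  "t \<le> N \<Longrightarrow> call R N DROP (VPair (unary t) (elem_list bs)) = elem_list (drop t bs)"
  using call_DROP[of "replicate t VNil" N R id bs] by (simp add: unary_def)

lemma call_DROP_elem [simp]:
  "length as \<le> N \<Longrightarrow> call R N DROP (VPair (elem_list as) (elem_list bs)) = elem_list (drop (length as) bs)"
  using call_DROP[of as N R VElem bs] by (simp add: elem_list_def)

definition COUNT :: dcom where
  "COUNT = 1 ::= Var 0 ;;; 0 ::= Nil_Exp ;;; dfor 2 1 (0 ::= Pair_Exp Nil_Exp (Var 0))"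

lemma call_COUNT [simp]:
  assumes "length as \<le> N"
  shows "call R N COUNT (elem_list as) = unary (length as)"
proof -
  define Q where "Q = (\<lambda>(r :: 'a list) st (\<sigma> :: nat \<Rightarrow> 'a val). \<sigma> 0 = unary st)"
  have "Q [] (fold (\<lambda>_. Suc) as 0)
     (dsem R N (dfor 2 1 (0 ::= Pair_Exp Nil_Exp (Var 0)))
       ((init (elem_list as))(1 := elem_list as, 0 := VNil)))"
    by (rule dfor[where Q = Q and enc = VElem]) (use assms in \<open>auto simp: Q_def elem_list_def\<close>)
  moreover have "fold (\<lambda>_. Suc) as m = length as + m" for m
    by (induction as arbitrary: m) simp_all
  ultimately show ?thesis unfolding call_def[of _ _ COUNT] unfolding COUNT_def
    by (simp add: Q_def)
qed

definition HIGH :: dcom where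
  "HIGH = DCall 2 MONIC (Tl (Var 0)) ;;; 1 ::= Hd (Var 0) ;;; 0 ::= Var 2 ;;;
     dfor 2 1 (0 ::= Pair_Exp F_Zero (Var 0))"

lemma call_HIGH [simp]:
  assumes "length c \<le> N" "k \<le> N"
  shows "call R N HIGH (VPair (unary k) (elem_list c)) = elem_list (highpoly R k c)"
proof -
  define Q where "Q = (\<lambda>(r :: 'a val list) st (\<sigma> :: nat \<Rightarrow> 'a val). \<sigma> 0 = elem_list (replicate st \<zero>\<^bsub>R\<^esub> @ rev c @ [\<one>\<^bsub>R\<^esub>]))"
  have "Q
     [] (fold (\<lambda>_. Suc) (replicate k (VNil :: 'a val)) 0)
     (dsem R N (dfor 2 1 (0 ::= Pair_Exp F_Zero (Var 0)))
       ((init (VPair (unary k) (elem_list c)))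
         (2 := elem_list (rev c @ [\<one>\<^bsub>R\<^esub>]), 1 := unary k, 0 := elem_list (rev c @ [\<one>\<^bsub>R\<^esub>]))))"
    by (rule dfor[where Q = Q and enc = id]) (use assms in \<open>auto simp: Q_def unary_def\<close>)
  moreover have "fold (\<lambda>_. Suc) (replicate k (VNil :: 'a val)) m = k + m" for m
    by (induction k arbitrary: m) simp_all
  ultimately show ?thesis
    using assms unfolding call_def[of _ _ HIGH] unfolding HIGH_def
    by (simp add: Q_def highpoly_def)
qed

text \<open>Two rows \<open>(n, w)\<close> and \<open>(m, v)\<close>, and the difference of their weighted degrees.\<close>

type_synonym 'a kstate = "('a list \<times> 'a list) \<times> ('a list \<times> 'a list) \<times> nat"

definition discrep :: "'a ring \<Rightarrow> 'a \<Rightarrow> 'a \<Rightarrow> 'a list \<times> 'a list \<Rightarrow> 'a" where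
  "discrep R a b P = lev R a (fst P) \<oplus>\<^bsub>R\<^esub> \<ominus>\<^bsub>R\<^esub> (b \<otimes>\<^bsub>R\<^esub> lev R a (snd P))"

text \<open>\<open>P\<close> is the row of smaller weight. If it already fits the new point, only
  \<open>Q\<close> is multiplied by z - a. Otherwise \<open>P\<close> cancels the discrepancy of
  \<open>Q\<close> and is itself multiplied by z - a; this upsets the order of the weights exactly
  when \<open>d = 0\<close>, and then the rows are swapped.\<close>

fun kstep :: "'a ring \<Rightarrow> 'a list \<Rightarrow> 'a \<Rightarrow> 'a kstate \<Rightarrow> 'a kstate" where
  "kstep R h a (P, Q, d) =
     (let b = lev R a h; \<delta> = discrep R a b P; \<epsilon> = discrep R a b Q; c = \<epsilon> \<otimes>\<^bsub>R\<^esub> finv R \<delta> in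
      if \<delta> = \<zero>\<^bsub>R\<^esub> then (P, (mull R a (fst Q), mull R a (snd Q)), Suc d)
      else let Q' = (axpy R c (fst P) (fst Q), axpy R c (snd P) (snd Q));
               P' = (mull R a (fst P), mull R a (snd P))
           in if d = 0 then (Q', P', 1) else (P', Q', d - 1))"

fun enc_pair :: "'a list \<times> 'a list \<Rightarrow> 'a val" where
  "enc_pair (p, q) = VPair (elem_list p) (elem_list q)"

fun enc_kstate :: "'a kstate \<Rightarrow> 'a val" where
  "enc_kstate (P, Q, d) = VPair (enc_pair P) (VPair (enc_pair Q) (unary d))"

definition DISCREP :: dcom where
  "DISCREP = 1 ::= Hd (Var 0) ;;; 2 ::= Hd (Tl (Var 0)) ;;; 3 ::= Tl (Tl (Var 0)) ;;;
     DCall 4 LEV (Pair_Exp (Var 1) (Hd (Var 3))) ;;; DCall 5 LEV (Pair_Exp (Var 1) (Tl (Var 3))) ;;;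
     0 ::= F_Add (Var 4) (F_Neg (F_Mul (Var 2) (Var 5)))"

lemma call_DISCREP [simp]:
  assumes "length (fst P) \<le> N" "length (snd P) \<le> N"
  shows "call R N DISCREP (VPair (VElem a) (VPair (VElem b) (enc_pair P))) = VElem (discrep R a b P)"
  using assms unfolding call_def[of _ _ DISCREP] unfolding DISCREP_def
    by (cases P) (simp add: discrep_def)

definition KSTEP :: dcom where
  "KSTEP = 1 ::= Hd (Var 0) ;;; 2 ::= Hd (Tl (Var 0)) ;;;
     3 ::= Hd (Tl (Tl (Var 0))) ;;; 4 ::= Hd (Tl (Tl (Tl (Var 0)))) ;;; 5 ::= Tl (Tl (Tl (Tl (Var 0)))) ;;;
     DCall 6 LEV (Pair_Exp (Var 1) (Var 2)) ;;;
     DCall 7 DISCREP (pair3 (Var 1) (Var 6) (Var 3)) ;;;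
     DCall 8 DISCREP (pair3 (Var 1) (Var 6) (Var 4)) ;;;
     9 ::= F_Mul (Var 8) (F_Inv (Var 7)) ;;;
     DIf (F_Eq (Var 7) F_Zero)
       (DCall 10 MULL (Pair_Exp (Var 1) (Hd (Var 4))) ;;; DCall 11 MULL (Pair_Exp (Var 1) (Tl (Var 4))) ;;;
        0 ::= pair3 (Var 3) (Pair_Exp (Var 10) (Var 11)) (Pair_Exp Nil_Exp (Var 5)))
       (DCall 10 AXPY (pair3 (Var 9) (Hd (Var 3)) (Hd (Var 4))) ;;;
        DCall 11 AXPY (pair3 (Var 9) (Tl (Var 3)) (Tl (Var 4))) ;;;
        DCall 12 MULL (Pair_Exp (Var 1) (Hd (Var 3))) ;;; DCall 13 MULL (Pair_Exp (Var 1) (Tl (Var 3))) ;;;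
        DIf (Var 5)
          (0 ::= pair3 (Pair_Exp (Var 12) (Var 13)) (Pair_Exp (Var 10) (Var 11)) (Tl (Var 5)))
          (0 ::= pair3 (Pair_Exp (Var 10) (Var 11)) (Pair_Exp (Var 12) (Var 13))
                   (Pair_Exp Nil_Exp Nil_Exp)))"

fun ksize :: "nat \<Rightarrow> 'a kstate \<Rightarrow> bool" where
  "ksize m ((n, w), (n', w'), d) \<longleftrightarrow>
     length n \<le> m \<and> length w \<le> m \<and> length n' \<le> m \<and> length w' \<le> m"

lemma call_KSTEP [simp]:
  assumes "length h \<le> N" "ksize m st" "m < N"
  shows "call R N KSTEP (VPair (VElem a) (VPair (elem_list h) (enc_kstate st))) =
    enc_kstate (kstep R h a st)"
proof -
  obtain n w n' w' d where st: "st = ((n, w), (n', w'), d)" by (metis surj_pair)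
  show ?thesis
    using assms call_DISCREP[of "(n, w)" N] call_DISCREP[of "(n', w')" N]
    unfolding call_def[of _ _ KSTEP] unfolding KSTEP_def
    by (cases d) (simp_all add: st Let_def)
qed

lemma ksize_kstep: "ksize m st \<Longrightarrow> ksize (Suc m) (kstep R h a st)"
proof -
  obtain n w n' w' d where st: "st = ((n, w), (n', w'), d)" by (metis surj_pair)
  show "ksize m st \<Longrightarrow> ?thesis"
    using length_mull[of R a n] length_mull[of R a w] length_mull[of R a n'] length_mull[of R a w']
    by (simp add: st Let_def)
qed

text \<open>The rows (1, 0) and (0, 1) have weights 0 and k - 1, as w will be multiplied by a
  polynomial of degree at most k - 1. For \<open>k = 0\<close> the second weight is -1, so the rows
  change places.\<close>

definition kinit :: "'a ring \<Rightarrow> nat \<Rightarrow> 'a kstate" where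
  "kinit R k = (if k = 0 then (([], [\<one>\<^bsub>R\<^esub>]), ([\<one>\<^bsub>R\<^esub>], []), 1)
     else (([\<one>\<^bsub>R\<^esub>], []), ([], [\<one>\<^bsub>R\<^esub>]), k - 1))"

definition interp :: "'a ring \<Rightarrow> nat \<Rightarrow> 'a list \<Rightarrow> 'a list \<Rightarrow> 'a list \<times> 'a list" where
  "interp R k h as = fst (fold (kstep R h) as (kinit R k))"

definition INTERP :: dcom where
  "INTERP = 2 ::= Hd (Var 0) ;;; 3 ::= Tl (Tl (Var 0)) ;;; 4 ::= Hd (Tl (Var 0)) ;;;
     DIf (Var 2)
       (1 ::= pair3 (Pair_Exp (Pair_Exp F_One Nil_Exp) Nil_Exp)
                (Pair_Exp Nil_Exp (Pair_Exp F_One Nil_Exp)) (Tl (Var 2)))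
       (1 ::= pair3 (Pair_Exp Nil_Exp (Pair_Exp F_One Nil_Exp))
                (Pair_Exp (Pair_Exp F_One Nil_Exp) Nil_Exp) (Pair_Exp Nil_Exp Nil_Exp)) ;;;
     dfor 5 3 (DCall 1 KSTEP (pair3 (Var 5) (Var 4) (Var 1))) ;;; 0 ::= Hd (Var 1)"

lemma call_INTERP [simp]:
  assumes "length h \<le> N" "Suc (length as) < N"
  shows "call R N INTERP (VPair (unary k) (VPair (elem_list h) (elem_list as))) =
    enc_pair (interp R k h as)"
proof -
  define Q where "Q = (\<lambda>(r :: 'a list) st (\<sigma> :: nat \<Rightarrow> 'a val). \<sigma> 1 = enc_kstate st \<and> \<sigma> 4 = elem_list h \<and>
        (\<exists>m. ksize m st \<and> m + length r < N))"
  have *: "Q [] (fold (kstep R h) as (kinit R k))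
     (dsem R N (dfor 5 3 (DCall 1 KSTEP (pair3 (Var 5) (Var 4) (Var 1))))
       ((init (VPair (unary k) (VPair (elem_list h) (elem_list as))))
         (2 := unary k, 3 := elem_list as, 4 := elem_list h, 1 := enc_kstate (kinit R k))))"
  proof (rule dfor[where enc = VElem], goal_cases)
    case 4
    show ?case using assms(2) by (auto intro!: exI[of _ 1] simp: Q_def kinit_def)
  next
    case (5 a r st \<sigma>)
    then obtain m where m: "ksize m st" "m + length (a # r) < N" by (auto simp: Q_def)
    then have "m < N" by simp
    then show ?case using 5 m assms call_KSTEP[OF assms(1) m(1), of R a] ksize_kstep[OF m(1), of R h a]
      by (auto intro!: exI[of _ "Suc m"] simp: Q_def simp del: kstep.simps)
  qed (use assms in \<open>auto simp: Q_def elem_list_def\<close>)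
  obtain P Q d where K: "fold (kstep R h) as (kinit R k) = (P, Q, d)" by (metis surj_pair)
  show ?thesis
    using * K unfolding call_def[of _ _ INTERP] unfolding INTERP_def
    by (cases k) (simp_all add: Q_def interp_def kinit_def)
qed


subsection \<open>Division of power series\<close>

definition hd0 :: "'a ring \<Rightarrow> 'a list \<Rightarrow> 'a" where
  "hd0 R p = (if p = [] then \<zero>\<^bsub>R\<^esub> else hd p)"

definition HD0 :: dcom where
  "HD0 = DIf (Var 0) (0 ::= Hd (Var 0)) (0 ::= F_Zero)"

lemma call_HD0 [simp]: "call R N HD0 (elem_list p) = VElem (hd0 R p)"
  by (simp add: HD0_def call_def hd0_def)

text \<open>Power series division needs a denominator with nonzero constant coefficient; common
  factors z of n and w, which arise when 0 is among the points, are cancelled first.\<close>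

fun strip_step :: "'a ring \<Rightarrow> 'a list \<times> 'a list \<Rightarrow> 'a list \<times> 'a list" where
  "strip_step R (n, w) = (if w \<noteq> [] \<and> hd w = \<zero>\<^bsub>R\<^esub> then (tl n, tl w) else (n, w))"

definition STRIP :: dcom where
  "STRIP = 1 ::= Hd (Var 0) ;;; 2 ::= Tl (Var 0) ;;;
     DLoop (DIf (Var 2) (DIf (F_Eq (Hd (Var 2)) F_Zero) (1 ::= Tl (Var 1) ;;; 2 ::= Tl (Var 2)) DSkip) DSkip) ;;;
     0 ::= Pair_Exp (Var 1) (Var 2)"

lemma call_STRIP [simp]: "call R N STRIP (enc_pair P) = enc_pair ((strip_step R ^^ N) P)"
proof -
  let ?c = "DLoop (DIf (Var 2) (DIf (F_Eq (Hd (Var 2)) F_Zero) (1 ::= Tl (Var 1) ;;; 2 ::= Tl (Var 2)) DSkip) DSkip)"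
  obtain n w where P: "P = (n, w)" by (cases P)
  let ?Q = "\<lambda>st \<sigma>. \<sigma> 1 = elem_list (fst st) \<and> \<sigma> 2 = elem_list (snd st)"
  have *: "?Q ((strip_step R ^^ N) P)
     (dsem R N ?c ((init (enc_pair P))(1 := elem_list n, 2 := elem_list w)))"
    by (rule dloop[where Q = ?Q]) (auto simp: P)
  then show ?thesis
    unfolding call_def[of _ _ STRIP] unfolding STRIP_def
    by (cases "(strip_step R ^^ N) P") (simp add: P del: dsem.simps(5))
qed

text \<open>Division from the low end: the constant coefficient \<open>c\<close> of the quotient is
  determined, \<open>c * w\<close> is subtracted, and \<open>tl\<close> divides the rest by
  z.\<close>

fun dstep :: "'a ring \<Rightarrow> 'a list \<Rightarrow> 'a list \<times> 'a list \<Rightarrow> 'a list \<times> 'a list" where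
  "dstep R w (n, acc) =
     (let c = hd0 R n \<otimes>\<^bsub>R\<^esub> finv R (hd0 R w) in (tl (axpy R c w n), c # acc))"

definition psdiv :: "'a ring \<Rightarrow> nat \<Rightarrow> 'a list \<times> 'a list \<Rightarrow> 'a list" where
  "psdiv R k P = rev (snd ((dstep R (snd P) ^^ k) (fst P, [])))"

definition PSDIV :: dcom where
  "PSDIV = 1 ::= Hd (Var 0) ;;; 2 ::= Hd (Tl (Var 0)) ;;; 3 ::= Tl (Tl (Var 0)) ;;;
     DCall 5 HD0 (Var 3) ;;;
     dfor 6 1 (DCall 7 HD0 (Var 2) ;;; 7 ::= F_Mul (Var 7) (F_Inv (Var 5)) ;;;
       DCall 2 AXPY (pair3 (Var 7) (Var 3) (Var 2)) ;;; 2 ::= Tl (Var 2) ;;;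
       4 ::= Pair_Exp (Var 7) (Var 4)) ;;;
     DCall 0 REV (Var 4)"

lemma fold_const_funpow: "fold (\<lambda>_. f) xs = f ^^ length xs"
  by (induction xs) (auto simp: funpow_swap1 fun_eq_iff)

lemma length_snd_dstep: "length (snd ((dstep R w ^^ k) st)) = k + length (snd st)"
  by (induction k) (auto simp: Let_def case_prod_beta dstep.simps[of R w "fst x" "snd x" for x, simplified])

lemma call_PSDIV [simp]:
  assumes "length (fst P) \<le> N" "length (snd P) \<le> N" "k \<le> N"
  shows "call R N PSDIV (VPair (unary k) (enc_pair P)) = elem_list (psdiv R k P)"
proof -
  let ?c = "dfor 6 1 (DCall 7 HD0 (Var 2) ;;; 7 ::= F_Mul (Var 7) (F_Inv (Var 5)) ;;;
       DCall 2 AXPY (pair3 (Var 7) (Var 3) (Var 2)) ;;; 2 ::= Tl (Var 2) ;;;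
       4 ::= Pair_Exp (Var 7) (Var 4))"
  obtain n w where P: "P = (n, w)" by (cases P)
  define Q where "Q = (\<lambda>(r :: 'a val list) st (\<sigma> :: nat \<Rightarrow> 'a val). \<sigma> 2 = elem_list (fst st) \<and> \<sigma> 3 = elem_list w \<and> \<sigma> 4 = elem_list (snd st) \<and> \<sigma> 5 = VElem (hd0 R w) \<and> length (fst st) \<le> N)"
  have *: "Q
     [] (fold (\<lambda>_. dstep R w) (replicate k (VNil :: 'a val)) (n, []))
     (dsem R N ?c ((init (VPair (unary k) (enc_pair P)))
       (1 := unary k, 2 := elem_list n, 3 := elem_list w, 5 := VElem (hd0 R w))))"
    by (rule dfor[where Q = Q and enc = id]) (use assms in \<open>auto simp: Q_def P unary_def Let_def\<close>)
  have "length (snd ((dstep R w ^^ k) (n, []))) \<le> N"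
    using assms(3) by (simp add: Q_def length_snd_dstep)
  then show ?thesis
    using * unfolding call_def[of _ _ PSDIV] unfolding PSDIV_def
    by (simp add: Q_def psdiv_def P fold_const_funpow)
qed


text \<open>Positive exactly if at most t/2 of the points are not zeros of \<open>f\<close>.
  Truncated subtraction models the program, which removes two cells of a unary number per
  error.\<close>

definition check :: "'a ring \<Rightarrow> nat \<Rightarrow> 'a list \<Rightarrow> 'a list \<Rightarrow> nat" where
  "check R t f as = Suc t - 2 * length (filter (\<lambda>a. lev R a f \<noteq> \<zero>\<^bsub>R\<^esub>) as)"

definition CHECK :: dcom where
  "CHECK = 1 ::= Pair_Exp Nil_Exp (Hd (Var 0)) ;;; 2 ::= Hd (Tl (Var 0)) ;;; 3 ::= Tl (Tl (Var 0)) ;;;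
     dfor 4 3 (DCall 5 LEV (Pair_Exp (Var 4) (Var 2)) ;;;
       DIf (F_Eq (Var 5) F_Zero) DSkip (1 ::= Tl (Tl (Var 1)))) ;;; 0 ::= Var 1"

lemma call_CHECK [simp]:
  assumes "length f \<le> N" "length as \<le> N"
  shows "call R N CHECK (VPair (unary t) (VPair (elem_list f) (elem_list as))) = unary (check R t f as)"
proof -
  define F where "F = (\<lambda>a (n :: nat). if lev R a f = \<zero>\<^bsub>R\<^esub> then n else n - 1 - 1)"
  define Q where "Q = (\<lambda>(r :: 'a list) st (\<sigma> :: nat \<Rightarrow> 'a val). \<sigma> 1 = unary st \<and> \<sigma> 2 = elem_list f)"
  have *: "Q [] (fold F as (Suc t))
     (dsem R N (dfor 4 3 (DCall 5 LEV (Pair_Exp (Var 4) (Var 2)) ;;;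
         DIf (F_Eq (Var 5) F_Zero) DSkip (1 ::= Tl (Tl (Var 1)))))
       ((init (VPair (unary t) (VPair (elem_list f) (elem_list as))))
         (1 := unary (Suc t), 2 := elem_list f, 3 := elem_list as)))"
    by (rule dfor[where enc = VElem]) (use assms in \<open>auto simp: Q_def F_def elem_list_def[of as]\<close>)
  have "fold F as m = m - 2 * length (filter (\<lambda>a. lev R a f \<noteq> \<zero>\<^bsub>R\<^esub>) as)" for m
    by (induction as arbitrary: m) (auto simp: F_def)
  with * show ?thesis
    unfolding call_def[of _ _ CHECK] unfolding CHECK_def by (simp add: Q_def check_def)
qed

text \<open>The quotient is computed whether or not a low polynomial exists, and accepted only if
  \<open>check\<close> succeeds. A point is a zero of \<open>f\<close> exactly if the low and the
  high part agree there.\<close>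

definition decode :: "'a ring \<Rightarrow> nat \<Rightarrow> nat \<Rightarrow> 'a list \<Rightarrow> 'a list \<Rightarrow> 'a list option" where
  "decode R N t as c =
     (let k = length as - t; h = highpoly R k c;
          f = axpy R \<one>\<^bsub>R\<^esub> (psdiv R k ((strip_step R ^^ N) (interp R k h as))) h
      in if check R t f as = 0 then None else Some (rev f))"

definition DECODE :: dcom where
  "DECODE = 1 ::= Hd (Var 0) ;;; 2 ::= Hd (Tl (Var 0)) ;;; 3 ::= Hd (Tl (Tl (Var 0))) ;;;
     DCall 4 DROP (Pair_Exp (Var 3) (Var 1)) ;;; DCall 4 COUNT (Var 4) ;;;
     DCall 5 HIGH (Pair_Exp (Var 4) (Var 2)) ;;; DCall 6 INTERP (pair3 (Var 4) (Var 5) (Var 1)) ;;;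
     DCall 6 STRIP (Var 6) ;;; DCall 7 PSDIV (Pair_Exp (Var 4) (Var 6)) ;;;
     DCall 8 AXPY (pair3 F_One (Var 7) (Var 5)) ;;; DCall 9 CHECK (pair3 (Var 3) (Var 8) (Var 1)) ;;;
     DIf (Var 9) (DCall 10 REV (Var 8) ;;; 0 ::= Pair_Exp Nil_Exp (Var 10)) (0 ::= Nil_Exp)"

fun enc_opt :: "('b \<Rightarrow> 'a val) \<Rightarrow> 'b option \<Rightarrow> 'a val" where
  "enc_opt enc None = VNil"
| "enc_opt enc (Some x) = VPair VNil (enc x)"

lemma ksize_fold: "ksize m st \<Longrightarrow> ksize (m + length as) (fold (kstep R h) as st)"
proof (induction as arbitrary: m st)
  case (Cons a as)
  then show ?case using ksize_kstep[OF Cons.prems, of R h a] Cons.IH[of "Suc m" "kstep R h a st"] by simp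
qed simp

lemma length_interp:
  "length (fst (interp R k h as)) \<le> Suc (length as)" "length (snd (interp R k h as)) \<le> Suc (length as)"
proof -
  obtain n w n' w' d where st: "fold (kstep R h) as (kinit R k) = ((n, w), (n', w'), d)"
    by (metis surj_pair)
  have "ksize (1 + length as) (fold (kstep R h) as (kinit R k))"
    by (rule ksize_fold) (simp add: kinit_def)
  then show "length (fst (interp R k h as)) \<le> Suc (length as)"
    "length (snd (interp R k h as)) \<le> Suc (length as)"
    by (simp_all add: interp_def st)
qed

lemma length_strip:
  "length (fst ((strip_step R ^^ m) P)) \<le> length (fst P)"
  "length (snd ((strip_step R ^^ m) P)) \<le> length (snd P)"
proof -
  have s: "length (fst (strip_step R P)) \<le> length (fst P) \<and> length (snd (strip_step R P)) \<le> length (snd P)"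
    for P by (cases P) auto
  have "length (fst ((strip_step R ^^ m) P)) \<le> length (fst P) \<and>
     length (snd ((strip_step R ^^ m) P)) \<le> length (snd P)"
    by (induction m) (auto intro: order_trans[OF conjunct1[OF s]] order_trans[OF conjunct2[OF s]])
  then show "length (fst ((strip_step R ^^ m) P)) \<le> length (fst P)"
    "length (snd ((strip_step R ^^ m) P)) \<le> length (snd P)" by auto
qed

lemma length_psdiv [simp]: "length (psdiv R k P) = k"
  by (simp add: psdiv_def length_snd_dstep)

lemma length_highpoly [simp]: "length (highpoly R k c) = Suc (k + length c)"
  by (simp add: highpoly_def)

lemma call_DECODE [simp]:
  assumes "length as + 2 \<le> N" "length c = t" "t \<le> length as"
  shows "call R N DECODE (VPair (elem_list as) (VPair (elem_list c) (VPair (unary t) v))) =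
    enc_opt elem_list (decode R N t as c)"
proof -
  let ?i = "interp R (length as - t) (highpoly R (length as - t) c) as"
  have "length (fst ((strip_step R ^^ N) ?i)) \<le> N" "length (snd ((strip_step R ^^ N) ?i)) \<le> N"
    using length_strip[where R = R and m = N and P = ?i] length_interp[of R "length as - t" "highpoly R (length as - t) c" as]
      assms(1) by linarith+
  then show ?thesis
    using assms unfolding call_def[of _ _ DECODE] unfolding DECODE_def
    by (simp add: decode_def Let_def)
qed


subsection \<open>Arithmetic modulo a polynomial\<close>

text \<open>Horner step \<open>z * acc + c * q\<close> modulo \<open>g\<close>, leading coefficient
  first. As \<open>g\<close> is longer than \<open>acc\<close> by one, aligning heads multiplies
  \<open>acc\<close> by z; the chosen multiple of \<open>g\<close> clears the first coefficient,
  which \<open>tl\<close> then drops.\<close>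

definition mstep :: "'a ring \<Rightarrow> 'a list \<Rightarrow> 'a list \<Rightarrow> 'a \<Rightarrow> 'a list \<Rightarrow> 'a list" where
  "mstep R g q c acc =
     axpy R (\<ominus>\<^bsub>R\<^esub> c) q (tl (axpy R (hd acc \<otimes>\<^bsub>R\<^esub> finv R (hd g)) g acc))"

text \<open>The start value \<open>q - q\<close> is the zero residue with as many coefficients as
  \<open>q\<close>.\<close>

definition mulmod :: "'a ring \<Rightarrow> 'a list \<Rightarrow> 'a list \<Rightarrow> 'a list \<Rightarrow> 'a list" where
  "mulmod R g p q = fold (mstep R g q) p (axpy R \<one>\<^bsub>R\<^esub> q q)"

text \<open>Nonemptiness matters because the programs do arithmetic with heads, and the head of
  \<open>VNil\<close> is not a field element.\<close>

definition sized :: "nat \<Rightarrow> 'a list \<Rightarrow> bool" where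
  "sized N p \<longleftrightarrow> p \<noteq> [] \<and> length p \<le> N"

lemma sized_length [simp]: "sized N p \<Longrightarrow> length p \<le> N"
  by (simp add: sized_def)

lemma sized_axpy [simp]: "sized N p \<Longrightarrow> sized N q \<Longrightarrow> sized N (axpy R c p q)"
  by (auto simp: sized_def)

definition MULMOD :: dcom where
  "MULMOD = 1 ::= Hd (Var 0) ;;; 2 ::= Hd (Tl (Var 0)) ;;; 3 ::= Tl (Tl (Var 0)) ;;;
     DCall 4 AXPY (pair3 F_One (Var 3) (Var 3)) ;;;
     dfor 5 2
       (DCall 4 AXPY (pair3 (F_Mul (Hd (Var 4)) (F_Inv (Hd (Var 1)))) (Var 1) (Var 4)) ;;;
        4 ::= Tl (Var 4) ;;; DCall 4 AXPY (pair3 (F_Neg (Var 5)) (Var 3) (Var 4))) ;;;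
     0 ::= Var 4"

lemma sized_mstep:
  "length g \<le> N \<Longrightarrow> sized N q \<Longrightarrow> sized N acc \<Longrightarrow> sized N (mstep R g q c acc)"
  by (auto simp: mstep_def sized_def)

lemma sized_mulmod [simp]:
  assumes "sized N g" "sized N q"
  shows "sized N (mulmod R g p q)"
proof -
  have "sized N (fold (mstep R g q) p acc)" if "sized N acc" for acc
    using that by (induction p arbitrary: acc) (simp_all add: sized_mstep assms)
  then show ?thesis using assms by (simp add: mulmod_def)
qed

lemma call_MULMOD [simp]:
  assumes "sized N g" "length p \<le> N" "sized N q"
  shows "call R N MULMOD (VPair (elem_list g) (VPair (elem_list p) (elem_list q))) =
    elem_list (mulmod R g p q)"
proof -
  define Q where "Q = (\<lambda>(r :: 'a list) st (\<sigma> :: nat \<Rightarrow> 'a val). \<sigma> 1 = elem_list g \<and> \<sigma> 3 = elem_list q \<and>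
     \<sigma> 4 = elem_list st \<and> sized N st)"
  have "Q [] (fold (mstep R g q) p (axpy R \<one>\<^bsub>R\<^esub> q q))
     (dsem R N (dfor 5 2
       (DCall 4 AXPY (pair3 (F_Mul (Hd (Var 4)) (F_Inv (Hd (Var 1)))) (Var 1) (Var 4)) ;;;
        4 ::= Tl (Var 4) ;;; DCall 4 AXPY (pair3 (F_Neg (Var 5)) (Var 3) (Var 4))))
       ((init (VPair (elem_list g) (VPair (elem_list p) (elem_list q))))
         (1 := elem_list g, 2 := elem_list p, 3 := elem_list q, 4 := elem_list (axpy R \<one>\<^bsub>R\<^esub> q q))))"
    by (rule dfor[where enc = VElem])
       (use assms in \<open>auto simp: Q_def elem_list_def[of p] mstep_def sized_def\<close>)
  then show ?thesis
    using assms unfolding call_def[of _ _ MULMOD] unfolding MULMOD_def by (simp add: Q_def mulmod_def)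
qed

definition onev :: "'a ring \<Rightarrow> 'a list \<Rightarrow> 'a list" where
  "onev R g = replicate (length g - 2) \<zero>\<^bsub>R\<^esub> @ [\<one>\<^bsub>R\<^esub>]"

definition ONE :: dcom where
  "ONE = 1 ::= Tl (Tl (Var 0)) ;;; 0 ::= Pair_Exp F_One Nil_Exp ;;; dfor 2 1 (0 ::= Pair_Exp F_Zero (Var 0))"

lemma call_ONE [simp]:
  assumes "length g \<le> N"
  shows "call R N ONE (elem_list g) = elem_list (onev R g)"
proof -
  define Q where "Q = (\<lambda>(r :: 'a list) st (\<sigma> :: nat \<Rightarrow> 'a val).
     \<sigma> 0 = elem_list (replicate st \<zero>\<^bsub>R\<^esub> @ [\<one>\<^bsub>R\<^esub>]))"
  have "Q [] (fold (\<lambda>_. Suc) (tl (tl g)) 0)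
     (dsem R N (dfor 2 1 (0 ::= Pair_Exp F_Zero (Var 0)))
       ((init (elem_list g)) (1 := elem_list (tl (tl g)), 0 := elem_list [\<one>\<^bsub>R\<^esub>])))"
    by (rule dfor[where enc = VElem]) (use assms in \<open>auto simp: Q_def elem_list_def\<close>)
  moreover have "fold (\<lambda>_. Suc) xs m = length xs + m" for xs :: "'a list" and m
    by (induction xs arbitrary: m) simp_all
  ultimately show ?thesis
    unfolding call_def[of _ _ ONE] unfolding ONE_def by (simp add: Q_def onev_def numeral_2_eq_2)
qed

lemma sized_onev [simp]: "sized N g \<Longrightarrow> sized N (onev R g)"
  by (auto simp: sized_def onev_def neq_Nil_conv)

fun nbits :: "nat \<Rightarrow> bool list" where
  "nbits k = (if k = 0 then [] else odd k # nbits (k div 2))"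

declare nbits.simps [simp del]

definition encb :: "bool \<Rightarrow> 'a val" where
  "encb b = (if b then VPair VNil VNil else VNil)"

abbreviation enc_bits :: "bool list \<Rightarrow> 'a val" where
  "enc_bits bs \<equiv> val_list (map encb bs)"

lemma binary_eq_enc_bits: "binary k = enc_bits (nbits k)"
proof (induction k rule: nbits.induct)
  case (1 k)
  then show ?case
    by (cases "k = 0") (simp_all add: binary.simps[of k] nbits.simps[of k] binary.simps[of 0] nbits.simps[of 0] encb_def)
qed

fun pstep :: "'a ring \<Rightarrow> 'a list \<Rightarrow> bool \<Rightarrow> 'a list \<times> 'a list \<Rightarrow> 'a list \<times> 'a list" where
  "pstep R g b (acc, y) = (if b then mulmod R g acc y else acc, mulmod R g y y)"

text \<open>Each list element contributes one term y^(2^i) of the trace; for n = 2^k the tail of the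
  bits of n has exactly k elements. Subtracting -y adds y.\<close>

fun tstep :: "'a ring \<Rightarrow> 'a list \<Rightarrow> bool \<Rightarrow> 'a list \<times> 'a list \<Rightarrow> 'a list \<times> 'a list" where
  "tstep R g b (acc, y) = (axpy R (\<ominus>\<^bsub>R\<^esub> \<one>\<^bsub>R\<^esub>) y acc, mulmod R g y y)"

definition powmod :: "'a ring \<Rightarrow> 'a list \<Rightarrow> bool list \<Rightarrow> 'a list \<Rightarrow> 'a list \<Rightarrow> 'a list" where
  "powmod R g bs acc y = fst (fold (pstep R g) bs (acc, y))"

definition tracemod :: "'a ring \<Rightarrow> 'a list \<Rightarrow> bool list \<Rightarrow> 'a list \<Rightarrow> 'a list \<Rightarrow> 'a list" where
  "tracemod R g bs acc y = fst (fold (tstep R g) bs (acc, y))"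

definition POW :: dcom where
  "POW = 1 ::= Hd (Var 0) ;;; 2 ::= Hd (Tl (Var 0)) ;;; 3 ::= Hd (Tl (Tl (Var 0))) ;;;
     4 ::= Tl (Tl (Tl (Var 0))) ;;;
     dfor 5 1 (DIf (Var 5) (DCall 3 MULMOD (pair3 (Var 2) (Var 3) (Var 4))) DSkip ;;;
       DCall 4 MULMOD (pair3 (Var 2) (Var 4) (Var 4))) ;;; 0 ::= Var 3"

definition TRACE :: dcom where
  "TRACE = 1 ::= Hd (Var 0) ;;; 2 ::= Hd (Tl (Var 0)) ;;; 3 ::= Hd (Tl (Tl (Var 0))) ;;;
     4 ::= Tl (Tl (Tl (Var 0))) ;;;
     dfor 5 1 (DCall 3 AXPY (pair3 (F_Neg F_One) (Var 4) (Var 3)) ;;;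
       DCall 4 MULMOD (pair3 (Var 2) (Var 4) (Var 4))) ;;; 0 ::= Var 3"

lemma call_POW:
  assumes "length bs \<le> N" "sized N g" "sized N acc" "sized N y"
  shows "call R N POW (VPair (enc_bits bs) (VPair (elem_list g) (VPair (elem_list acc) (elem_list y)))) =
     elem_list (powmod R g bs acc y)"
    and "sized N (powmod R g bs acc y)"
proof -
  define Q where "Q = (\<lambda>(r :: bool list) st (\<sigma> :: nat \<Rightarrow> 'a val). \<sigma> 2 = elem_list g \<and>
     \<sigma> 3 = elem_list (fst st) \<and> \<sigma> 4 = elem_list (snd st) \<and> sized N (fst st) \<and> sized N (snd st))"
  have *: "Q [] (fold (pstep R g) bs (acc, y))
     (dsem R N (dfor 5 1 (DIf (Var 5) (DCall 3 MULMOD (pair3 (Var 2) (Var 3) (Var 4))) DSkip ;;;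
         DCall 4 MULMOD (pair3 (Var 2) (Var 4) (Var 4))))
       ((init (VPair (enc_bits bs) (VPair (elem_list g) (VPair (elem_list acc) (elem_list y)))))
         (1 := enc_bits bs, 2 := elem_list g, 3 := elem_list acc, 4 := elem_list y)))"
  proof (rule dfor[where enc = encb], goal_cases)
    case (5 b r st \<sigma>)
    obtain acc' y' where st: "st = (acc', y')" by (cases st)
    have s: "sized N acc'" "sized N y'" "\<sigma> 2 = elem_list g" "\<sigma> 3 = elem_list acc'" "\<sigma> 4 = elem_list y'"
      using 5(1) by (simp_all add: Q_def st)
    have "sized N (mulmod R g acc' y')" "sized N (mulmod R g y' y')"
      using sized_mulmod[OF assms(2) s(2)] by auto
    with s assms(2) show ?case by (cases b) (simp_all add: Q_def st encb_def)
  qed (use assms in \<open>auto simp: Q_def\<close>)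
  then show "call R N POW (VPair (enc_bits bs) (VPair (elem_list g) (VPair (elem_list acc) (elem_list y)))) =
     elem_list (powmod R g bs acc y)"
    unfolding call_def[of _ _ POW] unfolding POW_def by (simp add: Q_def powmod_def)
  from * show "sized N (powmod R g bs acc y)" by (simp add: Q_def powmod_def)
qed

lemma call_TRACE:
  assumes "length bs \<le> N" "sized N g" "sized N acc" "sized N y"
  shows "call R N TRACE (VPair (enc_bits bs) (VPair (elem_list g) (VPair (elem_list acc) (elem_list y)))) =
     elem_list (tracemod R g bs acc y)"
    and "sized N (tracemod R g bs acc y)"
proof -
  define Q where "Q = (\<lambda>(r :: bool list) st (\<sigma> :: nat \<Rightarrow> 'a val). \<sigma> 2 = elem_list g \<and>
     \<sigma> 3 = elem_list (fst st) \<and> \<sigma> 4 = elem_list (snd st) \<and> sized N (fst st) \<and> sized N (snd st))"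
  have *: "Q [] (fold (tstep R g) bs (acc, y))
     (dsem R N (dfor 5 1 (DCall 3 AXPY (pair3 (F_Neg F_One) (Var 4) (Var 3)) ;;;
         DCall 4 MULMOD (pair3 (Var 2) (Var 4) (Var 4))))
       ((init (VPair (enc_bits bs) (VPair (elem_list g) (VPair (elem_list acc) (elem_list y)))))
         (1 := enc_bits bs, 2 := elem_list g, 3 := elem_list acc, 4 := elem_list y)))"
  proof (rule dfor[where enc = encb], goal_cases)
    case (5 b r st \<sigma>)
    obtain acc' y' where st: "st = (acc', y')" by (cases st)
    have s: "sized N acc'" "sized N y'" "\<sigma> 2 = elem_list g" "\<sigma> 3 = elem_list acc'" "\<sigma> 4 = elem_list y'"
      using 5(1) by (simp_all add: Q_def st)
    have "sized N (mulmod R g y' y')"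
      using sized_mulmod[OF assms(2) s(2)] by auto
    with s assms(2) sized_axpy[OF s(2) s(1)] show ?case by (cases b) (simp_all add: Q_def st encb_def)
  qed (use assms in \<open>auto simp: Q_def\<close>)
  then show "call R N TRACE (VPair (enc_bits bs) (VPair (elem_list g) (VPair (elem_list acc) (elem_list y)))) =
     elem_list (tracemod R g bs acc y)"
    unfolding call_def[of _ _ TRACE] unfolding TRACE_def by (simp add: Q_def tracemod_def)
  from * show "sized N (tracemod R g bs acc y)" by (simp add: Q_def tracemod_def)
qed


subsection \<open>Greatest common divisors and splitting\<close>

text \<open>Euclid's algorithm by single cancellations: \<open>p\<close> always has a nonzero head,
  while \<open>q\<close> may carry leading zeros, which are removed one at a time.\<close>

fun gstep :: "'a ring \<Rightarrow> 'a list \<times> 'a list \<Rightarrow> 'a list \<times> 'a list" where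
  "gstep R (p, q) =
     (if q = [] then (p, q)
      else if hd q = \<zero>\<^bsub>R\<^esub> then (p, tl q)
      else if length p > length q then (q, p)
      else (p, tl (axpy R (hd q \<otimes>\<^bsub>R\<^esub> finv R (hd p)) p q)))"

text \<open>At most \<open>4 * N + 1\<close> steps change anything. Two nested loops exceed this
  number as soon as \<open>5 \<le> N\<close>.\<close>

definition gcdl :: "'a ring \<Rightarrow> nat \<Rightarrow> 'a list \<Rightarrow> 'a list \<Rightarrow> 'a list" where
  "gcdl R N p q = fst ((gstep R ^^ (N * N)) (p, q))"

definition GSTEP :: dcom where
  "GSTEP = DIf (Var 2)
     (DIf (F_Eq (Hd (Var 2)) F_Zero) (2 ::= Tl (Var 2))
       (DCall 3 DROP (Pair_Exp (Var 2) (Var 1)) ;;;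
        DIf (Var 3) (3 ::= Var 1 ;;; 1 ::= Var 2 ;;; 2 ::= Var 3)
          (DCall 2 AXPY (pair3 (F_Mul (Hd (Var 2)) (F_Inv (Hd (Var 1)))) (Var 1) (Var 2)) ;;;
           2 ::= Tl (Var 2))))
     DSkip"

definition EUCLID :: dcom where
  "EUCLID = 1 ::= Hd (Var 0) ;;; 2 ::= Tl (Var 0) ;;; DLoop (DLoop GSTEP) ;;; 0 ::= Var 1"

lemma call_EUCLID:
  assumes "sized N p" "length q \<le> N"
  shows "call R N EUCLID (VPair (elem_list p) (elem_list q)) = elem_list (gcdl R N p q)"
    and "sized N (gcdl R N p q)"
proof -
  define Q where "Q = (\<lambda>st (\<sigma> :: nat \<Rightarrow> 'a val). \<sigma> 1 = elem_list (fst st) \<and> \<sigma> 2 = elem_list (snd st) \<and>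
     sized N (fst st) \<and> length (snd st) \<le> N)"
  have step: "Q (gstep R st) (dsem R N GSTEP \<sigma>)" if "Q st \<sigma>" for st \<sigma>
  proof -
    obtain p q where st: "st = (p, q)" by (cases st)
    have h: "\<sigma> (Suc 0) = elem_list p" "\<sigma> 2 = elem_list q" "p \<noteq> []" "length p \<le> N" "length q \<le> N"
      using that by (simp_all add: Q_def st sized_def del: sized_length)
    show ?thesis
      using h by (auto simp: Q_def st GSTEP_def sized_def simp del: sized_length)
  qed
  have *: "Q (((gstep R ^^ N) ^^ N) (p, q)) (dsem R N (DLoop (DLoop GSTEP))
     ((init (VPair (elem_list p) (elem_list q)))(1 := elem_list p, 2 := elem_list q)))"
    by (rule dloop[where Q = Q], use assms in \<open>simp add: Q_def\<close>) (rule dloop[where Q = Q], assumption, rule step)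
  then have **: "Q ((gstep R ^^ (N * N)) (p, q)) (dsem R N (DLoop (DLoop GSTEP))
     ((init (VPair (elem_list p) (elem_list q)))(1 := elem_list p, 2 := elem_list q)))"
    by (simp only: funpow_mult)
  define S where "S = dsem R N (DLoop (DLoop GSTEP))
     ((init (VPair (elem_list p) (elem_list q)))(1 := elem_list p, 2 := elem_list q))"
  have Q: "Q ((gstep R ^^ (N * N)) (p, q)) S" using ** by (simp only: S_def)
  have "call R N EUCLID (VPair (elem_list p) (elem_list q)) = S 1"
    unfolding call_def EUCLID_def S_def by (simp del: dsem.simps(5))
  with Q show "call R N EUCLID (VPair (elem_list p) (elem_list q)) = elem_list (gcdl R N p q)"
    by (simp add: Q_def gcdl_def)
  from Q show "sized N (gcdl R N p q)" by (simp add: Q_def gcdl_def)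
qed

text \<open>Both components vanish at complementary sets of roots of \<open>g\<close>: \<open>e\<close> and \<open>1 - e\<close> for a trace \<open>e\<close>,
  \<open>1 - e\<close> and \<open>e\<^sup>2 + e\<close> for a quadratic character \<open>e\<close>, which is \<open>0\<close>, \<open>1\<close> or \<open>- 1\<close>.\<close>

definition sep :: "'a ring \<Rightarrow> bool list \<Rightarrow> 'a \<Rightarrow> 'a list \<Rightarrow> 'a list \<times> 'a list" where
  "sep R bs a g =
     (let u = onev R g in
      if \<one>\<^bsub>R\<^esub> \<oplus>\<^bsub>R\<^esub> \<one>\<^bsub>R\<^esub> = \<zero>\<^bsub>R\<^esub>
      then let e = tracemod R g (tl bs) (axpy R \<one>\<^bsub>R\<^esub> u u) (mulmod R g [a, \<zero>\<^bsub>R\<^esub>] u)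
           in (e, axpy R \<one>\<^bsub>R\<^esub> u e)
      else let e = powmod R g (tl bs) u (mulmod R g [\<one>\<^bsub>R\<^esub>, a] u)
           in (axpy R \<one>\<^bsub>R\<^esub> u e, axpy R (\<ominus>\<^bsub>R\<^esub> \<one>\<^bsub>R\<^esub>) e (mulmod R g e e)))"

definition SEP :: dcom where
  "SEP = 1 ::= Hd (Var 0) ;;; 2 ::= Hd (Tl (Var 0)) ;;; 3 ::= Tl (Tl (Var 0)) ;;; DCall 4 ONE (Var 3) ;;;
     DIf (F_Eq (F_Add F_One F_One) F_Zero)
       (DCall 5 MULMOD (pair3 (Var 3) (Pair_Exp (Var 1) (Pair_Exp F_Zero Nil_Exp)) (Var 4)) ;;;
        DCall 6 AXPY (pair3 F_One (Var 4) (Var 4)) ;;;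
        DCall 7 TRACE (pair3 (Tl (Var 2)) (Var 3) (Pair_Exp (Var 6) (Var 5))) ;;;
        DCall 8 AXPY (pair3 F_One (Var 4) (Var 7)) ;;; 0 ::= Pair_Exp (Var 7) (Var 8))
       (DCall 5 MULMOD (pair3 (Var 3) (Pair_Exp F_One (Pair_Exp (Var 1) Nil_Exp)) (Var 4)) ;;;
        DCall 7 POW (pair3 (Tl (Var 2)) (Var 3) (Pair_Exp (Var 4) (Var 5))) ;;;
        DCall 8 AXPY (pair3 F_One (Var 4) (Var 7)) ;;;
        DCall 9 MULMOD (pair3 (Var 3) (Var 7) (Var 7)) ;;;
        DCall 9 AXPY (pair3 (F_Neg F_One) (Var 7) (Var 9)) ;;; 0 ::= Pair_Exp (Var 8) (Var 9))"

lemma val_tl_enc_bits [simp]: "val_tl (enc_bits bs) = enc_bits (tl bs)"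
  by (cases bs) simp_all

lemma call_SEP:
  assumes "length bs \<le> N" "sized N g" "2 \<le> N"
  shows "call R N SEP (VPair (VElem a) (VPair (enc_bits bs) (elem_list g))) = enc_pair (sep R bs a g)"
    and "sized N (fst (sep R bs a g))" "sized N (snd (sep R bs a g))"
proof -
  let ?u = "onev R g" and ?m = "\<lambda>x y. mulmod R g [x, y] (onev R g)"
  have u: "sized N ?u" and m: "sized N (?m x y)" for x y using assms(2) by simp_all
  have b: "length (tl bs) \<le> N" using assms(1) by simp
  have [simp]: "call R N MULMOD (VPair (elem_list g) (VPair (VPair (VElem x) (VPair (VElem y) VNil)) (elem_list ?u)))
     = elem_list (?m x y)" for x y
    using call_MULMOD[of N g "[x, y]" ?u R] assms(2,3) u by simp
  note t = call_TRACE[OF b assms(2) sized_axpy[OF u u] m]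
  note p = call_POW[OF b assms(2) u m]
  show "call R N SEP (VPair (VElem a) (VPair (enc_bits bs) (elem_list g))) = enc_pair (sep R bs a g)"
    unfolding call_def[of _ _ SEP] unfolding SEP_def
    using assms(1,2) u t p by (simp add: sep_def Let_def)
  show "sized N (fst (sep R bs a g))" "sized N (snd (sep R bs a g))"
    using assms(2) u t p by (simp_all add: sep_def Let_def)
qed

text \<open>The factors that remain to be split, and the roots found so far.\<close>

type_synonym 'a rstate = "'a list list \<times> 'a list"

text \<open>A list of length 1 is a nonzero constant: it has no roots and is dropped.\<close>

definition push :: "'a list \<Rightarrow> 'a list list \<Rightarrow> 'a list list" where
  "push g gs = (if tl g = [] then gs else g # gs)"

fun rstep :: "'a ring \<Rightarrow> nat \<Rightarrow> bool list \<Rightarrow> 'a \<Rightarrow> 'a rstate \<Rightarrow> 'a rstate" where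
  "rstep R N bs a (g # gs, out) =
     (if tl (tl g) = [] then (gs, (\<ominus>\<^bsub>R\<^esub> hd (tl g) \<otimes>\<^bsub>R\<^esub> finv R (hd g)) # out)
      else (push (gcdl R N g (fst (sep R bs a g))) (push (gcdl R N g (snd (sep R bs a g))) gs), out))"
| "rstep R N bs a ([], out) = ([], out)"

fun enc_rstate :: "'a rstate \<Rightarrow> 'a val" where
  "enc_rstate (gs, out) = VPair (val_list (map elem_list gs)) (elem_list out)"

definition PUSH :: dcom where
  "PUSH = DIf (Tl (Hd (Var 0))) DSkip (0 ::= Tl (Var 0))"

lemma call_PUSH [simp]:
  "call R N PUSH (VPair (elem_list g) (val_list (map elem_list gs))) = val_list (map elem_list (push g gs))"
  by (simp add: PUSH_def call_def push_def)

definition RSTEP :: dcom where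
  "RSTEP = 1 ::= Hd (Var 0) ;;; 2 ::= Hd (Tl (Var 0)) ;;; 3 ::= Hd (Tl (Tl (Var 0))) ;;;
     4 ::= Tl (Tl (Tl (Var 0))) ;;; 5 ::= Hd (Var 3) ;;; 6 ::= Tl (Var 3) ;;;
     DIf (Tl (Tl (Var 5)))
       (DCall 7 SEP (pair3 (Var 1) (Var 2) (Var 5)) ;;;
        DCall 8 EUCLID (Pair_Exp (Var 5) (Hd (Var 7))) ;;; DCall 9 EUCLID (Pair_Exp (Var 5) (Tl (Var 7))) ;;;
        DCall 6 PUSH (Pair_Exp (Var 9) (Var 6)) ;;; DCall 6 PUSH (Pair_Exp (Var 8) (Var 6)) ;;;
        0 ::= Pair_Exp (Var 6) (Var 4))
       (0 ::= Pair_Exp (Var 6)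
          (Pair_Exp (F_Mul (F_Neg (Hd (Tl (Var 5)))) (F_Inv (Hd (Var 5)))) (Var 4)))"

lemma call_RSTEP:
  assumes "length bs \<le> N" "sized N g" "2 \<le> N" "tl g \<noteq> []"
  shows "call R N RSTEP (VPair (VElem a) (VPair (enc_bits bs) (enc_rstate (g # gs, out)))) =
    enc_rstate (rstep R N bs a (g # gs, out))"
proof -
  obtain e1 e2 where e: "sep R bs a g = (e1, e2)" by (cases "sep R bs a g")
  have s: "length e1 \<le> N" "length e2 \<le> N" "g \<noteq> []"
    using call_SEP(2,3)[OF assms(1-3), of R a] assms(2) by (simp_all add: e sized_def del: sized_length)
  show ?thesis
    unfolding call_def[of _ _ RSTEP] unfolding RSTEP_def
    using assms(4) s call_SEP(1)[OF assms(1-3), of R a]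
      call_EUCLID(1)[OF assms(2) s(1), of R] call_EUCLID(1)[OF assms(2) s(2), of R] by (simp add: e)
qed

text \<open>The residue of z^n comes from repeated squaring over the bits of n, so z^n - z is never
  written out. Also z is reduced modulo \<open>f\<close>, which matters when \<open>f\<close> is
  linear.\<close>

definition rinit :: "'a ring \<Rightarrow> nat \<Rightarrow> bool list \<Rightarrow> 'a list \<Rightarrow> 'a rstate" where
  "rinit R N bs f =
     (let u = onev R f; x = mulmod R f [\<one>\<^bsub>R\<^esub>, \<zero>\<^bsub>R\<^esub>] u; y = powmod R f bs u x
      in (push (gcdl R N f (axpy R \<one>\<^bsub>R\<^esub> x y)) [], []))"

definition RINIT :: dcom where
  "RINIT = 1 ::= Hd (Var 0) ;;; 2 ::= Tl (Var 0) ;;; DCall 3 ONE (Var 1) ;;;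
     DCall 4 MULMOD (pair3 (Var 1) (Pair_Exp F_One (Pair_Exp F_Zero Nil_Exp)) (Var 3)) ;;;
     DCall 5 POW (pair3 (Var 2) (Var 1) (Pair_Exp (Var 3) (Var 4))) ;;;
     DCall 5 AXPY (pair3 F_One (Var 4) (Var 5)) ;;; DCall 5 EUCLID (Pair_Exp (Var 1) (Var 5)) ;;;
     DCall 5 PUSH (Pair_Exp (Var 5) Nil_Exp) ;;; 0 ::= Pair_Exp (Var 5) Nil_Exp"

lemma call_RINIT [simp]:
  assumes "length bs \<le> N" "sized N f" "2 \<le> N"
  shows "call R N RINIT (VPair (elem_list f) (enc_bits bs)) = enc_rstate (rinit R N bs f)"
proof -
  let ?u = "onev R f" and ?m = "mulmod R f [\<one>\<^bsub>R\<^esub>, \<zero>\<^bsub>R\<^esub>] (onev R f)"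
  have u: "sized N ?u" and m: "sized N ?m" using assms(2) by simp_all
  have [simp]: "call R N MULMOD (VPair (elem_list f)
      (VPair (VPair (VElem \<one>\<^bsub>R\<^esub>) (VPair (VElem \<zero>\<^bsub>R\<^esub>) VNil)) (elem_list ?u))) = elem_list ?m"
    using call_MULMOD[of N f "[\<one>\<^bsub>R\<^esub>, \<zero>\<^bsub>R\<^esub>]" ?u R] assms(2,3) u by simp
  have [simp]: "call R N PUSH (VPair (elem_list g) VNil) = val_list (map elem_list (push g []))" for g
    using call_PUSH[of R N g "[]"] by simp
  note p = call_POW[OF assms(1,2) u m]
  have "length (axpy R \<one>\<^bsub>R\<^esub> ?m (powmod R f bs ?u ?m)) \<le> N" using m p by simp
  note q = call_EUCLID(1)[OF assms(2) this, of R]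
  show ?thesis
    unfolding call_def[of _ _ RINIT] unfolding RINIT_def
    using assms(2) u m p q by (simp add: rinit_def Let_def)
qed

definition recinit :: "'a ring \<Rightarrow> nat \<Rightarrow> nat \<Rightarrow> 'a list \<Rightarrow> 'a list \<Rightarrow> 'a rstate option" where
  "recinit R N t as c = map_option (rinit R N (nbits (order R))) (decode R N t as c)"

definition RECINIT :: dcom where
  "RECINIT = DCall 1 DECODE (Var 0) ;;;
     DIf (Var 1)
       (DCall 2 RINIT (Pair_Exp (Tl (Var 1)) (Hd (Tl (Tl (Tl (Var 0)))))) ;;; 0 ::= Pair_Exp Nil_Exp (Var 2))
       (0 ::= Nil_Exp)"

lemma length_decode:
  assumes "decode R N t as c = Some f" "length c = t" "t \<le> length as"
  shows "length f = Suc (length as)"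
  using assms by (auto simp: decode_def Let_def split: if_splits)

lemma call_RECINIT:
  assumes "length as + 2 \<le> N" "length c = t" "t \<le> length as" "length (nbits (order R)) \<le> N"
  shows "call R N RECINIT (Rec_input R t as c) = enc_opt enc_rstate (recinit R N t as c)"
proof (cases "decode R N t as c")
  case None
  then show ?thesis
    unfolding call_def[of _ _ RECINIT] unfolding RECINIT_def
    using assms by (simp add: recinit_def Rec_input_def)
next
  case (Some f)
  then have "sized N f" using length_decode[OF Some] assms by (auto simp: sized_def simp del: sized_length)
  with Some show ?thesis
    unfolding call_def[of _ _ RECINIT] unfolding RECINIT_def
    using assms by (simp add: recinit_def Rec_input_def binary_eq_enc_bits)
qed


section \<open>Coefficient lists as polynomials, residue arithmetic and greatest common
  divisors\<close>

section \<open>Coefficient lists and polynomials over a finite field\<close>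

primrec bval :: "bool list \<Rightarrow> nat" where
  "bval [] = 0"
| "bval (b # bs) = of_bool b + 2 * bval bs"

locale ff = field R for R :: "'a ring" (structure) +
  assumes fin: "finite (carrier R)"
begin

abbreviation P :: "'a list ring" where "P \<equiv> poly_ring R"

lemma sr: "subring (carrier R) R" by (rule carrier_is_subring)

interpretation P: domain P
  by (rule univ_poly_is_domain[OF sr])

abbreviation K :: "'a \<Rightarrow> 'a list" where "K \<equiv> poly_of_const"

definition pol :: "'a list \<Rightarrow> 'a list" where "pol L = normalize L"

lemma K_closed [simp]: "c \<in> carrier R \<Longrightarrow> K c \<in> carrier P"
  unfolding poly_of_const_def univ_poly_carrier[symmetric] by (rule normalize_gives_polynomial) simp

lemma K_hom: "ring_hom_ring R P K"
  using canonical_embedding_ring_hom[OF sr] by simp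

lemma K_zero [simp]: "K \<zero> = \<zero>\<^bsub>P\<^esub>"
  by (simp add: poly_of_const_def univ_poly_zero)

lemma K_one [simp]: "K \<one> = \<one>\<^bsub>P\<^esub>"
  by (simp add: poly_of_const_def univ_poly_one)

lemma X_closed [simp]: "X \<in> carrier P"
  by (rule var_closed(1)[OF sr])

lemma pol_closed [simp]: "set L \<subseteq> carrier R \<Longrightarrow> pol L \<in> carrier P"
  by (simp add: pol_def normalize_gives_polynomial flip: univ_poly_carrier)

lemma pol_polynomial: "L \<in> carrier P \<Longrightarrow> pol L = L"
  by (metis pol_def normalize_polynomial univ_poly_carrier)

lemma carrier_P_iff: "L \<in> carrier P \<longleftrightarrow> L = [] \<or> (set L \<subseteq> carrier R \<and> hd L \<noteq> \<zero>)"
  by (simp add: polynomial_def flip: univ_poly_carrier)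

lemma length_pol: "length (pol L) \<le> length L"
  unfolding pol_def by (rule normalize_length_le)

lemma eval_pol: "set L \<subseteq> carrier R \<Longrightarrow> x \<in> carrier R \<Longrightarrow> eval (pol L) x = eval L x"
  unfolding pol_def using eval_normalize by simp

lemma pol_eval: "set L \<subseteq> carrier R \<Longrightarrow> pol L = P.eval (map K L) X"
proof (induction L)
  case Nil
  then show ?case by (simp add: pol_def univ_poly_zero)
next
  case (Cons c L)
  have Lc: "set (map K L) \<subseteq> carrier P" using Cons.prems by auto
  show ?case
  proof (cases "c = \<zero>")
    case True
    have "pol (c # L) = pol L" using True by (simp add: pol_def)
    then show ?thesis using Cons True P.eval_in_carrier[OF Lc X_closed] by simp
  next
    case False
    then have "c # L \<in> carrier P" using Cons.prems by (simp add: carrier_P_iff)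
    from eval_rewrite[OF sr this] pol_polynomial[OF this] show ?thesis by (rule trans[rotated])
  qed
qed

lemma pol_Nil [simp]: "pol [] = \<zero>\<^bsub>P\<^esub>"
  by (simp add: pol_def univ_poly_zero)

lemma pol_Cons:
  assumes "c \<in> carrier R" "set L \<subseteq> carrier R"
  shows "pol (c # L) = K c \<otimes>\<^bsub>P\<^esub> X [^]\<^bsub>P\<^esub> length L \<oplus>\<^bsub>P\<^esub> pol L"
  using assms by (simp add: pol_eval)

lemma pol_zero_Cons: "pol (\<zero> # L) = pol L"
  by (simp add: pol_def)

lemma pol_tl: "L \<noteq> [] \<Longrightarrow> hd L = \<zero> \<Longrightarrow> pol (tl L) = pol L"
  by (cases L) (simp_all add: pol_zero_Cons)

lemma pol_snoc:
  assumes "set L \<subseteq> carrier R" "c \<in> carrier R"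
  shows "pol (L @ [c]) = X \<otimes>\<^bsub>P\<^esub> pol L \<oplus>\<^bsub>P\<^esub> K c"
  using assms(1)
proof (induction L)
  case Nil
  then show ?case using assms(2) by (simp add: pol_Cons)
next
  case (Cons a L)
  then show ?case using assms(2)
    by (simp add: pol_Cons P.r_distr P.a_assoc P.m_assoc P.m_comm P.m_lcomm)
qed

lemma pol_replicate_zero:
  assumes "set L \<subseteq> carrier R"
  shows "pol (L @ replicate k \<zero>) = pol L \<otimes>\<^bsub>P\<^esub> X [^]\<^bsub>P\<^esub> k"
proof (induction k)
  case (Suc k)
  have "L @ replicate (Suc k) \<zero> = (L @ replicate k \<zero>) @ [\<zero>]"
    by (simp add: replicate_append_same)
  moreover have "set (L @ replicate k \<zero>) \<subseteq> carrier R" using assms by auto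
  ultimately show ?case using Suc assms by (simp only: pol_snoc zero_closed)
     (simp add: P.m_assoc P.m_comm P.nat_pow_Suc P.m_lcomm)
qed (use assms in simp)

lemma axpy_closed:
  "c \<in> carrier R \<Longrightarrow> set xs \<subseteq> carrier R \<Longrightarrow> set ys \<subseteq> carrier R \<Longrightarrow> set (axpy R c xs ys) \<subseteq> carrier R"
proof (induction xs arbitrary: ys)
  case (Cons x xs)
  then show ?case by (cases ys) auto
qed simp

lemma pol_axpy_eq:
  assumes "c \<in> carrier R" "set xs \<subseteq> carrier R" "set ys \<subseteq> carrier R" "length xs = length ys"
  shows "pol (axpy R c xs ys) = pol ys \<ominus>\<^bsub>P\<^esub> K c \<otimes>\<^bsub>P\<^esub> pol xs"
  using assms(4,2,3)
proof (induction xs ys rule: list_induct2)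
  case Nil
  then show ?case using assms(1) by (simp add: a_minus_def)
next
  case (Cons x xs y ys)
  interpret h: ring_hom_ring R P K by (rule K_hom)
  have c: "set (axpy R c xs ys) \<subseteq> carrier R" using Cons.prems axpy_closed assms(1) by simp
  show ?case using Cons assms(1) c
    by (simp add: pol_Cons a_minus_def P.l_distr P.r_distr P.minus_add P.l_minus P.a_assoc P.a_comm
        P.a_lcomm P.m_assoc)
qed

lemma axpy_pad_left:
  assumes "c \<in> carrier R" "set ys \<subseteq> carrier R" "length xs \<le> length ys"
  shows "axpy R c xs ys = axpy R c (xs @ replicate (length ys - length xs) \<zero>) ys"
  using assms(2,3)
proof (induction xs arbitrary: ys)
  case Nil
  then show ?case
  proof (induction ys)
    case (Cons y ys)
    then show ?case using assms(1) by simp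
  qed simp
next
  case (Cons x xs)
  then show ?case by (cases ys) auto
qed

lemma axpy_pad_right:
  assumes "c \<in> carrier R" "set xs \<subseteq> carrier R" "length ys \<le> length xs"
  shows "axpy R c xs ys = axpy R c xs (ys @ replicate (length xs - length ys) \<zero>)"
  using assms(2,3)
proof (induction ys arbitrary: xs)
  case Nil
  then show ?case
  proof (induction xs)
    case (Cons y ys)
    then show ?case using assms(1) by simp
  qed simp
next
  case (Cons x ys)
  then show ?case by (cases xs) auto
qed

text \<open>With the leading coefficient first, aligning heads multiplies the shorter polynomial by
  a power of \<open>X\<close>.\<close>

lemma pol_axpy_le:
  assumes "c \<in> carrier R" "set xs \<subseteq> carrier R" "set ys \<subseteq> carrier R" "length xs \<le> length ys"
  shows "pol (axpy R c xs ys) =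
    pol ys \<ominus>\<^bsub>P\<^esub> K c \<otimes>\<^bsub>P\<^esub> (pol xs \<otimes>\<^bsub>P\<^esub> X [^]\<^bsub>P\<^esub> (length ys - length xs))"
proof -
  have "set (xs @ replicate (length ys - length xs) \<zero>) \<subseteq> carrier R" using assms(2) by auto
  then show ?thesis
    unfolding axpy_pad_left[OF assms(1,3,4)] using assms
    by (subst pol_axpy_eq) (simp_all add: pol_replicate_zero)
qed

lemma pol_axpy_ge:
  assumes "c \<in> carrier R" "set xs \<subseteq> carrier R" "set ys \<subseteq> carrier R" "length ys \<le> length xs"
  shows "pol (axpy R c xs ys) =
    pol ys \<otimes>\<^bsub>P\<^esub> X [^]\<^bsub>P\<^esub> (length xs - length ys) \<ominus>\<^bsub>P\<^esub> K c \<otimes>\<^bsub>P\<^esub> pol xs"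
proof -
  have "set (ys @ replicate (length xs - length ys) \<zero>) \<subseteq> carrier R" using assms(3) by auto
  then show ?thesis
    unfolding axpy_pad_right[OF assms(1,2,4)] using assms
    by (subst pol_axpy_eq) (simp_all add: pol_replicate_zero)
qed

lemma finv_closed [simp]: "a \<in> carrier R \<Longrightarrow> finv R a \<in> carrier R"
  by (simp add: finv_def field_Units)

lemma finv_mult: "a \<in> carrier R \<Longrightarrow> a \<noteq> \<zero> \<Longrightarrow> finv R a \<otimes> a = \<one>"
  by (simp add: finv_def field_Units)

lemma hd_axpy: "xs \<noteq> [] \<Longrightarrow> ys \<noteq> [] \<Longrightarrow> hd (axpy R c xs ys) = hd ys \<oplus> \<ominus> (c \<otimes> hd xs)"
  by (cases xs; cases ys) auto

lemma elim_hd: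
  assumes "set xs \<subseteq> carrier R" "set ys \<subseteq> carrier R" "xs \<noteq> []" "ys \<noteq> []" "hd xs \<noteq> \<zero>"
  shows "hd (axpy R (hd ys \<otimes> finv R (hd xs)) xs ys) = \<zero>"
proof -
  have c: "hd xs \<in> carrier R" "hd ys \<in> carrier R" using assms by (cases xs; cases ys; auto)+
  then have "hd ys \<otimes> finv R (hd xs) \<otimes> hd xs = hd ys"
    using assms(5) by (simp add: m_assoc finv_mult)
  then show ?thesis using assms c by (simp add: hd_axpy r_neg)
qed

lemma set_tl: "set L \<subseteq> A \<Longrightarrow> set (tl L) \<subseteq> A"
  by (cases L) auto

text \<open>Residues modulo a polynomial of degree \<open>d\<close>: exactly \<open>d\<close>
  coefficients, with leading zeros allowed.\<close>

definition vec :: "nat \<Rightarrow> 'a list \<Rightarrow> bool" where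
  "vec d L \<longleftrightarrow> length L = d \<and> set L \<subseteq> carrier R"

definition modulus :: "nat \<Rightarrow> 'a list \<Rightarrow> bool" where
  "modulus d g \<longleftrightarrow> g \<in> carrier P \<and> length g = Suc d \<and> d > 0"

lemma modulusD:
  assumes "modulus d g"
  shows "set g \<subseteq> carrier R" "hd g \<noteq> \<zero>" "g \<noteq> []" "length g = Suc d" "d > 0" "pol g = g" "g \<in> carrier P"
  using assms by (auto simp: modulus_def carrier_P_iff pol_polynomial)

lemma vecD: "vec d L \<Longrightarrow> set L \<subseteq> carrier R" "vec d L \<Longrightarrow> length L = d"
  by (simp_all add: vec_def)

lemma vec_axpy: "c \<in> carrier R \<Longrightarrow> vec d p \<Longrightarrow> vec d q \<Longrightarrow> vec d (axpy R c p q)"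
  by (simp add: vec_def axpy_closed)

lemma pol_axpy_vec:
  "c \<in> carrier R \<Longrightarrow> vec d p \<Longrightarrow> vec d q \<Longrightarrow> pol (axpy R c p q) = pol q \<ominus>\<^bsub>P\<^esub> K c \<otimes>\<^bsub>P\<^esub> pol p"
  by (simp add: vec_def pol_axpy_eq)

text \<open>The multiple of \<open>g\<close> may stay existential, since every homomorphism that
  kills \<open>g\<close> ignores it.\<close>

lemma mstep_props:
  assumes g: "modulus d g" and q: "vec d q" and acc: "vec d acc" and c: "c \<in> carrier R"
  shows "vec d (mstep R g q c acc)"
    and "\<exists>k\<in>carrier R. pol (mstep R g q c acc) =
       (X \<otimes>\<^bsub>P\<^esub> pol acc \<ominus>\<^bsub>P\<^esub> K k \<otimes>\<^bsub>P\<^esub> g) \<oplus>\<^bsub>P\<^esub> K c \<otimes>\<^bsub>P\<^esub> pol q"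
proof -
  note g' = modulusD[OF g]
  have ne: "acc \<noteq> []" using acc g' by (auto simp: vec_def)
  define k where "k = hd acc \<otimes> finv R (hd g)"
  have cr: "hd acc \<in> carrier R" "hd g \<in> carrier R" using ne acc g' by (cases acc; cases g; auto simp: vec_def)+
  then have k: "k \<in> carrier R" by (simp add: k_def)
  define A where "A = axpy R k g acc"
  have A: "set A \<subseteq> carrier R" "length A = Suc d" "hd A = \<zero>"
    using axpy_closed[OF k] g' vecD[OF acc] elim_hd[of g acc] ne by (simp_all add: A_def k_def)
  have Ap: "pol A = X \<otimes>\<^bsub>P\<^esub> pol acc \<ominus>\<^bsub>P\<^esub> K k \<otimes>\<^bsub>P\<^esub> g"
    using pol_axpy_ge[of k g acc] k g' vecD[OF acc] by (simp add: A_def P.m_comm)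
  have tA: "vec d (tl A)" "pol (tl A) = pol A"
    using A set_tl[of A] pol_tl[of A] by (auto simp: vec_def simp flip: length_greater_0_conv)
  have eq: "mstep R g q c acc = axpy R (\<ominus> c) q (tl A)" by (simp add: mstep_def A_def k_def)
  then show "vec d (mstep R g q c acc)" using vec_axpy[of "\<ominus> c"] c q tA by simp
  interpret h: ring_hom_ring R P K by (rule K_hom)
  have "pol (mstep R g q c acc) = pol A \<ominus>\<^bsub>P\<^esub> (\<ominus>\<^bsub>P\<^esub> K c) \<otimes>\<^bsub>P\<^esub> pol q"
    using pol_axpy_vec[OF _ q tA(1), of "\<ominus> c"] c eq tA(2) by simp
  also have "\<dots> = pol A \<oplus>\<^bsub>P\<^esub> K c \<otimes>\<^bsub>P\<^esub> pol q"
    using A c vecD[OF q] by (simp add: a_minus_def P.l_minus)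
  finally show "\<exists>k\<in>carrier R. pol (mstep R g q c acc) =
       (X \<otimes>\<^bsub>P\<^esub> pol acc \<ominus>\<^bsub>P\<^esub> K k \<otimes>\<^bsub>P\<^esub> g) \<oplus>\<^bsub>P\<^esub> K c \<otimes>\<^bsub>P\<^esub> pol q"
    using Ap k by auto
qed

lemma vec_mulmod:
  assumes "modulus d g" "vec d q" "set p \<subseteq> carrier R"
  shows "vec d (mulmod R g p q)"
proof -
  have "vec d (fold (mstep R g q) p acc)" if "vec d acc" for acc
    using that assms(3) by (induction p arbitrary: acc) (simp_all add: mstep_props(1)[OF assms(1,2)])
  then show ?thesis using vec_axpy[OF one_closed assms(2,2)] by (simp add: mulmod_def)
qed

lemma vec_onev: "modulus d g \<Longrightarrow> vec d (onev R g)"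
  by (auto simp: modulus_def vec_def onev_def)

lemma pol_onev: "pol (onev R g) = \<one>\<^bsub>P\<^esub>"
proof -
  have "pol (replicate k \<zero> @ [\<one>]) = pol [\<one>]" for k
    by (induction k) (simp_all add: pol_zero_Cons)
  then show ?thesis by (simp add: onev_def pol_Cons)
qed

text \<open>The programs compute modulo \<open>g\<close>; instead of congruences, use all homomorphisms \<open>h\<close> with
  \<open>h g = 0\<close>: the evaluation at a root of \<open>g\<close>, and the map to the quotient ring.\<close>

context
  fixes Q :: "('q, 'm) ring_scheme" and h :: "'a list \<Rightarrow> 'q" and d :: nat and g :: "'a list"
  assumes hom: "ring_hom_cring P Q h" and g: "modulus d g" and hg: "h g = \<zero>\<^bsub>Q\<^esub>"
begin

interpretation h: ring_hom_cring P Q h by (rule hom)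

lemma h_mulmod:
  assumes q: "vec d q" and p: "set p \<subseteq> carrier R"
  shows "h (pol (mulmod R g p q)) = h (pol p) \<otimes>\<^bsub>Q\<^esub> h (pol q)"
proof -
  \<comment> \<open>Generalized to an accumulator that represents \<open>p0 * q\<close>, where
    \<open>p0\<close> is the prefix of the multiplier consumed so far.\<close>
  have "h (pol (fold (mstep R g q) p acc)) = h (pol (p0 @ p)) \<otimes>\<^bsub>Q\<^esub> h (pol q)"
    if "vec d acc" "set p0 \<subseteq> carrier R" "h (pol acc) = h (pol p0) \<otimes>\<^bsub>Q\<^esub> h (pol q)" for acc p0
    using that p
  proof (induction p arbitrary: acc p0)
    case (Cons c p)
    then have c: "c \<in> carrier R" by simp
    obtain k where k: "k \<in> carrier R" "pol (mstep R g q c acc) =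
       (X \<otimes>\<^bsub>P\<^esub> pol acc \<ominus>\<^bsub>P\<^esub> K k \<otimes>\<^bsub>P\<^esub> g) \<oplus>\<^bsub>P\<^esub> K c \<otimes>\<^bsub>P\<^esub> pol q"
      using mstep_props(2)[OF g q Cons.prems(1) c] by blast
    have cl: "pol acc \<in> carrier P" "pol q \<in> carrier P" "g \<in> carrier P" "pol p0 \<in> carrier P"
      using vecD[OF Cons.prems(1)] vecD[OF q] modulusD[OF g] Cons.prems(2) by simp_all
    have "h (pol (mstep R g q c acc)) = h X \<otimes>\<^bsub>Q\<^esub> h (pol acc) \<oplus>\<^bsub>Q\<^esub> h (K c) \<otimes>\<^bsub>Q\<^esub> h (pol q)"
      using k(1) c cl by (simp add: k(2) a_minus_def hg)
    also have "\<dots> = h (pol (p0 @ [c])) \<otimes>\<^bsub>Q\<^esub> h (pol q)"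
      using c cl Cons.prems by (simp add: pol_snoc h.S.l_distr h.S.m_assoc)
    finally show ?case
      using Cons.IH[OF mstep_props(1)[OF g q Cons.prems(1) c], of "p0 @ [c]"] Cons.prems c by simp
  qed simp
  note this[of "axpy R \<one> q q" "[]"]
  moreover have "pol (axpy R \<one> q q) = \<zero>\<^bsub>P\<^esub>"
    using pol_axpy_vec[OF one_closed q q] vecD[OF q] by (simp add: a_minus_def P.r_neg)
  ultimately show ?thesis
    using vec_axpy[OF one_closed q q] vecD[OF q] by (simp add: mulmod_def)
qed

lemma h_powmod:
  assumes "vec d acc" "vec d y"
  shows "vec d (powmod R g bs acc y) \<and>
    h (pol (powmod R g bs acc y)) = h (pol acc) \<otimes>\<^bsub>Q\<^esub> h (pol y) [^]\<^bsub>Q\<^esub> bval bs"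
  using assms unfolding powmod_def
proof (induction bs arbitrary: acc y)
  case Nil
  then show ?case using vecD(1)[OF Nil(1)] by simp
next
  case (Cons b bs)
  have cl: "h (pol acc) \<in> carrier Q" "h (pol y) \<in> carrier Q"
    using Cons.prems vecD by simp_all
  have v: "vec d (mulmod R g acc y)" "vec d (mulmod R g y y)"
    using Cons.prems vec_mulmod[OF g] vecD by blast+
  have y2: "h (pol (mulmod R g y y)) [^]\<^bsub>Q\<^esub> k = h (pol y) [^]\<^bsub>Q\<^esub> (2 * k)" for k :: nat
  proof -
    have "h (pol (mulmod R g y y)) = h (pol y) [^]\<^bsub>Q\<^esub> (2::nat)"
      using h_mulmod Cons.prems vecD cl by (simp add: numeral_2_eq_2)
    then show ?thesis using cl by (simp add: h.S.nat_pow_pow)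
  qed
  show ?case
  proof (cases b)
    case True
    have "h (pol (mulmod R g acc y)) \<otimes>\<^bsub>Q\<^esub> h (pol y) [^]\<^bsub>Q\<^esub> (2 * bval bs)
       = h (pol acc) \<otimes>\<^bsub>Q\<^esub> h (pol y) [^]\<^bsub>Q\<^esub> Suc (2 * bval bs)"
      using h_mulmod[of y acc] Cons.prems vecD cl
      by (simp add: h.S.m_assoc h.S.m_comm[of "h (pol y)"])
    then show ?thesis using Cons.IH[OF v] True y2 by simp
  next
    case False
    then show ?thesis using Cons.IH[OF Cons.prems(1) v(2)] y2 by simp
  qed
qed

end

end


context ff
begin

interpretation P: domain P
  by (rule univ_poly_is_domain[OF sr])

definition zeros :: "'a list \<Rightarrow> 'a set" where
  "zeros L = {x \<in> carrier R. eval L x = \<zero>}"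

lemma finite_zeros [simp]: "finite (zeros L)"
  using fin by (simp add: zeros_def)

lemma zeros_pol: "set L \<subseteq> carrier R \<Longrightarrow> zeros (pol L) = zeros L"
  by (auto simp: zeros_def eval_pol)

lemma P_set: "p \<in> carrier P \<Longrightarrow> set p \<subseteq> carrier R"
  by (auto simp: carrier_P_iff)

lemma card_zeros_less:
  assumes "q \<in> carrier P" "q \<noteq> []"
  shows "card (zeros q) < length q"
proof -
  have "zeros q = set_mset (roots q)"
    using roots_mem_iff_is_root[OF assms(1)] assms(2) by (auto simp: zeros_def is_root_def)
  moreover have "card (set_mset (roots q)) \<le> size (roots q)"
    unfolding size_multiset_overloaded_eq
    by (rule order_trans[OF eq_imp_le sum_mono[of _ "\<lambda>_. 1"]]) auto
  ultimately show ?thesis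
    using size_roots_le_degree[OF assms(1)] assms(2) by (cases q) auto
qed

lemma poly_eq_zeroI:
  assumes "q \<in> carrier P" "S \<subseteq> zeros q" "length q \<le> card S"
  shows "q = []"
  using card_zeros_less[OF assms(1)] card_mono[OF finite_zeros assms(2)] assms(3) by fastforce

lemma P_mult:
  assumes "p \<in> carrier P" "q \<in> carrier P" "p \<noteq> []" "q \<noteq> []"
  shows "p \<otimes>\<^bsub>P\<^esub> q \<noteq> []" "length (p \<otimes>\<^bsub>P\<^esub> q) + 1 = length p + length q"
proof -
  have "p \<otimes>\<^bsub>P\<^esub> q \<noteq> \<zero>\<^bsub>P\<^esub>" using assms P.integral_iff[of p q] by (simp add: univ_poly_zero)
  then show *: "p \<otimes>\<^bsub>P\<^esub> q \<noteq> []" by (simp add: univ_poly_zero)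
  have "degree (p \<otimes>\<^bsub>P\<^esub> q) = degree p + degree q"
    using poly_mult_degree_eq[OF sr, of p q] assms by (simp add: univ_poly_carrier univ_poly_mult)
  then show "length (p \<otimes>\<^bsub>P\<^esub> q) + 1 = length p + length q"
    using * assms(3,4) by (cases "p \<otimes>\<^bsub>P\<^esub> q"; cases p; cases q) auto
qed

lemma eval_P_hom: "x \<in> carrier R \<Longrightarrow> ring_hom_cring P R (\<lambda>p. eval p x)"
  by (rule eval_cring_hom[OF sr])

lemma eval_P_mult:
  "p \<in> carrier P \<Longrightarrow> q \<in> carrier P \<Longrightarrow> x \<in> carrier R \<Longrightarrow> eval (p \<otimes>\<^bsub>P\<^esub> q) x = eval p x \<otimes> eval q x"
  using ring_hom_memE(2)[OF eval_is_hom[OF sr]] by blast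

lemma eval_P_add:
  "p \<in> carrier P \<Longrightarrow> q \<in> carrier P \<Longrightarrow> x \<in> carrier R \<Longrightarrow> eval (p \<oplus>\<^bsub>P\<^esub> q) x = eval p x \<oplus> eval q x"
  using ring_hom_memE(3)[OF eval_is_hom[OF sr]] by blast

text \<open>Equivalently, \<open>g\<close> is a nonzero constant times a product of distinct monic
  linear factors over the field.\<close>

definition full :: "'a list \<Rightarrow> bool" where
  "full g \<longleftrightarrow> g \<in> carrier P \<and> length g = Suc (card (zeros g))"

text \<open>Counting zeros: those of \<open>q\<close> lie among the zeros of \<open>d\<close> and of
  the cofactor, each of which has at most as many as its degree. As the degrees add up, equality
  holds throughout.\<close>

lemma full_divisor:
  assumes q: "full q" and d: "d \<in> carrier P" "d pdivides q"
  shows "full d"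
proof -
  have q': "q \<in> carrier P" "q \<noteq> []" using q by (auto simp: full_def)
  obtain c where c: "c \<in> carrier P" "q = d \<otimes>\<^bsub>P\<^esub> c"
    using d(2) by (auto simp: pdivides_def factor_def)
  have ne: "d \<noteq> []" "c \<noteq> []"
    using q'(2) c d(1) by (auto simp flip: univ_poly_zero[of R "carrier R"])
  have "zeros q \<subseteq> zeros d \<union> zeros c"
  proof
    fix x assume x: "x \<in> zeros q"
    then have "x \<in> carrier R" by (simp add: zeros_def)
    have "eval d x \<otimes> eval c x = \<zero>"
      using x eval_P_mult[OF d(1) c(1), of x] by (simp add: zeros_def c(2))
    moreover have "eval d x \<in> carrier R" "eval c x \<in> carrier R"
      using eval_in_carrier[OF P_set[OF d(1)]] eval_in_carrier[OF P_set[OF c(1)]] \<open>x \<in> carrier R\<close>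
      by auto
    ultimately show "x \<in> zeros d \<union> zeros c"
      using integral[of "eval d x" "eval c x"] \<open>x \<in> carrier R\<close> by (auto simp: zeros_def)
  qed
  then have "card (zeros q) \<le> card (zeros d \<union> zeros c)" by (intro card_mono) auto
  also have "\<dots> \<le> card (zeros d) + card (zeros c)" by (rule card_Un_le)
  finally have "card (zeros q) \<le> card (zeros d) + card (zeros c)" .
  then show ?thesis
    using q card_zeros_less[OF d(1) ne(1)] card_zeros_less[OF c(1) ne(2)] P_mult(2)[OF d(1) c(1) ne]
      c(2) d(1) by (simp add: full_def)
qed

lemma pdivides_add_mult:
  assumes "d pdivides a" "d pdivides b" "a \<in> carrier P" "b \<in> carrier P" "r \<in> carrier P" "d \<in> carrier P"
  shows "d pdivides (a \<oplus>\<^bsub>P\<^esub> r \<otimes>\<^bsub>P\<^esub> b)"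
proof -
  obtain a' b' where "a' \<in> carrier P" "a = d \<otimes>\<^bsub>P\<^esub> a'" "b' \<in> carrier P" "b = d \<otimes>\<^bsub>P\<^esub> b'"
    using assms(1,2) by (auto simp: pdivides_def factor_def)
  then have "a \<oplus>\<^bsub>P\<^esub> r \<otimes>\<^bsub>P\<^esub> b = d \<otimes>\<^bsub>P\<^esub> (a' \<oplus>\<^bsub>P\<^esub> r \<otimes>\<^bsub>P\<^esub> b')" "a' \<oplus>\<^bsub>P\<^esub> r \<otimes>\<^bsub>P\<^esub> b' \<in> carrier P"
    using assms(5,6) by (simp_all add: P.r_distr P.m_lcomm)
  then show ?thesis by (auto simp: pdivides_def factor_def)
qed

lemma pdivides_trans:
  assumes "d pdivides a" "a pdivides b" "d \<in> carrier P"
  shows "d pdivides b"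
  using assms P.divides_trans unfolding pdivides_def by blast

text \<open>Every other step removes a coefficient and gains 2; the extra unit is what a swap gives
  up, since it preserves the total length.\<close>

definition gmeasure :: "'a list \<times> 'a list \<Rightarrow> nat" where
  "gmeasure s = 2 * (length (fst s) + length (snd s)) +
     (if snd s \<noteq> [] \<and> hd (snd s) \<noteq> \<zero> \<and> length (snd s) < length (fst s) then 1 else 0)"

definition gstate :: "'a list \<times> 'a list \<Rightarrow> bool" where
  "gstate s \<longleftrightarrow> fst s \<in> carrier P \<and> fst s \<noteq> [] \<and> set (snd s) \<subseteq> carrier R"

text \<open>Only two properties of a greatest common divisor are tracked: it divides both inputs,
  and its zeros are their common zeros. The second involves field elements only, the first also
  covers irreducible factors of higher degree.\<close>

definition gless :: "'a list \<times> 'a list \<Rightarrow> 'a list \<times> 'a list \<Rightarrow> bool" where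
  "gless s' s \<longleftrightarrow> zeros (fst s') \<inter> zeros (snd s') = zeros (fst s) \<inter> zeros (snd s) \<and>
     (\<forall>d\<in>carrier P. d pdivides fst s' \<longrightarrow> d pdivides pol (snd s') \<longrightarrow>
        d pdivides fst s \<and> d pdivides pol (snd s))"

lemma gstep_props:
  assumes "gstate s"
  shows "gstate (gstep R s)" "gless (gstep R s) s"
    "snd s \<noteq> [] \<Longrightarrow> gmeasure (gstep R s) < gmeasure s"
    "snd s = [] \<Longrightarrow> gstep R s = s"
proof -
  obtain p q where s: "s = (p, q)" by (cases s)
  have p: "p \<in> carrier P" "p \<noteq> []" "set p \<subseteq> carrier R" "hd p \<noteq> \<zero>" and q: "set q \<subseteq> carrier R"
    using assms by (auto simp: gstate_def s carrier_P_iff)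
  consider (nil) "q = []" | (zero) "q \<noteq> []" "hd q = \<zero>"
    | (swap) "q \<noteq> []" "hd q \<noteq> \<zero>" "length p > length q"
    | (red) "q \<noteq> []" "hd q \<noteq> \<zero>" "length p \<le> length q" by linarith
  then have "gstate (gstep R s) \<and> gless (gstep R s) s \<and>
     (q \<noteq> [] \<longrightarrow> gmeasure (gstep R s) < gmeasure s) \<and> (q = [] \<longrightarrow> gstep R s = s)"
  proof cases
    case nil
    then show ?thesis using assms by (simp add: s gless_def)
  next
    case zero
    have "zeros (tl q) = zeros q"
      using zeros_pol[of q] zeros_pol[of "tl q"] pol_tl[OF zero] set_tl[OF q] q by simp
    then show ?thesis using zero p q pol_tl[OF zero] set_tl[OF q]
      by (cases q) (auto simp: s gstate_def gless_def gmeasure_def)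
  next
    case swap
    then have "q \<in> carrier P" using q by (simp add: carrier_P_iff)
    then show ?thesis using swap p q
      by (auto simp: s gstate_def gless_def gmeasure_def pol_polynomial)
  next
    case red
    define c where "c = hd q \<otimes> finv R (hd p)"
    have c: "c \<in> carrier R" using p q red(1) by (cases p; cases q) (auto simp: c_def)
    define A where "A = axpy R c p q"
    have A: "set A \<subseteq> carrier R" "length A = length q" "hd A = \<zero>" "A \<noteq> []"
      using axpy_closed[OF c p(3) q] elim_hd[of p q] p q red by (simp_all add: A_def c_def max_def)
    define r where "r = K c \<otimes>\<^bsub>P\<^esub> X [^]\<^bsub>P\<^esub> (length q - length p)"
    have r: "r \<in> carrier P" using c by (simp add: r_def)
    have "pol A = pol q \<ominus>\<^bsub>P\<^esub> r \<otimes>\<^bsub>P\<^esub> p"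
      using pol_axpy_le[OF c p(3) q red(3)] c p
      by (simp add: A_def r_def pol_polynomial P.m_assoc P.m_comm[of p])
    then have qA: "pol q = pol (tl A) \<oplus>\<^bsub>P\<^esub> r \<otimes>\<^bsub>P\<^esub> p"
      using pol_tl[OF A(4,3)] q r p(1) by (simp add: a_minus_def P.a_assoc P.l_neg)
    have tA: "set (tl A) \<subseteq> carrier R" using set_tl[OF A(1)] .
    have ev: "eval q x = eval (tl A) x \<oplus> eval r x \<otimes> eval p x" if "x \<in> carrier R" for x
    proof -
      have "eval (pol q) x = eval (pol (tl A)) x \<oplus> eval r x \<otimes> eval p x"
        using that r p(1) tA by (simp add: qA eval_P_add eval_P_mult)
      then show ?thesis using that q tA by (simp add: eval_pol)
    qed
    have z: "zeros p \<inter> zeros (tl A) = zeros p \<inter> zeros q"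
      using ev eval_in_carrier[OF tA] eval_in_carrier[OF P_set[OF r]] by (auto simp: zeros_def)
    have eq: "gstep R s = (p, tl A)" using red by (simp add: s A_def c_def)
    have "gless (gstep R s) s"
      unfolding gless_def eq using z pdivides_add_mult[where r = r and b = p and a = "pol (tl A)"] qA r p tA
      by (auto simp: s)
    moreover have "gmeasure (p, tl A) < gmeasure s"
      using red A by (cases A) (auto simp: gmeasure_def s)
    ultimately show ?thesis using p tA red(1) by (simp add: eq gstate_def)
  qed
  then show "gstate (gstep R s)" "gless (gstep R s) s"
    "snd s \<noteq> [] \<Longrightarrow> gmeasure (gstep R s) < gmeasure s"
    "snd s = [] \<Longrightarrow> gstep R s = s" by (auto simp: s)
qed

lemma gcdl_props:
  assumes "p \<in> carrier P" "p \<noteq> []" "set q \<subseteq> carrier R" "length p \<le> N" "length q \<le> N" "5 \<le> N"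
  shows "gcdl R N p q \<in> carrier P" "gcdl R N p q \<noteq> []" "gcdl R N p q pdivides p"
    "gcdl R N p q pdivides pol q" "zeros (gcdl R N p q) = zeros p \<inter> zeros q"
proof -
  have trans: "gless a c" if "gless a b" "gless b c" for a b c
    using that by (auto simp: gless_def)
  have it: "gstate ((gstep R ^^ m) s) \<and> gless ((gstep R ^^ m) s) s \<and>
      (snd ((gstep R ^^ m) s) = [] \<or> gmeasure ((gstep R ^^ m) s) + m \<le> gmeasure s)"
    if "gstate s" for s m
  proof (induction m)
    case 0
    show ?case using that by (simp add: gless_def)
  next
    case (Suc m)
    then show ?case
      using gstep_props[of "(gstep R ^^ m) s"] trans[of "gstep R ((gstep R ^^ m) s)"]
      by (cases "snd ((gstep R ^^ m) s) = []") fastforce+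
  qed
  define S where "S = (gstep R ^^ (N * N)) (p, q)"
  have S: "gstate S" "gless S (p, q)" "snd S = [] \<or> gmeasure S + N * N \<le> gmeasure (p, q)"
    using it[of "(p, q)" "N * N"] assms by (auto simp: gstate_def S_def)
  have "gmeasure (p, q) \<le> 2 * (length p + length q) + 1" by (simp add: gmeasure_def)
  also have "\<dots> < 5 * N" using assms(4-6) by auto
  also have "\<dots> \<le> N * N" using assms(6) by simp
  finally have "gmeasure (p, q) < N * N" .
  then have nil: "snd S = []" using S(3) by auto
  have fst: "fst S = gcdl R N p q" by (simp add: S_def gcdl_def)
  show c: "gcdl R N p q \<in> carrier P" "gcdl R N p q \<noteq> []"
    using S(1) by (auto simp: gstate_def fst)
  have "gcdl R N p q pdivides gcdl R N p q" using c P.divides_refl by (simp add: pdivides_def)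
  moreover have "gcdl R N p q pdivides \<zero>\<^bsub>P\<^esub>"
    using pdivides_zero[OF sr c(1)] by (simp add: univ_poly_zero)
  ultimately show "gcdl R N p q pdivides p" "gcdl R N p q pdivides pol q"
    using S(2) c by (auto simp: gless_def nil fst)
  show "zeros (gcdl R N p q) = zeros p \<inter> zeros q"
    using S(2) by (auto simp: gless_def nil fst zeros_def)
qed


subsection \<open>The polynomial with all field elements as simple roots\<close>

lemma order_ge_2: "2 \<le> order R"
proof -
  have "card {\<zero>, \<one>} \<le> card (carrier R)" by (rule card_mono[OF fin]) auto
  then show ?thesis by (simp add: order_def)
qed

lemma pow_order: "x \<in> carrier R \<Longrightarrow> x [^] order R = x"
proof (cases "x = \<zero>")
  case True
  then show ?thesis using order_ge_2 by (simp add: nat_pow_zero)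
next
  case False
  assume x: "x \<in> carrier R"
  interpret G: group "Multiplicative_Group.mult_of R" by (rule field_mult_group)
  have "order (Multiplicative_Group.mult_of R) = order R - 1"
    using order_mult_of[OF fin] by simp
  then have "x [^] (order R - 1) = \<one>"
    using G.pow_order_eq_1[of x] x False fin by (simp add: Multiplicative_Group.nat_pow_mult_of)
  moreover have "order R = Suc (order R - 1)" using order_ge_2 by simp
  ultimately show ?thesis using x nat_pow_Suc by (metis l_one)
qed

text \<open>The coefficient list of z^n - z, where n is the order of the field.\<close>

definition allroots :: "'a list" where
  "allroots = \<one> # replicate (order R - 2) \<zero> @ [\<ominus> \<one>, \<zero>]"

lemma pol_zeros_append: "pol (replicate k \<zero> @ L) = pol L"
  by (induction k) (simp_all add: pol_zero_Cons)

lemma set_allroots: "set allroots \<subseteq> carrier R"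
  by (auto simp: allroots_def)

lemma pol_allroots: "pol allroots = X [^]\<^bsub>P\<^esub> order R \<ominus>\<^bsub>P\<^esub> X"
proof -
  interpret h: ring_hom_ring R P K by (rule K_hom)
  have l: "length (replicate (order R - 2) \<zero> @ [\<ominus> \<one>, \<zero>]) = order R" using order_ge_2 by simp
  have "pol allroots = K \<one> \<otimes>\<^bsub>P\<^esub> X [^]\<^bsub>P\<^esub> order R \<oplus>\<^bsub>P\<^esub> pol [\<ominus> \<one>, \<zero>]"
    unfolding allroots_def by (subst pol_Cons, auto simp del: length_append simp: pol_zeros_append)
      (use l in simp)
  then show ?thesis by (simp add: pol_Cons a_minus_def P.l_minus)
qed

lemma full_allroots: "full allroots"
proof -
  have "eval allroots x = \<zero>" if x: "x \<in> carrier R" for x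
  proof -
    interpret e: ring_hom_cring P R "\<lambda>p. eval p x" by (rule eval_P_hom[OF x])
    have "eval X x = x" by (rule eval_var[OF x])
    then have "eval (pol allroots) x = \<zero>"
      using x by (simp add: pol_allroots a_minus_def pow_order r_neg)
    then show ?thesis using x set_allroots by (simp add: eval_pol)
  qed
  then have "zeros allroots = carrier R" by (auto simp: zeros_def)
  moreover have "allroots \<in> carrier P" using set_allroots by (simp add: carrier_P_iff allroots_def)
  ultimately show ?thesis using order_ge_2 by (simp add: full_def allroots_def order_def)
qed

text \<open>The hypothesis is applied to the projection onto the quotient by the principal ideal of
  \<open>f\<close>, whose carrier explains the type of \<open>Q\<close>. It turns a statement about
  homomorphisms back into a congruence.\<close>

lemma pdivides_quotient:
  assumes "f \<in> carrier P" "a \<in> carrier P" "b \<in> carrier P"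
    and "\<And>(Q :: 'a list set ring) h. ring_hom_cring P Q h \<Longrightarrow> h f = \<zero>\<^bsub>Q\<^esub> \<Longrightarrow> h a = h b"
  shows "f pdivides (a \<ominus>\<^bsub>P\<^esub> b)"
proof -
  let ?I = "PIdl\<^bsub>P\<^esub> f"
  have zero: "\<zero>\<^bsub>P Quot ?I\<^esub> = ?I" unfolding FactRing_def ring.simps by (rule refl)
  interpret I: ideal ?I P by (rule P.cgenideal_ideal[OF assms(1)])
  have hom: "ring_hom_cring P (P Quot ?I) ((+>\<^bsub>P\<^esub>) ?I)"
    by (rule I.rcos_ring_hom_cring[OF P.is_cring])
  interpret h: ring_hom_cring P "P Quot ?I" "(+>\<^bsub>P\<^esub>) ?I" by (rule hom)
  have "?I +>\<^bsub>P\<^esub> f = \<zero>\<^bsub>P Quot ?I\<^esub>"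
    using P.cgenideal_self[OF assms(1)] I.a_rcos_const by (simp add: zero)
  note ab = assms(4)[OF hom this]
  have "?I +>\<^bsub>P\<^esub> (a \<ominus>\<^bsub>P\<^esub> b) = (?I +>\<^bsub>P\<^esub> b) \<oplus>\<^bsub>P Quot ?I\<^esub> \<ominus>\<^bsub>P Quot ?I\<^esub> (?I +>\<^bsub>P\<^esub> b)"
    unfolding a_minus_def using assms(2,3)
    by (simp only: h.hom_add h.hom_a_inv P.add.inv_closed ab)
  also have "\<dots> = ?I"
    using h.S.r_neg[OF h.hom_closed[OF assms(3)]] by (simp only: zero)
  finally have "?I +>\<^bsub>P\<^esub> (a \<ominus>\<^bsub>P\<^esub> b) = ?I" .
  then have "a \<ominus>\<^bsub>P\<^esub> b \<in> ?I"
    using I.a_rcos_self[OF P.minus_closed[OF assms(2,3)]] by (simp only:)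
  then obtain x where x: "x \<in> carrier P" "a \<ominus>\<^bsub>P\<^esub> b = x \<otimes>\<^bsub>P\<^esub> f" unfolding cgenideal_def by blast
  have "a \<ominus>\<^bsub>P\<^esub> b = f \<otimes>\<^bsub>P\<^esub> x" unfolding x(2) by (rule P.m_comm[OF x(1) assms(1)])
  with x(1) show ?thesis unfolding pdivides_def factor_def by blast
qed

end


section \<open>Counting the elements whose trace or quadratic character separates two given
  ones\<close>

section \<open>Separating two field elements\<close>

lemma bval_nbits: "bval (nbits n) = n"
proof (induction n rule: nbits.induct)
  case (1 k)
  then show ?case
    by (cases "k = 0") (simp_all add: nbits.simps[of k] nbits.simps[of 0])
qed

lemma bval_tl_nbits: "bval (tl (nbits n)) = n div 2"
  by (cases "n = 0") (simp_all add: nbits.simps[of n] nbits.simps[of 0] bval_nbits)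

lemma length_nbits_power: "length (nbits (2 ^ k)) = Suc k"
  by (induction k) (simp_all add: nbits.simps[of "2 * 2 ^ _"] nbits.simps[of "Suc 0"] nbits.simps[of 0])

context ff
begin

text \<open>Cauchy's theorem for the additive group: Sylow's theorem with exponent 1 gives a
  subgroup of order \<open>q\<close>, and \<open>q\<close> annihilates its elements.\<close>

lemma prime_dvd_order:
  assumes "Factorial_Ring.prime q" "q dvd order R"
  shows "\<exists>x\<in>carrier R. x \<noteq> \<zero> \<and> [q] \<cdot> x = \<zero>"
proof -
  let ?G = "add_monoid R"
  have o: "order ?G = order R" by (simp add: order_def)
  interpret G: group ?G by (rule add.is_group)
  obtain m where "order ?G = q ^ 1 * m" using assms(2) o by (auto elim: dvdE)
  then obtain H where H: "subgroup H ?G" "card H = q"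
    using sylow_thm[OF assms(1) add.is_group, of 1 m] fin by auto
  then have "card H \<ge> 2" using assms(1) prime_ge_2_nat by blast
  moreover have "finite H" using H(2) \<open>card H \<ge> 2\<close> card.infinite by fastforce
  ultimately have "\<not> H \<subseteq> {\<zero>}"
    using card_mono[of "{\<zero>}" H] by auto
  then obtain x where x: "x \<in> H" "x \<noteq> \<zero>" by blast
  have xR: "x \<in> carrier R" using x(1) subgroup.subset[OF H(1)] by auto
  interpret H: group "?G\<lparr>carrier := H\<rparr>"
    by (rule subgroup.subgroup_is_group[OF H(1) add.is_group])
  have "x [^]\<^bsub>?G\<lparr>carrier := H\<rparr>\<^esub> q = \<one>\<^bsub>?G\<lparr>carrier := H\<rparr>\<^esub>"
    using H.pow_order_eq_1[of x] x(1) H(2) \<open>finite H\<close> by (simp add: order_def)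
  then have "x [^]\<^bsub>?G\<^esub> q = \<zero>" by (simp add: nat_pow_def)
  then show ?thesis using xR x(2) by (auto simp: add_pow_def)
qed

lemma add_pow_even:
  assumes "\<one> \<oplus> \<one> = \<zero>" "x \<in> carrier R"
  shows "x \<oplus> x = \<zero>"
proof -
  have "x \<oplus> x = (\<one> \<oplus> \<one>) \<otimes> x" using assms(2) by (simp add: l_distr)
  then show ?thesis using assms by simp
qed

text \<open>An odd prime divisor p of the order would give a nonzero x with p x = 0, whereas 2 x = 0
  implies p x = x.\<close>

lemma char2_order:
  assumes "\<one> \<oplus> \<one> = \<zero>"
  obtains k where "order R = 2 ^ Suc k"
proof -
  have "p = 2" if p: "Factorial_Ring.prime p" "p dvd order R" for p
  proof (rule ccontr)
    assume "p \<noteq> 2"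
    then have "odd p" using p(1) primes_dvd_imp_eq two_is_prime_nat by blast
    then obtain j where j: "p = Suc (2 * j)" by (auto elim: oddE)
    obtain x where x: "x \<in> carrier R" "x \<noteq> \<zero>" "[p] \<cdot> x = \<zero>"
      using prime_dvd_order[OF p] by blast
    have "[(2 * j)] \<cdot> x = \<zero>"
    proof (induction j)
      case (Suc j)
      then show ?case using x(1) add_pow_even[OF assms x(1)]
        by (simp add: add.nat_pow_Suc a_assoc)
    qed simp
    then show False using x by (simp add: j add.nat_pow_Suc)
  qed
  moreover have "order R \<noteq> 0" using order_ge_2 by simp
  then obtain m where m: "order R = 2 ^ Factorial_Ring.multiplicity 2 (order R) * m" "\<not> 2 dvd m"
    using multiplicity_decompose'[of "order R" 2] by auto
  ultimately have "m = 1"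
    using prime_factor_nat[of m] by (metis dvd_mult)
  with m(1) order_ge_2 that show ?thesis
    by (cases "Factorial_Ring.multiplicity 2 (order R)") auto
qed

lemma not_char2_order:
  assumes "\<one> \<oplus> \<one> \<noteq> \<zero>"
  shows "odd (order R)"
proof
  assume "even (order R)"
  then obtain x where x: "x \<in> carrier R" "x \<noteq> \<zero>" "[(2::nat)] \<cdot> x = \<zero>"
    using prime_dvd_order[OF two_is_prime_nat] by blast
  then have "(\<one> \<oplus> \<one>) \<otimes> x = \<zero>" by (simp add: numeral_2_eq_2 add.nat_pow_Suc l_distr)
  with assms x(1,2) show False using integral by blast
qed

lemma card_zeros_le:
  assumes "set L \<subseteq> carrier R" "L \<noteq> []" "hd L \<noteq> \<zero>"
  shows "card {x \<in> carrier R. eval L x = \<zero>} < length L"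
  using card_zeros_less[of L] assms by (simp add: carrier_P_iff zeros_def)

text \<open>The sum of x^(2^i) for i < k, which is the absolute trace when the order is 2^k. The
  recursion squares the argument, as the program does.\<close>

primrec tr :: "nat \<Rightarrow> 'a \<Rightarrow> 'a" where
  "tr 0 x = \<zero>"
| "tr (Suc k) x = x \<oplus> tr k (x \<otimes> x)"

lemma tr_closed [simp]: "x \<in> carrier R \<Longrightarrow> tr k x \<in> carrier R"
  by (induction k arbitrary: x) auto

lemma square_pow: "x \<in> carrier R \<Longrightarrow> (x \<otimes> x) [^] (2 ^ k :: nat) = x [^] (2 ^ Suc k :: nat)"
proof -
  assume x: "x \<in> carrier R"
  have "x \<otimes> x = x [^] (2::nat)" using x by (simp add: numeral_2_eq_2)
  then show ?thesis using x by (simp add: nat_pow_pow)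
qed

lemma tr_Suc: "x \<in> carrier R \<Longrightarrow> tr (Suc k) x = tr k x \<oplus> x [^] (2 ^ k :: nat)"
proof (induction k arbitrary: x)
  case (Suc k)
  have "tr (Suc (Suc k)) x = x \<oplus> (tr k (x \<otimes> x) \<oplus> (x \<otimes> x) [^] (2 ^ k :: nat))"
    using Suc by simp
  then show ?case using Suc.prems square_pow[OF Suc.prems, of k] by (simp add: a_assoc)
qed simp

context
  assumes two: "\<one> \<oplus> \<one> = \<zero>"
begin

lemma square_add:
  assumes "x \<in> carrier R" "y \<in> carrier R"
  shows "(x \<oplus> y) \<otimes> (x \<oplus> y) = x \<otimes> x \<oplus> y \<otimes> y"
proof -
  have "(x \<oplus> y) \<otimes> (x \<oplus> y) = x \<otimes> x \<oplus> y \<otimes> y \<oplus> (x \<otimes> y \<oplus> x \<otimes> y)"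
    using assms by (simp add: l_distr r_distr a_ac m_comm)
  then show ?thesis using add_pow_even[OF two, of "x \<otimes> y"] assms by simp
qed

lemma tr_add: "x \<in> carrier R \<Longrightarrow> y \<in> carrier R \<Longrightarrow> tr k (x \<oplus> y) = tr k x \<oplus> tr k y"
  by (induction k arbitrary: x y) (simp_all add: square_add a_ac)

lemma tr_square: "x \<in> carrier R \<Longrightarrow> tr k x \<otimes> tr k x = tr k (x \<otimes> x)"
  by (induction k arbitrary: x) (simp_all add: square_add)

lemma tr_01:
  assumes "order R = 2 ^ k" "x \<in> carrier R"
  shows "tr k x = \<zero> \<or> tr k x = \<one>"
proof -
  \<comment> \<open>Both sides are \<open>tr (Suc k) x\<close>, expanded at the front and at the
    back, with x^(2^k) = x. Thus the trace equals its own square.\<close>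
  have "x \<oplus> tr k (x \<otimes> x) = tr k x \<oplus> x"
    using tr_Suc[OF assms(2), of k] pow_order[OF assms(2)] assms(1) by simp
  then have "tr k x \<otimes> tr k x = tr k x"
    using assms(2) by (simp add: tr_square a_comm[of x])
  then have "tr k x \<otimes> (tr k x \<ominus> \<one>) = \<zero>"
    using assms(2) by (simp add: a_minus_def r_distr r_minus r_neg)
  then show ?thesis using assms(2) integral[of "tr k x" "tr k x \<ominus> \<one>"] by (auto simp: r_right_minus_eq)
qed

lemma tr_zeros:
  shows "card {x \<in> carrier R. tr (Suc k) x = \<zero>} \<le> 2 ^ k"
proof -
  \<comment> \<open>The coefficient list of z^(2^k) + ... + z^2 + z, whose degree 2^k bounds the
    number of zeros of \<open>tr (Suc k)\<close>.\<close>
  define L where "L = rec_nat [\<one>, \<zero>] (\<lambda>k L. \<one> # replicate (2 ^ k - 1) \<zero> @ L)"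
  have L0: "L 0 = [\<one>, \<zero>]" and LS: "L (Suc k) = \<one> # replicate (2 ^ k - 1) \<zero> @ L k" for k
    by (simp_all add: L_def)
  have len: "length (L k) = Suc (2 ^ k)" for k
    by (induction k) (simp_all add: L0 LS)
  have set: "set (L k) \<subseteq> carrier R" for k
    by (induction k) (auto simp: L0 LS)
  have rep: "eval (replicate j \<zero> @ M) x = eval M x" if "set M \<subseteq> carrier R" "x \<in> carrier R" for j M x
    using that by (induction j) (simp_all add: eval_in_carrier)
  have ev: "eval (L k) x = tr (Suc k) x" if x: "x \<in> carrier R" for k x
  proof (induction k)
    case 0
    then show ?case using x by (simp add: L0)
  next
    case (Suc k)
    have "2 ^ k - Suc 0 + Suc (2 ^ k) = 2 ^ Suc k" by (simp add: Suc_leI mult_2)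
    then have "eval (L (Suc k)) x = x [^] (2 ^ Suc k :: nat) \<oplus> eval (L k) x"
      using x set rep by (simp add: LS len del: power_Suc)
    also have "\<dots> = tr (Suc k) x \<oplus> x [^] (2 ^ Suc k :: nat)"
      using x Suc by (simp add: a_comm del: tr.simps power_Suc)
    also have "\<dots> = tr (Suc (Suc k)) x" by (simp only: tr_Suc[OF x])
    finally show ?case .
  qed
  have "card {x \<in> carrier R. eval (L k) x = \<zero>} < length (L k)"
    by (rule card_zeros_le[OF set]) (cases k; simp add: L0 LS)+
  also have "{x \<in> carrier R. eval (L k) x = \<zero>} = {x \<in> carrier R. tr (Suc k) x = \<zero>}"
    using ev by auto
  finally show ?thesis by (simp add: len)
qed

text \<open>For a = x / (u - v) the traces of a u and a v differ by the trace of x, and at most half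
  of all x have trace zero.\<close>

lemma card_trace_separating:
  assumes k: "order R = 2 ^ k" and uv: "u \<in> carrier R" "v \<in> carrier R" "u \<noteq> v"
  shows "order R \<le> 2 * card {a \<in> carrier R. (tr k (a \<otimes> u) = \<zero>) \<noteq> (tr k (a \<otimes> v) = \<zero>)}"
proof -
  obtain j where j: "k = Suc j" using k order_ge_2 by (cases k) auto
  let ?S = "{a \<in> carrier R. (tr k (a \<otimes> u) = \<zero>) \<noteq> (tr k (a \<otimes> v) = \<zero>)}"
    and ?T = "{x \<in> carrier R. tr k x \<noteq> \<zero>}"
  define w where "w = u \<ominus> v"
  have w: "w \<in> carrier R" "w \<noteq> \<zero>" using uv by (simp_all add: w_def r_right_minus_eq)
  then have iw: "inv w \<in> carrier R" "inv w \<otimes> w = \<one>" "inv w \<noteq> \<zero>"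
    using field_Units by (auto intro!: Units_l_inv)
  have "(\<lambda>x. x \<otimes> inv w) ` ?T \<subseteq> ?S"
  proof safe
    fix x assume x: "x \<in> carrier R" "tr k x \<noteq> \<zero>"
    let ?a = "x \<otimes> inv w"
    show a: "?a \<in> carrier R" using x iw by simp
    have "?a \<otimes> u = ?a \<otimes> w \<oplus> ?a \<otimes> v"
      using a uv by (simp add: w_def flip: r_distr) (simp add: a_minus_def a_assoc l_neg)
    also have "?a \<otimes> w = x" using x w iw by (simp add: m_assoc)
    finally have "tr k (?a \<otimes> u) = tr k x \<oplus> tr k (?a \<otimes> v)"
      using a x uv by (simp add: tr_add)
    moreover have "tr k x = \<one>" using tr_01[OF k x(1)] x(2) by simp
    moreover have "tr k (?a \<otimes> v) = \<zero> \<or> tr k (?a \<otimes> v) = \<one>"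
      using tr_01[OF k, of "?a \<otimes> v"] a uv by simp
    ultimately have "(tr k (?a \<otimes> u) = \<zero>) \<noteq> (tr k (?a \<otimes> v) = \<zero>)"
      using two by auto
    then show "tr k (?a \<otimes> u) = \<zero> \<Longrightarrow> tr k (?a \<otimes> v) = \<zero> \<Longrightarrow> False"
      and "tr k (?a \<otimes> u) \<noteq> \<zero> \<Longrightarrow> tr k (?a \<otimes> v) \<noteq> \<zero> \<Longrightarrow> False" by auto
  qed
  moreover have "inj_on (\<lambda>x. x \<otimes> inv w) ?T"
    using m_rcancel[OF iw(3,1)] by (auto intro!: inj_onI)
  ultimately have "card ?T \<le> card ?S" using fin by (intro card_inj_on_le) auto
  moreover have "card ?T + card {x \<in> carrier R. tr k x = \<zero>} = order R"
    unfolding order_def using fin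
    by (subst card_Un_disjoint[symmetric]) (auto intro!: arg_cong[where f = card])
  ultimately show ?thesis using tr_zeros[of j] k unfolding j by simp
qed

end

context
  assumes two: "\<one> \<oplus> \<one> \<noteq> \<zero>"
begin

lemma chi_values:
  assumes "x \<in> carrier R" "x \<noteq> \<zero>"
  shows "x [^] (order R div 2) = \<one> \<or> x [^] (order R div 2) = \<ominus> \<one>"
proof -
  let ?y = "x [^] (order R div 2)"
  have "order R = Suc (2 * (order R div 2))" using not_char2_order[OF two] by presburger
  then have "x [^] (2 * (order R div 2)) \<otimes> x = \<one> \<otimes> x"
    using pow_order[OF assms(1)] assms(1) by (metis nat_pow_Suc l_one)
  then have "x [^] (2 * (order R div 2)) = \<one>"
    using m_rcancel[OF assms(2,1), of "x [^] (2 * (order R div 2))" \<one>] assms(1) by simp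
  then have "?y \<otimes> ?y = \<one>" using assms(1) by (simp add: nat_pow_mult mult_2)
  then show ?thesis using square_eq_one assms(1) by simp
qed

lemma minus_one_neq_one: "\<ominus> \<one> \<noteq> \<one>"
  using two r_neg[OF one_closed] by force

text \<open>With m = n div 2, the polynomial z^m - 1 has at most m zeros, and each of the 2 m
  nonzero elements is such a zero or a nonresidue.\<close>

lemma card_nonresidues:
  "order R div 2 \<le> card {x \<in> carrier R. x \<noteq> \<zero> \<and> x [^] (order R div 2) = \<ominus> \<one>}" (is "_ \<le> card ?N")
proof -
  let ?m = "order R div 2"
  let ?S = "{x \<in> carrier R. x [^] ?m = \<one>}"
  have m: "?m > 0" using order_ge_2 by simp
  define L where "L = \<one> # replicate (?m - 1) \<zero> @ [\<ominus> \<one>]"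
  have len: "length L = Suc ?m" using m by (simp add: L_def)
  have ev: "eval L x = x [^] ?m \<ominus> \<one>" if "x \<in> carrier R" for x
  proof -
    have "eval (replicate j \<zero> @ [\<ominus> \<one>]) x = \<ominus> \<one>" for j
      using that by (induction j) simp_all
    then show ?thesis using that m by (simp add: L_def a_minus_def)
  qed
  have "card {x \<in> carrier R. eval L x = \<zero>} < length L"
    by (rule card_zeros_le) (auto simp: L_def)
  also have "{x \<in> carrier R. eval L x = \<zero>} = ?S"
    using ev by (auto simp: r_right_minus_eq)
  finally have S: "card ?S \<le> ?m" using len by simp
  have "carrier R \<subseteq> insert \<zero> (?S \<union> ?N)" using chi_values by auto
  then have "card (carrier R) \<le> card (insert \<zero> (?S \<union> ?N))" using fin by (intro card_mono) auto
  then have "order R \<le> Suc (card (?S \<union> ?N))"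
    using fin by (simp add: order_def card_insert_if split: if_splits)
  also have "\<dots> \<le> Suc (card ?S + card ?N)" using card_Un_le by auto
  finally have "order R \<le> Suc (?m + card ?N)" using S by simp
  moreover have "order R = Suc (2 * ?m)" using not_char2_order[OF two] by presburger
  ultimately show ?thesis by simp
qed

text \<open>For each nonresidue rho there is a shift a with u + a = rho (v + a). There the two
  characters are nonzero and differ by the factor -1, and distinct nonresidues give distinct
  shifts.\<close>

lemma card_chi_separating:
  assumes uv: "u \<in> carrier R" "v \<in> carrier R" "u \<noteq> v"
  shows "order R div 2 \<le> card {a \<in> carrier R.
     ((u \<oplus> a) [^] (order R div 2) = \<one>) \<noteq> ((v \<oplus> a) [^] (order R div 2) = \<one>)}" (is "_ \<le> card ?S")
proof -
  let ?m = "order R div 2"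
  let ?N = "{x \<in> carrier R. x \<noteq> \<zero> \<and> x [^] ?m = \<ominus> \<one>}"
  define w where "w = u \<ominus> v"
  have w: "w \<in> carrier R" "w \<noteq> \<zero>" and uw: "u = v \<oplus> w"
    using uv by (simp_all add: w_def r_right_minus_eq) (simp add: a_minus_def a_lcomm r_neg)
  \<comment> \<open>The solution y = v + a of the equation y + w = rho y.\<close>
  define b where "b = (\<lambda>\<rho>. w \<otimes> inv (\<rho> \<ominus> \<one>))"
  have N: "b \<rho> \<in> carrier R" "b \<rho> \<noteq> \<zero>" "b \<rho> \<otimes> (\<rho> \<ominus> \<one>) = w" if "\<rho> \<in> ?N" for \<rho>
  proof -
    have "\<rho> \<noteq> \<one>" using that minus_one_neq_one by auto
    then have "\<rho> \<ominus> \<one> \<in> Units R" using that field_Units by (auto simp: r_right_minus_eq)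
    then show "b \<rho> \<in> carrier R" "b \<rho> \<otimes> (\<rho> \<ominus> \<one>) = w"
      using w(1) that by (simp_all add: b_def m_assoc Units_l_inv)
    then show "b \<rho> \<noteq> \<zero>" using w(2) that by auto
  qed
  have "(\<lambda>\<rho>. b \<rho> \<ominus> v) ` ?N \<subseteq> ?S"
  proof
    fix a assume "a \<in> (\<lambda>\<rho>. b \<rho> \<ominus> v) ` ?N"
    then obtain \<rho> where \<rho>: "\<rho> \<in> ?N" "a = b \<rho> \<ominus> v" by blast
    note n = N[OF \<rho>(1)]
    have \<rho>': "\<rho> \<in> carrier R" "\<rho> [^] ?m = \<ominus> \<one>" using \<rho>(1) by auto
    have va: "v \<oplus> a = b \<rho>"
      using \<rho>(2) n(1) uv(2) a_lcomm[of v "b \<rho>" "\<ominus> v"] by (simp add: a_minus_def r_neg)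
    have "u \<oplus> a = b \<rho> \<oplus> b \<rho> \<otimes> (\<rho> \<ominus> \<one>)"
    proof -
      have "a \<in> carrier R" using \<rho>(2) n(1) uv(2) by simp
      then have "u \<oplus> a = w \<oplus> (v \<oplus> a)" using uw uv(2) w(1) by (simp add: a_ac)
      also have "\<dots> = b \<rho> \<oplus> w" unfolding va by (rule a_comm[OF w(1) n(1)])
      finally show ?thesis using n(3) by simp
    qed
    also have "\<dots> = b \<rho> \<otimes> \<rho>"
      using n(1) \<rho>' a_lcomm[of "b \<rho>" "b \<rho> \<otimes> \<rho>" "\<ominus> b \<rho>"]
      by (simp add: a_minus_def r_distr r_minus r_neg)
    finally have "(u \<oplus> a) [^] ?m = (v \<oplus> a) [^] ?m \<otimes> \<ominus> \<one>"
      using n(1) \<rho>' va by (simp add: nat_pow_distrib)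
    moreover have "a \<in> carrier R" using \<rho>(2) n(1) uv(2) by simp
    moreover have "(v \<oplus> a) [^] ?m = \<one> \<or> (v \<oplus> a) [^] ?m = \<ominus> \<one>"
      using chi_values[OF n(1,2)] va by simp
    ultimately show "a \<in> ?S" using minus_one_neq_one by (auto simp: l_minus)
  qed
  moreover have "inj_on (\<lambda>\<rho>. b \<rho> \<ominus> v) ?N"
  proof (rule inj_onI)
    fix \<rho> \<tau> assume r: "\<rho> \<in> ?N" "\<tau> \<in> ?N" and "b \<rho> \<ominus> v = b \<tau> \<ominus> v"
    then have bb: "b \<rho> = b \<tau>" using N(1)[OF r(1)] N(1)[OF r(2)] uv(2) by (simp add: a_minus_def)
    then have "b \<rho> \<otimes> (\<rho> \<ominus> \<one>) = b \<rho> \<otimes> (\<tau> \<ominus> \<one>)" using N(3)[OF r(1)] N(3)[OF r(2)] by simp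
    then have "\<rho> \<ominus> \<one> = \<tau> \<ominus> \<one>"
      using m_lcancel[OF N(2)[OF r(1)] N(1)[OF r(1)]] r by simp
    then show "\<rho> = \<tau>" using r by (simp add: a_minus_def)
  qed
  ultimately have "card ?N \<le> card ?S" using fin by (intro card_inj_on_le) auto
  then show ?thesis using card_nonresidues by (rule order_trans[rotated])
qed

end

end


section \<open>Root finding: correctness of a splitting round and its probability of
  progress\<close>

section \<open>Root finding\<close>

context ff
begin

interpretation P: domain P
  by (rule univ_poly_is_domain[OF sr])

abbreviation bits :: "bool list" where "bits \<equiv> nbits (order R)"

lemma zerosD: "r \<in> zeros g \<Longrightarrow> r \<in> carrier R" "r \<in> zeros g \<Longrightarrow> eval g r = \<zero>"
  by (simp_all add: zeros_def)

lemma eval_vec_closed: "vec d p \<Longrightarrow> r \<in> carrier R \<Longrightarrow> eval p r \<in> carrier R"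
  by (rule eval_in_carrier[OF vecD(1)])

lemma eval_axpy_vec:
  assumes "c \<in> carrier R" "vec d p" "vec d q" "r \<in> carrier R"
  shows "eval (axpy R c p q) r = eval q r \<oplus> \<ominus> (c \<otimes> eval p r)"
proof -
  interpret e: ring_hom_cring P R "\<lambda>p. eval p r" by (rule eval_P_hom[OF assms(4)])
  note s = vecD(1)[OF assms(2)] vecD(1)[OF assms(3)]
  have "eval (K c) r = c" using assms(1,4) by (simp add: poly_of_const_def)
  moreover have "eval (pol (axpy R c p q)) r = eval (pol q) r \<oplus> \<ominus> (eval (K c) r \<otimes> eval (pol p) r)"
    unfolding pol_axpy_vec[OF assms(1-3)] a_minus_def using s assms(1) by simp
  ultimately show ?thesis using s assms(4) axpy_closed[OF assms(1) s] by (simp add: eval_pol)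
qed

lemma eval_onev: "modulus d g \<Longrightarrow> r \<in> carrier R \<Longrightarrow> eval (onev R g) r = \<one>"
proof -
  assume g: "modulus d g" and r: "r \<in> carrier R"
  have "eval (pol (onev R g)) r = \<one>" using r by (simp add: pol_onev univ_poly_one)
  then show ?thesis using r vecD(1)[OF vec_onev[OF g]] by (simp add: eval_pol)
qed

context
  fixes d :: nat and g :: "'a list" and r :: 'a
  assumes g: "modulus d g" and r: "r \<in> zeros g"
begin

lemma eval_mulmod:
  assumes "vec d q" "set p \<subseteq> carrier R"
  shows "eval (mulmod R g p q) r = eval p r \<otimes> eval q r"
  using h_mulmod[OF eval_P_hom g _ assms, of r] zerosD[OF r] assms
    vecD(1)[OF vec_mulmod[OF g assms]] vecD(1)[OF assms(1)] by (simp add: eval_pol)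

lemma eval_powmod:
  assumes "vec d acc" "vec d y"
  shows "eval (powmod R g bs acc y) r = eval acc r \<otimes> eval y r [^] bval bs"
  using h_powmod[OF eval_P_hom g _ assms, of r bs] zerosD[OF r] vecD(1)[OF assms(1)] vecD(1)[OF assms(2)]
    vecD(1)[of d "powmod R g bs acc y"] by (simp add: eval_pol)

lemma eval_tracemod:
  assumes "vec d acc" "vec d y"
  shows "vec d (tracemod R g bs acc y) \<and>
    eval (tracemod R g bs acc y) r = eval acc r \<oplus> tr (length bs) (eval y r)"
  using assms unfolding tracemod_def
proof (induction bs arbitrary: acc y)
  case Nil
  then show ?case using eval_vec_closed zerosD[OF r] by simp
next
  case (Cons b bs)
  have r': "r \<in> carrier R" using zerosD[OF r] by simp
  have m: "\<ominus> \<one> \<in> carrier R" by simp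
  have v: "vec d (axpy R (\<ominus> \<one>) y acc)" "vec d (mulmod R g y y)"
    using vec_axpy[OF m] vec_mulmod[OF g] vecD(1) Cons.prems by blast+
  show ?case
    using Cons.IH[OF v] eval_axpy_vec[OF m Cons.prems(2,1) r'] eval_mulmod[OF Cons.prems(2) vecD(1)[OF Cons.prems(2)]]
      eval_vec_closed[OF Cons.prems(1) r'] eval_vec_closed[OF Cons.prems(2) r']
    by (simp add: l_minus a_assoc)
qed

end

lemma vec_powmod: "modulus d g \<Longrightarrow> vec d acc \<Longrightarrow> vec d y \<Longrightarrow> vec d (powmod R g bs acc y)"
  unfolding powmod_def
  by (induction bs arbitrary: acc y) (simp_all add: vec_mulmod vecD(1))

lemma vec_tracemod: "modulus d g \<Longrightarrow> vec d acc \<Longrightarrow> vec d y \<Longrightarrow> vec d (tracemod R g bs acc y)"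
  unfolding tracemod_def
  by (induction bs arbitrary: acc y) (simp_all add: vec_mulmod vec_axpy vecD(1))

text \<open>Decides which of the two factors produced by \<open>sep\<close> inherits the root
  \<open>r\<close>.\<close>

definition side :: "'a \<Rightarrow> 'a \<Rightarrow> bool" where
  "side a r \<longleftrightarrow> (if \<one> \<oplus> \<one> = \<zero> then tr (length (tl bits)) (a \<otimes> r) = \<zero>
     else (r \<oplus> a) [^] (order R div 2) = \<one>)"

lemma char2_bits:
  assumes "\<one> \<oplus> \<one> = \<zero>"
  shows "order R = 2 ^ length (tl bits)"
  using char2_order[OF assms] by (metis length_nbits_power length_tl diff_Suc_1)

lemma sep_props:
  assumes g: "modulus d g" and a: "a \<in> carrier R"
  shows "vec d (fst (sep R bits a g)) \<and> vec d (snd (sep R bits a g)) \<and>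
    (\<forall>r\<in>zeros g. (eval (fst (sep R bits a g)) r = \<zero> \<longleftrightarrow> side a r) \<and>
       (eval (snd (sep R bits a g)) r = \<zero> \<longleftrightarrow> \<not> side a r))"
proof (cases "\<one> \<oplus> \<one> = \<zero>")
  case True
  let ?u = "onev R g"
  define y where "y = mulmod R g [a, \<zero>] ?u"
  define z where "z = axpy R \<one> ?u ?u"
  define e where "e = tracemod R g (tl bits) z y"
  have u: "vec d ?u" by (rule vec_onev[OF g])
  have y: "vec d y" and z: "vec d z" using vec_mulmod[OF g u] vec_axpy[OF one_closed u u] a by (simp_all add: y_def z_def)
  have e: "vec d e" using vec_tracemod[OF g z y] by (simp add: e_def)
  have s: "sep R bits a g = (e, axpy R \<one> ?u e)"
    using True by (simp add: sep_def Let_def e_def y_def z_def)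
  have "(eval e r = \<zero> \<longleftrightarrow> side a r) \<and> (eval (axpy R \<one> ?u e) r = \<zero> \<longleftrightarrow> \<not> side a r)" if r: "r \<in> zeros g" for r
  proof -
    have r': "r \<in> carrier R" using zerosD[OF r] by simp
    have yr: "eval y r = a \<otimes> r"
      using eval_mulmod[OF g r u, of "[a, \<zero>]"] a r' by (simp add: y_def eval_onev[OF g r'])
    have zr: "eval z r = \<zero>"
      using eval_axpy_vec[OF one_closed u u r'] r' by (simp add: z_def eval_onev[OF g r'] r_neg)
    have er: "eval e r = tr (length (tl bits)) (a \<otimes> r)"
      using eval_tracemod[OF g r z y] a r' by (simp add: e_def zr yr)
    have "eval (axpy R \<one> ?u e) r = eval e r \<oplus> \<ominus> \<one>"
      using eval_axpy_vec[OF one_closed u e r'] by (simp add: eval_onev[OF g r'])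
    then have "eval (axpy R \<one> ?u e) r = \<zero> \<longleftrightarrow> eval e r = \<one>"
      using r_right_minus_eq[of "eval e r" \<one>] eval_vec_closed[OF e r'] by (simp add: a_minus_def)
    moreover have "eval e r = \<zero> \<or> eval e r = \<one>"
      unfolding er using tr_01[OF True char2_bits[OF True], of "a \<otimes> r"] a r' by simp
    moreover have "side a r \<longleftrightarrow> eval e r = \<zero>" using True by (simp add: side_def er)
    ultimately show ?thesis by auto
  qed
  then show ?thesis using e vec_axpy[OF one_closed u e] by (simp add: s)
next
  case False
  let ?u = "onev R g" and ?m = "order R div 2"
  define y where "y = mulmod R g [\<one>, a] ?u"
  define e where "e = powmod R g (tl bits) ?u y"
  have u: "vec d ?u" by (rule vec_onev[OF g])
  have y: "vec d y" using vec_mulmod[OF g u] a by (simp add: y_def)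
  have e: "vec d e" using vec_powmod[OF g u y] by (simp add: e_def)
  have ee: "vec d (mulmod R g e e)" using vec_mulmod[OF g e vecD(1)[OF e]] .
  have m: "\<ominus> \<one> \<in> carrier R" by simp
  have s: "sep R bits a g = (axpy R \<one> ?u e, axpy R (\<ominus> \<one>) e (mulmod R g e e))"
    using False by (simp add: sep_def Let_def e_def y_def)
  have "(eval (axpy R \<one> ?u e) r = \<zero> \<longleftrightarrow> side a r) \<and>
      (eval (axpy R (\<ominus> \<one>) e (mulmod R g e e)) r = \<zero> \<longleftrightarrow> \<not> side a r)" if r: "r \<in> zeros g" for r
  proof -
    have r': "r \<in> carrier R" using zerosD[OF r] by simp
    have yr: "eval y r = r \<oplus> a"
      using eval_mulmod[OF g r u, of "[\<one>, a]"] a r' by (simp add: y_def eval_onev[OF g r'])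
    have er: "eval e r = (r \<oplus> a) [^] ?m"
      using eval_powmod[OF g r u y, of "tl bits"] a r' by (simp add: e_def yr eval_onev[OF g r'] bval_tl_nbits)
    have ec: "eval e r \<in> carrier R" by (rule eval_vec_closed[OF e r'])
    have "eval (axpy R \<one> ?u e) r = eval e r \<oplus> \<ominus> \<one>"
      using eval_axpy_vec[OF one_closed u e r'] by (simp add: eval_onev[OF g r'])
    then have 1: "eval (axpy R \<one> ?u e) r = \<zero> \<longleftrightarrow> eval e r = \<one>"
      using r_right_minus_eq[of "eval e r" \<one>] ec by (simp add: a_minus_def)
    have 2: "eval (axpy R (\<ominus> \<one>) e (mulmod R g e e)) r = eval e r \<otimes> eval e r \<oplus> eval e r"
      using eval_axpy_vec[OF m e ee r'] eval_mulmod[OF g r e vecD(1)[OF e]] ec by (simp add: l_minus)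
    have m0: "?m \<noteq> 0" using order_ge_2 by simp
    have v: "eval e r = \<zero> \<or> eval e r = \<one> \<or> eval e r = \<ominus> \<one>"
      unfolding er using chi_values[OF False, of "r \<oplus> a"] a r' nat_pow_zero[OF m0] by (cases "r \<oplus> a = \<zero>") auto
    \<comment> \<open>The value 0, taken at r = -a, falls on the side of -1; at 1 the expression is
      1 + 1, nonzero in odd characteristic.\<close>
    have "eval e r \<otimes> eval e r \<oplus> eval e r = \<zero> \<longleftrightarrow> eval e r \<noteq> \<one>"
      using v False by (auto simp: l_minus r_neg)
    then show ?thesis using 1 2 False by (simp add: side_def er)
  qed
  then show ?thesis using vec_axpy[OF one_closed u e] vec_axpy[OF m e ee] by (simp add: s)
qed

text \<open>In odd characteristic n >= 3, so three times (n - 1)/2 is at least n. This is the origin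
  of the constant 1/3.\<close>

lemma card_side_separating:
  assumes "u \<in> carrier R" "v \<in> carrier R" "u \<noteq> v"
  shows "order R \<le> 3 * card {a \<in> carrier R. side a u \<noteq> side a v}"
proof (cases "\<one> \<oplus> \<one> = \<zero>")
  case True
  then show ?thesis
    using card_trace_separating[OF True char2_bits[OF True] assms] by (simp add: side_def)
next
  case False
  moreover have "order R = Suc (2 * (order R div 2))" using not_char2_order[OF False] by presburger
  moreover have "order R div 2 \<ge> 1" using order_ge_2 by simp
  ultimately show ?thesis
    using card_chi_separating[OF False assms] by (simp add: side_def)
qed

text \<open>The degrees and the roots found add up to the size of \<open>W\<close>, so there is no
  room for repetitions; at the end this makes the output list distinct.\<close>

definition rinv :: "nat \<Rightarrow> 'a set \<Rightarrow> 'a rstate \<Rightarrow> bool" where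
  "rinv N W st \<longleftrightarrow> (\<forall>g\<in>set (fst st). full g \<and> 2 \<le> length g \<and> length g \<le> N) \<and>
     W = set (snd st) \<union> (\<Union>g\<in>set (fst st). zeros g) \<and>
     card W = length (snd st) + (\<Sum>g\<leftarrow>fst st. length g - 1)"

text \<open>A factor of degree e counts 2 e - 1: splitting it into two nonconstant factors lowers
  the total by one, and removing a linear factor does so as well.\<close>

definition rpot :: "'a rstate \<Rightarrow> nat" where
  "rpot st = (\<Sum>g\<leftarrow>fst st. 2 * length g - 3)"

lemma full_modulus: "full g \<Longrightarrow> 2 \<le> length g \<Longrightarrow> modulus (length g - 1) g"
  by (auto simp: full_def modulus_def)

lemma gcdl_full:
  assumes "full g" "vec (length g - 1) e" "length g \<le> N" "5 \<le> N"
  shows "full (gcdl R N g e)" "zeros (gcdl R N g e) = {r \<in> zeros g. eval e r = \<zero>}"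
proof -
  have g: "g \<in> carrier P" "g \<noteq> []" using assms(1) by (auto simp: full_def)
  have "length e \<le> N" using vecD(2)[OF assms(2)] assms(3) by simp
  note G = gcdl_props[OF g vecD(1)[OF assms(2)] assms(3) this assms(4)]
  show "full (gcdl R N g e)" by (rule full_divisor[OF assms(1) G(1,3)])
  show "zeros (gcdl R N g e) = {r \<in> zeros g. eval e r = \<zero>}"
    unfolding G(5) by (auto simp: zeros_def)
qed

lemma rstep_split:
  assumes inv: "rinv N W (g # gs, out)" and g3: "3 \<le> length g" and a: "a \<in> carrier R" and N: "5 \<le> N"
  shows "rinv N W (rstep R N bits a (g # gs, out))"
    and "rpot (rstep R N bits a (g # gs, out)) \<le> rpot (g # gs, out)"
    and "u \<in> zeros g \<Longrightarrow> v \<in> zeros g \<Longrightarrow> side a u \<noteq> side a v \<Longrightarrow>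
      rpot (rstep R N bits a (g # gs, out)) < rpot (g # gs, out)"
proof -
  have g: "full g" "length g \<le> N" using inv by (auto simp: rinv_def)
  have m: "modulus (length g - 1) g" using full_modulus[OF g(1)] g3 by simp
  note s = sep_props[OF m a]
  define g1 where "g1 = gcdl R N g (fst (sep R bits a g))"
  define g2 where "g2 = gcdl R N g (snd (sep R bits a g))"
  have f: "full g1" "full g2" and z: "zeros g1 = {r \<in> zeros g. side a r}" "zeros g2 = {r \<in> zeros g. \<not> side a r}"
    using gcdl_full[OF g(1) _ g(2) N] s unfolding g1_def g2_def by auto
  have l: "length g = Suc (card (zeros g))" "length g1 = Suc (card (zeros g1))" "length g2 = Suc (card (zeros g2))"
    using g(1) f by (simp_all add: full_def)
  have "zeros g = zeros g1 \<union> zeros g2" "zeros g1 \<inter> zeros g2 = {}" using z by auto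
  then have c: "card (zeros g) = card (zeros g1) + card (zeros g2)" by (simp add: card_Un_disjoint)
  have "tl (tl g) \<noteq> []" using g3 by (cases g; cases "tl g"; cases "tl (tl g)") auto
  then have eq: "rstep R N bits a (g # gs, out) = (push g1 (push g2 gs), out)"
    by (simp add: g1_def g2_def)
  \<comment> \<open>Dropping a constant changes none of the sums, because the truncated differences
    1 - 1 and 2 - 3 are both 0.\<close>
  have p: "(\<Union>x\<in>set (push h hs). zeros x) = zeros h \<union> (\<Union>x\<in>set hs. zeros x) \<and>
     (\<Sum>x\<leftarrow>push h hs. length x - 1) = (length h - 1) + (\<Sum>x\<leftarrow>hs. length x - 1) \<and>
     (\<Sum>x\<leftarrow>push h hs. 2 * length x - 3) = (2 * length h - 3) + (\<Sum>x\<leftarrow>hs. 2 * length x - 3) \<and>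
     (\<forall>x\<in>set (push h hs). Q x) = ((length h \<ge> 2 \<longrightarrow> Q h) \<and> (\<forall>x\<in>set hs. Q x))" if "full h" for h hs Q
  proof (cases "tl h = []")
    case True
    then have "length h = 1" using that by (cases h) (auto simp: full_def)
    then show ?thesis using that True by (simp add: push_def full_def)
  next
    case False
    then have "length h \<ge> 2" by (cases h; cases "tl h") auto
    then show ?thesis using False by (simp add: push_def)
  qed
  have le: "length g1 \<le> N" "length g2 \<le> N" using l c g(2) by simp_all
  show "rinv N W (rstep R N bits a (g # gs, out))"
    using inv f le l c z unfolding eq rinv_def fst_conv snd_conv
    by (simp add: p[OF f(1)] p[OF f(2)] del: One_nat_def) auto
  have pot: "rpot (rstep R N bits a (g # gs, out)) =
      (2 * length g1 - 3) + (2 * length g2 - 3) + (\<Sum>x\<leftarrow>gs. 2 * length x - 3)"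
    unfolding eq rpot_def fst_conv by (simp add: p[OF f(1)] p[OF f(2)])
  then show "rpot (rstep R N bits a (g # gs, out)) \<le> rpot (g # gs, out)"
    using l c g3 by (simp add: rpot_def)
  assume "u \<in> zeros g" "v \<in> zeros g" "side a u \<noteq> side a v"
  then have "zeros g1 \<noteq> {}" "zeros g2 \<noteq> {}" using z by auto
  then have "card (zeros g1) > 0" "card (zeros g2) > 0" by (simp_all add: card_gt_0_iff)
  then show "rpot (rstep R N bits a (g # gs, out)) < rpot (g # gs, out)"
    using pot l c by (simp add: rpot_def)
qed

lemma rstep_linear:
  assumes inv: "rinv N W (g # gs, out)" and g2: "length g = 2"
  shows "rinv N W (rstep R N bits a (g # gs, out))"
    and "rpot (rstep R N bits a (g # gs, out)) < rpot (g # gs, out)"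
proof -
  obtain x y where g: "g = [x, y]" using g2 by (auto simp: numeral_2_eq_2 length_Suc_conv)
  have full: "full g" using inv by (simp add: rinv_def)
  then have xy: "x \<in> carrier R" "y \<in> carrier R" "x \<noteq> \<zero>" by (auto simp: full_def carrier_P_iff g)
  define r where "r = \<ominus> y \<otimes> finv R x"
  have r: "r \<in> carrier R" using xy by (simp add: r_def)
  have "x \<otimes> r = \<ominus> y"
    using xy finv_mult[OF xy(1,3)] by (simp add: r_def m_comm[of x] m_assoc)
  then have "r \<in> zeros g" using r xy by (simp add: zeros_def g l_neg)
  moreover have "card (zeros g) = 1" using full by (simp add: full_def g)
  ultimately have z: "zeros g = {r}" by (auto simp: card_1_singleton_iff)
  have eq: "rstep R N bits a (g # gs, out) = (gs, r # out)" by (simp add: g r_def)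
  show "rinv N W (rstep R N bits a (g # gs, out))"
    using inv z g2 unfolding eq rinv_def by auto
  show "rpot (rstep R N bits a (g # gs, out)) < rpot (g # gs, out)"
    using g2 unfolding eq rpot_def by simp
qed

lemma rstep_inv:
  assumes "rinv N W (g # gs, out)" "a \<in> carrier R" "5 \<le> N"
  shows "rinv N W (rstep R N bits a (g # gs, out)) \<and>
    rpot (rstep R N bits a (g # gs, out)) \<le> rpot (g # gs, out)"
proof (cases "length g = 2")
  case True
  then show ?thesis using rstep_linear[OF assms(1) True, of a] by simp
next
  case False
  then have "3 \<le> length g" using assms(1) by (auto simp: rinv_def)
  then show ?thesis using rstep_split(1,2)[OF assms(1) _ assms(2,3)] by simp
qed

text \<open>A linear factor is removed whatever \<open>a\<close> is. A factor of higher degree has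
  two distinct roots, and every \<open>a\<close> that separates them splits it.\<close>

lemma rstep_progress:
  assumes "rinv N W (g # gs, out)" "5 \<le> N"
  shows "order R \<le> 3 * card {a \<in> carrier R. rpot (rstep R N bits a (g # gs, out)) < rpot (g # gs, out)}"
    (is "_ \<le> 3 * card ?S")
proof (cases "length g = 2")
  case True
  then have "?S = carrier R" using rstep_linear(2)[OF assms(1) True] by auto
  then show ?thesis by (simp add: order_def)
next
  case False
  then have g3: "3 \<le> length g" using assms(1) by (auto simp: rinv_def)
  have "full g" using assms(1) by (simp add: rinv_def)
  then have "2 \<le> card (zeros g)" using g3 by (simp add: full_def)
  then obtain u v where uv: "u \<in> zeros g" "v \<in> zeros g" "u \<noteq> v"
    by (metis card_le_Suc0_iff_eq finite_zeros not_less_eq_eq numeral_2_eq_2)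
  have "{a \<in> carrier R. side a u \<noteq> side a v} \<subseteq> ?S"
    using rstep_split(3)[OF assms(1) g3 _ assms(2) uv(1,2)] by auto
  then have "card {a \<in> carrier R. side a u \<noteq> side a v} \<le> card ?S" using fin by (intro card_mono) auto
  then show ?thesis using card_side_separating[of u v] uv zerosD(1) by fastforce
qed

text \<open>\<open>D\<close> represents z^n - z modulo \<open>f\<close>, so \<open>g\<close> divides
  \<open>D\<close> and its difference from \<open>allroots\<close>, hence \<open>allroots\<close>
  itself, and is \<open>full\<close>. No root is lost, since \<open>D\<close> vanishes at every zero
  of \<open>f\<close>.\<close>

lemma rinit_inv:
  assumes f: "modulus d f" "length f \<le> N" and N: "5 \<le> N"
  shows "rinv N (zeros f) (rinit R N bits f)" "rpot (rinit R N bits f) \<le> 2 * length f"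
proof -
  let ?u = "onev R f"
  define x where "x = mulmod R f [\<one>, \<zero>] ?u"
  define y where "y = powmod R f bits ?u x"
  define D where "D = axpy R \<one> x y"
  define g where "g = gcdl R N f D"
  note f' = modulusD[OF f(1)]
  have u: "vec d ?u" by (rule vec_onev[OF f(1)])
  have x: "vec d x" using vec_mulmod[OF f(1) u] by (simp add: x_def)
  have y: "vec d y" using vec_powmod[OF f(1) u x] by (simp add: y_def)
  have D: "vec d D" using vec_axpy[OF one_closed x y] by (simp add: D_def)
  note cl = pol_closed[OF vecD(1)[OF x]] pol_closed[OF vecD(1)[OF y]] pol_closed[OF vecD(1)[OF D]]
  have polD: "pol D = pol y \<ominus>\<^bsub>P\<^esub> pol x"
    using pol_axpy_vec[OF one_closed x y] cl by (simp add: D_def)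
  have A: "pol allroots \<in> carrier P" by (rule pol_closed[OF set_allroots])
  have "length D \<le> N" using vecD(2)[OF D] f'(4) f(2) by simp
  note G = gcdl_props[OF f'(7,3) vecD(1)[OF D] f(2) this N, folded g_def]
  have "f pdivides (pol D \<ominus>\<^bsub>P\<^esub> pol allroots)"
  proof (rule pdivides_quotient[OF f'(7) cl(3) A])
    fix Q :: "'a list set ring" and h
    assume h: "ring_hom_cring P Q h" "h f = \<zero>\<^bsub>Q\<^esub>"
    interpret h: ring_hom_cring P Q h by (rule h(1))
    have one: "set [\<one>, \<zero>] \<subseteq> carrier R" by simp
    have "pol [\<one>, \<zero>] = X" by (simp add: pol_Cons)
    then have hx: "h (pol x) = h X"
      using h_mulmod[OF h(1) f(1) h(2) u one] by (simp add: x_def pol_onev)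
    have "h (pol y) = h X [^]\<^bsub>Q\<^esub> order R"
      using h_powmod[OF h(1) f(1) h(2) u x, of bits] by (simp add: y_def pol_onev hx bval_nbits)
    then show "h (pol D) = h (pol allroots)"
      unfolding polD pol_allroots a_minus_def using cl by (simp add: hx)
  qed
  then have 1: "g pdivides (pol D \<ominus>\<^bsub>P\<^esub> pol allroots)" using pdivides_trans G(1,3) by blast
  have "g pdivides (pol D \<oplus>\<^bsub>P\<^esub> (\<ominus>\<^bsub>P\<^esub> \<one>\<^bsub>P\<^esub>) \<otimes>\<^bsub>P\<^esub> (pol D \<ominus>\<^bsub>P\<^esub> pol allroots))"
    by (rule pdivides_add_mult[OF G(4) 1]) (use cl A G(1) in auto)
  also have "pol D \<oplus>\<^bsub>P\<^esub> (\<ominus>\<^bsub>P\<^esub> \<one>\<^bsub>P\<^esub>) \<otimes>\<^bsub>P\<^esub> (pol D \<ominus>\<^bsub>P\<^esub> pol allroots) = pol allroots"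
    using cl(3) A by (simp add: a_minus_def P.l_minus P.minus_add P.r_neg2)
  also have "pol allroots = allroots" using full_allroots by (simp add: full_def pol_polynomial)
  finally have full: "full g" using full_divisor[OF full_allroots G(1)] by simp
  have "eval D r = \<zero>" if r: "r \<in> zeros f" for r
  proof -
    have r': "r \<in> carrier R" using zerosD[OF r] by simp
    have xr: "eval x r = r"
      using eval_mulmod[OF f(1) r u, of "[\<one>, \<zero>]"] r' by (simp add: x_def eval_onev[OF f(1) r'])
    have "eval y r = r"
      using eval_powmod[OF f(1) r u x, of bits] r'
      by (simp add: y_def xr eval_onev[OF f(1) r'] bval_nbits pow_order)
    then show ?thesis
      using eval_axpy_vec[OF one_closed x y r'] xr r' by (simp add: D_def r_neg)
  qed
  then have z: "zeros g = zeros f" using G(5) by (auto simp: zeros_def)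
  have "length g \<le> length f"
    using full z card_zeros_less[OF f'(7,3)] by (simp add: full_def)
  have eq: "rinit R N bits f = (push g [], [])"
    by (simp add: rinit_def Let_def g_def D_def y_def x_def)
  show "rinv N (zeros f) (rinit R N bits f)"
  proof (cases "tl g = []")
    case True
    then have "length g = 1" using full by (cases g) (auto simp: full_def)
    then have "zeros g = {}" using full by (simp add: full_def)
    then show ?thesis using True z by (simp add: eq push_def rinv_def)
  next
    case False
    then have "2 \<le> length g" by (cases g; cases "tl g") auto
    then show ?thesis using False z full \<open>length g \<le> length f\<close> f(2)
      by (simp add: eq push_def rinv_def) (simp add: full_def)
  qed
  show "rpot (rinit R N bits f) \<le> 2 * length f"
    using \<open>length g \<le> length f\<close>
    by (auto simp: eq push_def rpot_def intro: order_trans[OF diff_le_self])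
qed

end


section \<open>Reed-Solomon decoding by interpolation with rational functions\<close>

section \<open>Decoding\<close>

text \<open>In each of the three branches of \<open>kstep\<close> the determinant
  \<open>kdet\<close> is multiplied by l = z - a, up to sign.\<close>

lemma (in cring) det_row_ops:
  assumes "l \<in> carrier R" "c \<in> carrier R" "n \<in> carrier R" "w \<in> carrier R" "m \<in> carrier R" "v \<in> carrier R"
  shows "(l \<otimes> n) \<otimes> (v \<ominus> c \<otimes> w) \<ominus> (m \<ominus> c \<otimes> n) \<otimes> (l \<otimes> w) = l \<otimes> (n \<otimes> v \<ominus> m \<otimes> w)"
    and "(m \<ominus> c \<otimes> n) \<otimes> (l \<otimes> w) \<ominus> (l \<otimes> n) \<otimes> (v \<ominus> c \<otimes> w) = \<ominus> (l \<otimes> (n \<otimes> v \<ominus> m \<otimes> w))"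
    and "n \<otimes> (l \<otimes> v) \<ominus> (l \<otimes> m) \<otimes> w = l \<otimes> (n \<otimes> v \<ominus> m \<otimes> w)"
  using assms by algebra+

lemma (in cring) discrep_row_ops:
  assumes "x \<in> carrier R" "b \<in> carrier R" "c \<in> carrier R"
    "n \<in> carrier R" "w \<in> carrier R" "m \<in> carrier R" "v \<in> carrier R"
  shows "(m \<ominus> c \<otimes> n) \<oplus> \<ominus> (b \<otimes> (v \<ominus> c \<otimes> w)) = (m \<oplus> \<ominus> (b \<otimes> v)) \<ominus> c \<otimes> (n \<oplus> \<ominus> (b \<otimes> w))"
    and "x \<otimes> n \<oplus> \<ominus> (b \<otimes> (x \<otimes> w)) = x \<otimes> (n \<oplus> \<ominus> (b \<otimes> w))"
  using assms by algebra+

context ff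
begin

interpretation P: domain P
  by (rule univ_poly_is_domain[OF sr])

definition lp :: "'a list \<Rightarrow> 'a list" where "lp L = pol (rev L)"

lemma lp_closed [simp]: "set L \<subseteq> carrier R \<Longrightarrow> lp L \<in> carrier P"
  by (simp add: lp_def)

lemma length_lp: "length (lp L) \<le> length L"
  using length_pol[of "rev L"] by (simp add: lp_def)

lemma lp_Nil [simp]: "lp [] = \<zero>\<^bsub>P\<^esub>"
  by (simp add: lp_def)

lemma lp_Cons: "c \<in> carrier R \<Longrightarrow> set L \<subseteq> carrier R \<Longrightarrow> lp (c # L) = X \<otimes>\<^bsub>P\<^esub> lp L \<oplus>\<^bsub>P\<^esub> K c"
  by (simp add: lp_def pol_snoc)

lemma eval_K [simp]: "c \<in> carrier R \<Longrightarrow> x \<in> carrier R \<Longrightarrow> eval (K c) x = c"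
  by (simp add: poly_of_const_def)

lemma eval_P_minus:
  assumes "p \<in> carrier P" "q \<in> carrier P" "x \<in> carrier R"
  shows "eval (p \<ominus>\<^bsub>P\<^esub> q) x = eval p x \<ominus> eval q x"
proof -
  interpret e: ring_hom_cring P R "\<lambda>p. eval p x" by (rule eval_P_hom[OF assms(3)])
  show ?thesis using assms by (simp add: a_minus_def)
qed

lemma eval_P_closed: "p \<in> carrier P \<Longrightarrow> x \<in> carrier R \<Longrightarrow> eval p x \<in> carrier R"
  using eval_in_carrier[OF P_set] .

lemma lev_eq:
  assumes "set L \<subseteq> carrier R" "x \<in> carrier R"
  shows "lev R x L = eval (lp L) x"
  using assms(1)
proof (induction L)
  case Nil
  then show ?case by (simp add: lev_def univ_poly_zero)
next
  case (Cons c L)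
  have "eval (lp (c # L)) x = x \<otimes> eval (lp L) x \<oplus> c"
    using Cons.prems assms(2) by (simp add: lp_Cons eval_P_add eval_P_mult eval_var)
  then show ?case
    using Cons assms(2) eval_P_closed[of "lp L" x] by (simp add: lev_def m_comm)
qed

lemma lp_axpy:
  assumes "c \<in> carrier R" "set xs \<subseteq> carrier R" "set ys \<subseteq> carrier R"
  shows "lp (axpy R c xs ys) = lp ys \<ominus>\<^bsub>P\<^esub> K c \<otimes>\<^bsub>P\<^esub> lp xs"
  using assms(2,3)
proof (induction xs arbitrary: ys)
  case Nil
  then show ?case using assms(1) by (simp add: a_minus_def)
next
  case (Cons x xs)
  interpret h: ring_hom_ring R P K by (rule K_hom)
  show ?case
  proof (cases ys)
    case Nil
    have "set (axpy R c xs []) \<subseteq> carrier R" using axpy_closed[OF assms(1)] Cons.prems by simp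
    then show ?thesis using Cons.IH[of "[]"] Cons.prems assms(1) Nil
      by (simp add: lp_Cons a_minus_def P.r_distr P.r_minus P.minus_add P.m_lcomm)
  next
    case (Cons y zs)
    have "set (axpy R c xs zs) \<subseteq> carrier R" using axpy_closed[OF assms(1)] Cons.prems Cons by simp
    then show ?thesis using Cons.IH[of zs] Cons.prems assms(1) Cons
      by (simp add: lp_Cons a_minus_def P.r_distr P.r_minus P.minus_add P.m_lcomm P.a_ac)
  qed
qed

lemma mull_closed: "a \<in> carrier R \<Longrightarrow> set p \<subseteq> carrier R \<Longrightarrow> set (mull R a p) \<subseteq> carrier R"
  using axpy_closed[of a p "\<zero> # p"] by (simp add: mull_def)

lemma lp_mull:
  assumes "a \<in> carrier R" "set p \<subseteq> carrier R"
  shows "lp (mull R a p) = (X \<ominus>\<^bsub>P\<^esub> K a) \<otimes>\<^bsub>P\<^esub> lp p"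
proof (cases "p = []")
  case True
  then show ?thesis using assms(1) by (simp add: mull_def)
next
  case False
  then show ?thesis
    using assms lp_axpy[of a p "\<zero> # p"]
    by (simp add: mull_def lp_Cons a_minus_def P.l_distr P.l_minus)
qed

lemma linear_poly: "a \<in> carrier R \<Longrightarrow> X \<ominus>\<^bsub>P\<^esub> K a = [\<one>, \<ominus> a]"
proof -
  assume a: "a \<in> carrier R"
  interpret h: ring_hom_ring R P K by (rule K_hom)
  have "[\<one>, \<ominus> a] \<in> carrier P" using a by (simp add: carrier_P_iff)
  then have "[\<one>, \<ominus> a] = pol [\<one>, \<ominus> a]" by (simp add: pol_polynomial)
  also have "\<dots> = X \<ominus>\<^bsub>P\<^esub> K a" using a by (simp add: pol_Cons a_minus_def)
  finally show ?thesis by simp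
qed

lemma linear_poly_closed [simp]: "a \<in> carrier R \<Longrightarrow> [\<one>, \<ominus> a] \<in> carrier P"
  by (simp add: carrier_P_iff)

lemma linear_nonzero: "a \<in> carrier R \<Longrightarrow> X \<ominus>\<^bsub>P\<^esub> K a \<noteq> \<zero>\<^bsub>P\<^esub>"
  by (simp add: linear_poly univ_poly_zero)

lemma last_axpy: "length xs < length ys \<Longrightarrow> last (axpy R c xs ys) = last ys"
proof (induction xs arbitrary: ys)
  case (Cons x xs)
  then show ?case by (cases ys) auto
qed simp

lemma rootpoly_props:
  assumes "distinct as" "set as \<subseteq> carrier R"
  shows "rev (rootpoly R as) = JS_poly R (set as)" "length (rootpoly R as) = Suc (length as)"
    "hd (JS_poly R (set as)) = \<one>" "JS_poly R (set as) \<in> carrier P"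
proof -
  have *: "set (fold (mull R) as p) \<subseteq> carrier R \<and> fold (mull R) as p \<noteq> [] \<and>
     last (fold (mull R) as p) = last p \<and> length (fold (mull R) as p) = length as + length p \<and>
     lp (fold (mull R) as p) = (\<Otimes>\<^bsub>P\<^esub> x\<in>set as. [\<one>, \<ominus> x]) \<otimes>\<^bsub>P\<^esub> lp p"
    if "set p \<subseteq> carrier R" "p \<noteq> []" for p
    using assms that
  proof (induction as arbitrary: p)
    case (Cons a as)
    let ?p = "mull R a p"
    have p: "set ?p \<subseteq> carrier R" "?p \<noteq> []" "last ?p = last p" "length ?p = Suc (length p)"
      using Cons.prems mull_closed[of a p] by (simp_all add: mull_def last_axpy)
    have "(\<Otimes>\<^bsub>P\<^esub> x\<in>set (a # as). [\<one>, \<ominus> x]) = [\<one>, \<ominus> a] \<otimes>\<^bsub>P\<^esub> (\<Otimes>\<^bsub>P\<^esub> x\<in>set as. [\<one>, \<ominus> x])"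
      using Cons.prems by (simp add: P.finprod_insert Pi_def subset_iff)
    moreover have "(\<Otimes>\<^bsub>P\<^esub> x\<in>set as. [\<one>, \<ominus> x]) \<in> carrier P"
      using Cons.prems by (intro P.finprod_closed) auto
    moreover have "lp ?p = [\<one>, \<ominus> a] \<otimes>\<^bsub>P\<^esub> lp p" using Cons.prems by (simp add: lp_mull linear_poly)
    ultimately show ?case
      using Cons.IH[OF _ _ p(1,2)] Cons.prems p
      by (simp add: P.m_assoc P.m_lcomm)
  qed simp
  have L: "set (rootpoly R as) \<subseteq> carrier R" "rootpoly R as \<noteq> []" "last (rootpoly R as) = \<one>"
    "length (rootpoly R as) = Suc (length as)"
    "lp (rootpoly R as) = (\<Otimes>\<^bsub>P\<^esub> x\<in>set as. [\<one>, \<ominus> x]) \<otimes>\<^bsub>P\<^esub> lp [\<one>]"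
    using *[of "[\<one>]"] by (simp_all add: rootpoly_def)
  have c: "(\<Otimes>\<^bsub>P\<^esub> x\<in>set as. [\<one>, \<ominus> x]) \<in> carrier P"
    using assms(2) by (intro P.finprod_closed) auto
  have "lp (rootpoly R as) = JS_poly R (set as)"
    using L(5) c by (simp add: JS_poly_def lp_Cons)
  moreover have r: "rev (rootpoly R as) \<in> carrier P" using L by (simp add: carrier_P_iff hd_rev)
  ultimately show 1: "rev (rootpoly R as) = JS_poly R (set as)"
    by (simp add: lp_def pol_polynomial)
  show "length (rootpoly R as) = Suc (length as)" by (rule L(4))
  show "hd (JS_poly R (set as)) = \<one>" "JS_poly R (set as) \<in> carrier P"
    using r L(2,3) hd_rev[of "rootpoly R as"] unfolding 1 by simp_all
qed


subsection \<open>Invariant of the interpolation\<close>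

text \<open>Up to sign the product of z - a over the points processed. Only its being nonzero is
  kept, which prevents a row from vanishing.\<close>

definition kdet :: "'a kstate \<Rightarrow> 'a list" where
  "kdet st = (case st of ((n, w), (m, v), d) \<Rightarrow> lp n \<otimes>\<^bsub>P\<^esub> lp v \<ominus>\<^bsub>P\<^esub> lp m \<otimes>\<^bsub>P\<^esub> lp w)"

text \<open>The weight of the row is below \<open>D\<close>: deg n < D, and deg w + k - 1 < D unless
  w is zero, written with lengths.\<close>

definition kbound :: "nat \<Rightarrow> nat \<Rightarrow> 'a list \<times> 'a list \<Rightarrow> bool" where
  "kbound k D p \<longleftrightarrow> set (fst p) \<subseteq> carrier R \<and> set (snd p) \<subseteq> carrier R \<and> length (fst p) \<le> D \<and>
     (snd p = [] \<or> length (snd p) + k \<le> Suc D)"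

text \<open>The weighted degrees of the two rows of the interpolation basis are bounded by \<open>D\<close> and \<open>D + d\<close>;
  since the lengths are one more than the degrees, \<open>D\<close> is one more than the weighted degree.\<close>

definition kinv :: "nat \<Rightarrow> 'a list \<Rightarrow> nat \<Rightarrow> 'a set \<Rightarrow> 'a kstate \<Rightarrow> bool" where
  "kinv k h j S st \<longleftrightarrow> (case st of (p, q, d) \<Rightarrow>
     (\<exists>D. kbound k D p \<and> kbound k (D + d) q \<and> 2 * D + d = k + 1 + j) \<and>
     (\<forall>x\<in>S. discrep R x (lev R x h) p = \<zero> \<and> discrep R x (lev R x h) q = \<zero>)) \<and>
     kdet st \<noteq> \<zero>\<^bsub>P\<^esub>"

lemma lev_closed: "set h \<subseteq> carrier R \<Longrightarrow> x \<in> carrier R \<Longrightarrow> lev R x h \<in> carrier R"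
  by (simp add: lev_eq eval_P_closed)

lemma discrep_closed:
  assumes "kbound k D p" "x \<in> carrier R" "b \<in> carrier R"
  shows "discrep R x b p \<in> carrier R"
  using assms by (simp add: discrep_def kbound_def lev_closed)

lemma discrep_axpy:
  assumes "kbound k D p" "kbound k E q" "x \<in> carrier R" "b \<in> carrier R" "c \<in> carrier R"
  shows "discrep R x b (axpy R c (fst p) (fst q), axpy R c (snd p) (snd q)) =
    discrep R x b q \<ominus> c \<otimes> discrep R x b p"
proof -
  have l: "lev R x (axpy R c xs ys) = lev R x ys \<ominus> c \<otimes> lev R x xs"
    if "set xs \<subseteq> carrier R" "set ys \<subseteq> carrier R" for xs ys
    using that assms(3,5) axpy_closed[OF assms(5) that]
    by (simp add: lev_eq lp_axpy eval_P_minus eval_P_mult)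
  show ?thesis
    using assms discrep_row_ops(1)[of x b c "lev R x (fst p)" "lev R x (snd p)" "lev R x (fst q)" "lev R x (snd q)"]
    by (simp add: discrep_def l kbound_def lev_closed)
qed

lemma discrep_mull:
  assumes "kbound k D p" "x \<in> carrier R" "b \<in> carrier R" "a \<in> carrier R"
  shows "discrep R x b (mull R a (fst p), mull R a (snd p)) = (x \<ominus> a) \<otimes> discrep R x b p"
proof -
  have l: "lev R x (mull R a xs) = (x \<ominus> a) \<otimes> lev R x xs"
    if "set xs \<subseteq> carrier R" for xs
    using that assms(2,4) mull_closed[OF assms(4) that]
    by (simp add: lev_eq lp_mull eval_P_minus eval_P_mult eval_var)
  show ?thesis
    using assms discrep_row_ops(2)[of "x \<ominus> a" b \<zero> "lev R x (fst p)" "lev R x (snd p)" \<zero> \<zero>]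
    by (simp add: discrep_def l kbound_def lev_closed)
qed

lemma kbound_mull:
  assumes "kbound k D p" "a \<in> carrier R"
  shows "kbound k (Suc D) (mull R a (fst p), mull R a (snd p))"
  using assms mull_closed[OF assms(2)] length_mull[of R a "fst p"] length_mull[of R a "snd p"]
  by (auto simp: kbound_def) (auto simp: mull_def)

lemma kbound_axpy:
  assumes "kbound k D p" "kbound k E q" "D \<le> E" "c \<in> carrier R"
  shows "kbound k E (axpy R c (fst p) (fst q), axpy R c (snd p) (snd q))"
  using assms axpy_closed[OF assms(4)] by (auto simp: kbound_def)

text \<open>Each point raises \<open>2 * D + d\<close> by exactly one, since only one row is
  multiplied by z - a. Subtracting a multiple of the lighter row from the heavier one does not raise
  the bound \<open>D + d\<close>.\<close>

lemma kstep_inv: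
  assumes inv: "kinv k h j S st" and h: "set h \<subseteq> carrier R" and a: "a \<in> carrier R" and S: "S \<subseteq> carrier R"
  shows "kinv k h (Suc j) (insert a S) (kstep R h a st)"
proof -
  obtain n w m v d where st: "st = ((n, w), (m, v), d)" by (metis surj_pair)
  obtain D where D: "kbound k D (n, w)" "kbound k (D + d) (m, v)" "2 * D + d = k + 1 + j"
    using inv by (auto simp: kinv_def st)
  have z: "discrep R x (lev R x h) (n, w) = \<zero>" "discrep R x (lev R x h) (m, v) = \<zero>" if "x \<in> S" for x
    using inv that by (auto simp: kinv_def st)
  have det: "kdet st \<noteq> \<zero>\<^bsub>P\<^esub>" using inv by (simp add: kinv_def)
  have cl: "set n \<subseteq> carrier R" "set w \<subseteq> carrier R" "set m \<subseteq> carrier R" "set v \<subseteq> carrier R"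
    using D(1,2) by (auto simp: kbound_def)
  let ?b = "\<lambda>x. lev R x h"
  have b: "?b x \<in> carrier R" if "x \<in> carrier R" for x using lev_closed[OF h that] .
  define \<delta> where "\<delta> = discrep R a (?b a) (n, w)"
  define \<epsilon> where "\<epsilon> = discrep R a (?b a) (m, v)"
  define c where "c = \<epsilon> \<otimes> finv R \<delta>"
  have de: "\<delta> \<in> carrier R" "\<epsilon> \<in> carrier R" "c \<in> carrier R"
    using discrep_closed[OF D(1) a b[OF a]] discrep_closed[OF D(2) a b[OF a]]
    by (simp_all add: \<delta>_def \<epsilon>_def c_def)
  define P' where "P' = (mull R a n, mull R a w)"
  define Q1 where "Q1 = (mull R a m, mull R a v)"
  define Q2 where "Q2 = (axpy R c n m, axpy R c w v)"
  have P': "kbound k (Suc D) P'" and Q1: "kbound k (Suc (D + d)) Q1" and Q2: "kbound k (D + d) Q2"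
    using kbound_mull[OF D(1) a] kbound_mull[OF D(2) a] kbound_axpy[OF D(1,2) _ de(3)]
    by (simp_all add: P'_def Q1_def Q2_def)
  have dP: "discrep R x (?b x) P' = (x \<ominus> a) \<otimes> discrep R x (?b x) (n, w)"
    and dQ1: "discrep R x (?b x) Q1 = (x \<ominus> a) \<otimes> discrep R x (?b x) (m, v)"
    and dQ2: "discrep R x (?b x) Q2 = discrep R x (?b x) (m, v) \<ominus> c \<otimes> discrep R x (?b x) (n, w)"
    if "x \<in> carrier R" for x
    using discrep_mull[OF D(1) that b[OF that] a] discrep_mull[OF D(2) that b[OF that] a]
      discrep_axpy[OF D(1,2) that b[OF that] de(3)]
    by (simp_all add: P'_def Q1_def Q2_def)
  have aa: "a \<ominus> a = \<zero>" using a by (simp add: a_minus_def r_neg)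
  have l: "X \<ominus>\<^bsub>P\<^esub> K a \<in> carrier P" "X \<ominus>\<^bsub>P\<^esub> K a \<noteq> \<zero>\<^bsub>P\<^esub>"
    using a linear_nonzero[OF a] by simp_all
  have lc: "lp n \<in> carrier P" "lp w \<in> carrier P" "lp m \<in> carrier P" "lp v \<in> carrier P" "K c \<in> carrier P"
    using cl de by simp_all
  have dc: "kdet st \<in> carrier P" using lc by (simp add: kdet_def st)
  have ldet: "(X \<ominus>\<^bsub>P\<^esub> K a) \<otimes>\<^bsub>P\<^esub> kdet st \<noteq> \<zero>\<^bsub>P\<^esub>"
    using P.integral[OF _ l(1) dc] l(2) det by blast
  show ?thesis
  proof (cases "\<delta> = \<zero>")
    case True
    have eq: "kstep R h a st = ((n, w), Q1, Suc d)"
      using True by (simp add: st Let_def \<delta>_def Q1_def)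
    have "kdet (kstep R h a st) = (X \<ominus>\<^bsub>P\<^esub> K a) \<otimes>\<^bsub>P\<^esub> kdet st"
      unfolding eq using P.det_row_ops(3)[OF l(1) lc(5,1,2,3,4)] cl a
      by (simp add: kdet_def Q1_def lp_mull st)
    then have 1: "kdet (kstep R h a st) \<noteq> \<zero>\<^bsub>P\<^esub>" using ldet by simp
    have "discrep R x (?b x) (n, w) = \<zero> \<and> discrep R x (?b x) Q1 = \<zero>" if "x \<in> insert a S" for x
    proof (cases "x \<in> S")
      case True
      then show ?thesis using z[OF True] dQ1[of x] S a by auto
    next
      case False
      then have "x = a" using that by simp
      then show ?thesis using dQ1[OF a] a aa \<open>\<delta> = \<zero>\<close> de(2) by (simp add: \<delta>_def \<epsilon>_def)
    qed
    then show ?thesis using D(1,3) Q1 1 unfolding kinv_def eq by (auto intro!: exI[of _ D])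
  next
    case False
    have z1: "discrep R x (?b x) P' = \<zero> \<and> discrep R x (?b x) Q2 = \<zero>" if "x \<in> insert a S" for x
    proof (cases "x \<in> S")
      case True
      then have x: "x \<in> carrier R" using S by auto
      then show ?thesis using z[OF True] dP[OF x] dQ2[OF x] a de by (simp add: a_minus_def)
    next
      case False
      then have "x = a" using that by simp
      moreover have "c \<otimes> \<delta> = \<epsilon>" using de \<open>\<delta> \<noteq> \<zero>\<close> by (simp add: c_def m_assoc finv_mult)
      ultimately show ?thesis
        using dP[OF a] dQ2[OF a] aa de by (simp add: \<delta>_def[symmetric] \<epsilon>_def[symmetric] a_minus_def r_neg)
    qed
    show ?thesis
    proof (cases "d = 0")
      case True
      have eq: "kstep R h a st = (Q2, P', 1)"
        using True False by (simp add: st Let_def \<delta>_def \<epsilon>_def c_def Q2_def P'_def)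
      have "kdet (kstep R h a st) = \<ominus>\<^bsub>P\<^esub> ((X \<ominus>\<^bsub>P\<^esub> K a) \<otimes>\<^bsub>P\<^esub> kdet st)"
        unfolding eq using P.det_row_ops(2)[OF l(1) lc(5,1,2,3,4)] cl a de
        by (simp add: kdet_def P'_def Q2_def lp_mull lp_axpy st)
      then have 1: "kdet (kstep R h a st) \<noteq> \<zero>\<^bsub>P\<^esub>"
        using ldet P.minus_minus P.m_closed[OF l(1) dc] P.minus_zero by metis
      then show ?thesis using D(3) Q2 P' z1 True unfolding kinv_def eq by (auto intro!: exI[of _ D])
    next
      case d: False
      have eq: "kstep R h a st = (P', Q2, d - 1)"
        using d False by (simp add: st Let_def \<delta>_def \<epsilon>_def c_def Q2_def P'_def)
      have "kdet (kstep R h a st) = (X \<ominus>\<^bsub>P\<^esub> K a) \<otimes>\<^bsub>P\<^esub> kdet st"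
        unfolding eq using P.det_row_ops(1)[OF l(1) lc(5,1,2,3,4)] cl a de
        by (simp add: kdet_def P'_def Q2_def lp_mull lp_axpy st)
      then have 1: "kdet (kstep R h a st) \<noteq> \<zero>\<^bsub>P\<^esub>" using ldet by simp
      then show ?thesis using D(3) Q2 P' z1 d unfolding kinv_def eq by (auto intro!: exI[of _ "Suc D"])
    qed
  qed
qed

lemma kinit_inv: "kinv k h 0 {} (kinit R k)"
proof -
  have "\<ominus>\<^bsub>P\<^esub> \<one>\<^bsub>P\<^esub> \<noteq> \<zero>\<^bsub>P\<^esub>" by (metis P.minus_minus P.minus_zero P.one_closed P.one_not_zero)
  \<comment> \<open>The bound \<open>D\<close> is 0 for \<open>k = 0\<close> and 1 otherwise, one
    more than the smaller initial weight.\<close>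
  then show ?thesis
    by (auto simp: kinv_def kinit_def kbound_def kdet_def lp_Cons a_minus_def
        intro: exI[of _ 0] exI[of _ 1])
qed

lemma interp_props:
  assumes h: "set h \<subseteq> carrier R" and as: "set as \<subseteq> carrier R"
  obtains D where "kbound k D (interp R k h as)" "2 * D \<le> k + 1 + length as"
    "\<And>x. x \<in> set as \<Longrightarrow> discrep R x (lev R x h) (interp R k h as) = \<zero>"
    "lp (fst (interp R k h as)) = \<zero>\<^bsub>P\<^esub> \<Longrightarrow> lp (snd (interp R k h as)) \<noteq> \<zero>\<^bsub>P\<^esub>"
proof -
  have "kinv k h (j + length as) (set as \<union> S) (fold (kstep R h) as st)"
    if "kinv k h j S st" "S \<subseteq> carrier R" for j S st
    using that as
  proof (induction as arbitrary: j S st)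
    case (Cons a as)
    then show ?case
      using Cons.IH[OF kstep_inv[OF Cons.prems(1) h _ Cons.prems(2), of a]] by simp
  qed simp
  from this[OF kinit_inv] have inv: "kinv k h (length as) (set as) (fold (kstep R h) as (kinit R k))" by simp
  obtain n w m v d where st: "fold (kstep R h) as (kinit R k) = ((n, w), (m, v), d)" by (metis surj_pair)
  have i: "interp R k h as = (n, w)" by (simp add: interp_def st)
  obtain D where D: "kbound k D (n, w)" "kbound k (D + d) (m, v)" "2 * D + d = k + 1 + length as"
    using inv by (auto simp: kinv_def st)
  have "lp m \<in> carrier P" "lp v \<in> carrier P" using D(2) by (auto simp: kbound_def)
  then have "lp n = \<zero>\<^bsub>P\<^esub> \<Longrightarrow> lp w \<noteq> \<zero>\<^bsub>P\<^esub>"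
    using inv by (auto simp: kinv_def st kdet_def a_minus_def)
  then show ?thesis using that[of D] D inv by (auto simp: i kinv_def st)
qed


subsection \<open>Division\<close>

lemma X_nonzero: "X \<noteq> \<zero>\<^bsub>P\<^esub>"
  by (simp add: var_def univ_poly_zero)

lemma lp_hd:
  assumes "set L \<subseteq> carrier R"
  shows "hd0 R L = eval (lp L) \<zero>"
proof (cases L)
  case Nil
  then show ?thesis by (simp add: hd0_def univ_poly_zero)
next
  case (Cons c L')
  then show ?thesis
    using assms eval_P_closed[of "lp L'" \<zero>] by (simp add: hd0_def lp_Cons eval_P_add eval_P_mult eval_var)
qed

lemma lp_tl:
  assumes "set L \<subseteq> carrier R" "r \<in> carrier P" "lp L = X \<otimes>\<^bsub>P\<^esub> r"
  shows "lp (tl L) = r"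
proof (cases L)
  case Nil
  then have "X \<otimes>\<^bsub>P\<^esub> r = \<zero>\<^bsub>P\<^esub>" using assms(3) by simp
  then show ?thesis using P.integral[OF _ X_closed assms(2)] X_nonzero Nil by auto
next
  case (Cons c L')
  have "c = eval (lp L) \<zero>" using lp_hd[OF assms(1)] by (simp add: Cons hd0_def)
  then have "c = eval (X \<otimes>\<^bsub>P\<^esub> r) \<zero>" by (simp only: assms(3))
  then have "c = \<zero>" using assms(2) eval_P_closed[of r \<zero>] by (simp add: eval_P_mult eval_var)
  then have "X \<otimes>\<^bsub>P\<^esub> lp L' = X \<otimes>\<^bsub>P\<^esub> r" using assms Cons by (simp add: lp_Cons)
  then show ?thesis using P.m_lcancel[OF X_nonzero X_closed] assms Cons by simp
qed

lemma strip_props: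
  assumes "set (fst s) \<subseteq> carrier R" "set (snd s) \<subseteq> carrier R"
  shows "set (fst ((strip_step R ^^ m) s)) \<subseteq> carrier R \<and> set (snd ((strip_step R ^^ m) s)) \<subseteq> carrier R"
  using assms
proof (induction m arbitrary: s)
  case (Suc m)
  have "set (fst (strip_step R s)) \<subseteq> carrier R \<and> set (snd (strip_step R s)) \<subseteq> carrier R"
    using Suc.prems by (cases s) (simp add: set_tl)
  then show ?case using Suc.IH[of "strip_step R s"] by (simp add: funpow_swap1)
qed simp

text \<open>If z divides w, it divides n = w p, so one factor cancels without changing the quotient.
  A nonzero w reaches a nonzero constant coefficient within \<open>length w\<close> rounds.\<close>

lemma strip_quotient:
  assumes "set n \<subseteq> carrier R" "set w \<subseteq> carrier R" "p \<in> carrier P"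
    and "lp n = lp w \<otimes>\<^bsub>P\<^esub> p" "lp w \<noteq> \<zero>\<^bsub>P\<^esub>" "length w \<le> m"
  shows "\<exists>n' w'. (strip_step R ^^ m) (n, w) = (n', w') \<and> lp n' = lp w' \<otimes>\<^bsub>P\<^esub> p \<and>
    w' \<noteq> [] \<and> hd w' \<noteq> \<zero>"
  using assms
proof (induction m arbitrary: n w)
  case 0
  then show ?case by simp
next
  case (Suc m)
  have ne: "w \<noteq> []" using Suc.prems(5) by auto
  show ?case
  proof (cases "hd w = \<zero>")
    case True
    obtain w' where w: "w = \<zero> # w'" using True ne by (cases w) auto
    have w': "set w' \<subseteq> carrier R" using Suc.prems(2) w by simp
    have lw: "lp w = X \<otimes>\<^bsub>P\<^esub> lp w'" using w' by (simp add: w lp_Cons)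
    then have "lp n = X \<otimes>\<^bsub>P\<^esub> (lp w' \<otimes>\<^bsub>P\<^esub> p)" using Suc.prems(3,4) w' by (simp add: P.m_assoc)
    then have "lp (tl n) = lp w' \<otimes>\<^bsub>P\<^esub> p" using Suc.prems(1,3) w' by (intro lp_tl) simp_all
    moreover have "lp w' \<noteq> \<zero>\<^bsub>P\<^esub>" using Suc.prems(5) lw by auto
    ultimately show ?thesis
      using Suc.IH[OF set_tl[OF Suc.prems(1)] w' Suc.prems(3)] Suc.prems(6)
      by (simp add: w funpow_swap1)
  next
    case False
    have "(strip_step R ^^ j) (n, w) = (n, w)" for j
      using False by (induction j) simp_all
    then show ?thesis using Suc.prems ne False by auto
  qed
qed

lemma dstep_closed:
  assumes "set w \<subseteq> carrier R" "set (fst s) \<subseteq> carrier R" "set (snd s) \<subseteq> carrier R"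
  shows "set (snd ((dstep R w ^^ k) s)) \<subseteq> carrier R"
  using assms(2,3)
proof (induction k arbitrary: s)
  case (Suc k)
  have h: "hd0 R L \<in> carrier R" if "set L \<subseteq> carrier R" for L using that by (cases L) (simp_all add: hd0_def)
  have "set (fst (dstep R w s)) \<subseteq> carrier R \<and> set (snd (dstep R w s)) \<subseteq> carrier R"
  proof -
    obtain a b where s: "s = (a, b)" by (cases s)
    have "set (axpy R (hd0 R a \<otimes> finv R (hd0 R w)) w a) \<subseteq> carrier R"
      using Suc.prems h assms(1) by (intro axpy_closed) (simp_all add: s)
    then show ?thesis using Suc.prems h assms(1) by (simp add: s Let_def set_tl)
  qed
  then show ?case using Suc.IH[of "dstep R w s"] by (simp add: funpow_swap1)
qed simp

lemma psdiv_closed: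
  assumes "set (fst s) \<subseteq> carrier R" "set (snd s) \<subseteq> carrier R"
  shows "set (psdiv R k s) \<subseteq> carrier R"
  using dstep_closed[OF assms(2), of "(fst s, [])"] assms by (simp add: psdiv_def)

text \<open>Induction on \<open>q\<close>: the constant coefficient of w q is \<open>hd w\<close>
  times that of \<open>q\<close>, so it can be read off, and removing it leaves z times a product of
  the same form.\<close>

lemma psdiv_quotient:
  assumes "set n \<subseteq> carrier R" "set w \<subseteq> carrier R" "w \<noteq> []" "hd w \<noteq> \<zero>"
    and "set q \<subseteq> carrier R" "lp n = lp w \<otimes>\<^bsub>P\<^esub> lp q"
  shows "psdiv R (length q) (n, w) = q"
proof -
  have w0: "hd0 R w = hd w" "hd w \<in> carrier R" using assms(2,3) by (cases w; simp add: hd0_def)+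
  have "snd ((dstep R w ^^ length q) (n, acc)) = rev q @ acc" for acc
    using assms(1,5,6)
  proof (induction q arbitrary: n acc)
    case (Cons c q)
    have c: "c \<in> carrier R" "set q \<subseteq> carrier R" using Cons.prems by auto
    note lc = lp_closed[OF assms(2)] lp_closed[OF c(2)] lp_closed[OF Cons.prems(1)]
    have "hd0 R n = hd w \<otimes> c"
      using lp_hd[OF Cons.prems(1)] lp_hd[OF assms(2)] c lc(1,2) eval_P_closed[of "lp q" \<zero>] w0(1)
      unfolding Cons.prems(3) by (simp add: lp_Cons eval_P_mult eval_P_add eval_var)
    then have "hd0 R n \<otimes> finv R (hd0 R w) = (finv R (hd w) \<otimes> hd w) \<otimes> c"
      using c w0 by (simp add: m_ac)
    then have d: "hd0 R n \<otimes> finv R (hd0 R w) = c" using c w0 assms(4) finv_mult[of "hd w"] by simp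
    have A: "set (axpy R c w n) \<subseteq> carrier R" by (rule axpy_closed[OF c(1) assms(2) Cons.prems(1)])
    have "lp (axpy R c w n) = X \<otimes>\<^bsub>P\<^esub> (lp w \<otimes>\<^bsub>P\<^esub> lp q)"
      unfolding lp_axpy[OF c(1) assms(2) Cons.prems(1)] Cons.prems(3)
      using c lc by (simp add: lp_Cons P.r_distr a_minus_def P.a_assoc P.m_comm[of "K c"] P.r_neg P.m_lcomm)
    then have "lp (tl (axpy R c w n)) = lp w \<otimes>\<^bsub>P\<^esub> lp q" using A lc by (intro lp_tl) simp_all
    then show ?case
      using Cons.IH[OF set_tl[OF A] c(2), of "c # acc"] by (simp add: funpow_swap1 Let_def d)
  qed simp
  then show ?thesis by (simp add: psdiv_def)
qed

end


section \<open>Correctness of decoding, and recovery of sets at distance at most t\<close>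

section \<open>The improved Juels-Sudan construction\<close>

context ff
begin

interpretation P: domain P
  by (rule univ_poly_is_domain[OF sr])

lemma pol_append:
  assumes "set A \<subseteq> carrier R" "set B \<subseteq> carrier R"
  shows "pol (A @ B) = pol (A @ replicate (length B) \<zero>) \<oplus>\<^bsub>P\<^esub> pol B"
  using assms(1)
proof (induction A)
  case Nil
  have "pol (replicate k \<zero>) = \<zero>\<^bsub>P\<^esub>" for k
    using pol_zeros_append[of k "[]"] by simp
  then show ?case using assms(2) by simp
next
  case (Cons a A)
  moreover have "set (A @ replicate (length B) \<zero>) \<subseteq> carrier R" "set (A @ B) \<subseteq> carrier R"
    using Cons.prems assms(2) by auto
  ultimately show ?case using assms(2) by (simp add: pol_Cons P.a_assoc del: set_append)
qed

lemma length_P_minus: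
  assumes "p \<in> carrier P" "q \<in> carrier P"
  shows "length (p \<ominus>\<^bsub>P\<^esub> q) \<le> max (length p) (length q)"
proof -
  have "length (poly_add p (\<ominus>\<^bsub>P\<^esub> q)) \<le> max (length p) (length (\<ominus>\<^bsub>P\<^esub> q))"
    by (rule poly_add_length_le)
  then show ?thesis
    unfolding a_minus_def univ_poly_add univ_poly_a_inv_length[OF sr assms(2)] .
qed

lemma length_P_minus_le:
  "p \<in> carrier P \<Longrightarrow> q \<in> carrier P \<Longrightarrow> length p \<le> m \<Longrightarrow> length q \<le> m \<Longrightarrow> length (p \<ominus>\<^bsub>P\<^esub> q) \<le> m"
  using length_P_minus[of p q] max.boundedI order_trans by blast

lemma P_minus_cancel:
  assumes "p \<in> carrier P" "q \<in> carrier P" "p \<ominus>\<^bsub>P\<^esub> q = []"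
  shows "p = q"
  using assms P.r_right_minus_eq[of p q] by (simp add: univ_poly_zero)

text \<open>Each element of \<open>w\<close> is a zero by splitting off its linear factor, and the
  degree \<open>card w\<close> leaves no room for others.\<close>

lemma zeros_JS_poly:
  assumes "w \<subseteq> carrier R"
  shows "zeros (JS_poly R w) = w"
proof -
  have "finite w" using assms fin finite_subset by blast
  then obtain as where as: "set as = w" "distinct as" using finite_distinct_list by blast
  have as': "set as \<subseteq> carrier R" using as assms by simp
  note rp = rootpoly_props[OF as(2) as', unfolded as(1)]
  have c: "JS_poly R w \<in> carrier P" "length (JS_poly R w) = Suc (card w)"
    using rp(4) length_rev[of "rootpoly R as"] distinct_card[OF as(2)] by (simp_all only: rp(1,2) as(1))
  have "w \<subseteq> zeros (JS_poly R w)"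
  proof
    fix a assume a: "a \<in> w"
    have Pi: "(\<lambda>x. [\<one>, \<ominus> x]) \<in> w - {a} \<rightarrow> carrier P" using assms by auto
    have "JS_poly R w = (\<Otimes>\<^bsub>P\<^esub> x\<in>insert a (w - {a}). [\<one>, \<ominus> x])"
      using a by (simp add: JS_poly_def insert_absorb)
    also have "\<dots> = [\<one>, \<ominus> a] \<otimes>\<^bsub>P\<^esub> (\<Otimes>\<^bsub>P\<^esub> x\<in>w - {a}. [\<one>, \<ominus> x])"
      using \<open>finite w\<close> a assms Pi by (intro P.finprod_insert) auto
    finally have eq: "JS_poly R w = [\<one>, \<ominus> a] \<otimes>\<^bsub>P\<^esub> (\<Otimes>\<^bsub>P\<^esub> x\<in>w - {a}. [\<one>, \<ominus> x])" .
    have "(\<Otimes>\<^bsub>P\<^esub> x\<in>w - {a}. [\<one>, \<ominus> x]) \<in> carrier P" by (rule P.finprod_closed[OF Pi])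
    moreover have "a \<in> carrier R" using a assms by auto
    ultimately show "a \<in> zeros (JS_poly R w)"
      using eval_P_closed by (simp add: zeros_def eq eval_P_mult r_neg)
  qed
  moreover have "card (zeros (JS_poly R w)) \<le> card w"
    using card_zeros_less[OF c(1)] c(2) by force
  ultimately show ?thesis using card_seteq[OF finite_zeros] by blast
qed

lemma JS_SS_eq:
  assumes as: "distinct as" "set as \<subseteq> carrier R" and t: "t \<le> length as"
  shows "map (\<lambda>j. coeff (JS_poly R (set as)) (length as - 1 - j)) [0..<t] = take t (tl (rev (rootpoly R as)))"
proof -
  note rp = rootpoly_props[OF as]
  have l: "length (JS_poly R (set as)) = Suc (length as)" using rp(1,2) by (metis length_rev)
  show ?thesis
    unfolding rp(1)
    by (rule nth_equalityI) (use t l in \<open>auto simp: coeff_nth nth_tl\<close>)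
qed

lemma rev_highpoly: "rev (highpoly R (s - t) c) = JS_high R s t c"
  by (simp add: highpoly_def JS_high_def)

lemma JS_high_props:
  assumes "set c \<subseteq> carrier R"
  shows "JS_high R s t c \<in> carrier P" "set (highpoly R k c) \<subseteq> carrier R"
    "lp (highpoly R (s - t) c) = JS_high R s t c" "last (highpoly R k c) = \<one>"
proof -
  show 1: "JS_high R s t c \<in> carrier P" using assms by (auto simp: carrier_P_iff JS_high_def)
  show "set (highpoly R k c) \<subseteq> carrier R" using assms by (auto simp: highpoly_def)
  show "lp (highpoly R (s - t) c) = JS_high R s t c"
    by (simp add: lp_def rev_highpoly pol_polynomial[OF 1])
  show "last (highpoly R k c) = \<one>" by (simp add: highpoly_def)
qed

context
  fixes s t :: nat and w :: "'a set" and c :: "'a list"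
  assumes w: "w \<subseteq> carrier R" "card w = s" and c: "set c \<subseteq> carrier R" "length c = t" and ts: "t \<le> s"
begin

definition agree :: "'a list \<Rightarrow> 'a set" where
  "agree p = {a \<in> w. eval p a = eval (JS_high R s t c) a}"

lemma finite_w: "finite w"
  using w(1) fin finite_subset by blast

lemma finite_agree: "finite (agree p)"
  using finite_w by (simp add: agree_def)

lemma JS_low_iff:
  "JS_low R s t w c p \<longleftrightarrow> p \<in> carrier P \<and> length p \<le> s - t \<and> 2 * s \<le> 2 * card (agree p) + t"
  using ts by (cases p) (auto simp: JS_low_def agree_def)

text \<open>Two candidates agree in at least \<open>s - t\<close> points, which exceeds their degrees.\<close>

lemma JS_low_unique:
  assumes "JS_low R s t w c p" "JS_low R s t w c q"
  shows "p = q"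
proof -
  note p = assms(1)[unfolded JS_low_iff] and q = assms(2)[unfolded JS_low_iff]
  have "card (agree p \<union> agree q) \<le> s"
    using card_mono[OF finite_w, of "agree p \<union> agree q"] w(2) by (auto simp: agree_def)
  moreover have "card (agree p \<union> agree q) + card (agree p \<inter> agree q) = card (agree p) + card (agree q)"
    using card_Un_Int[OF finite_agree finite_agree] by simp
  ultimately have "s - t \<le> card (agree p \<inter> agree q)" using p q by linarith
  moreover have "length (p \<ominus>\<^bsub>P\<^esub> q) \<le> s - t" using length_P_minus_le p q by blast
  moreover have "agree p \<inter> agree q \<subseteq> zeros (p \<ominus>\<^bsub>P\<^esub> q)"
    using p q w(1) eval_P_closed[OF JS_high_props(1)[OF c(1)]]
    by (auto simp: agree_def zeros_def eval_P_minus subset_iff r_right_minus_eq)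
  ultimately have "p \<ominus>\<^bsub>P\<^esub> q = []"
    using poly_eq_zeroI[of "p \<ominus>\<^bsub>P\<^esub> q" "agree p \<inter> agree q"] p q by simp
  then show ?thesis using P_minus_cancel p q by blast
qed

text \<open>Uniqueness determines the value of the choice operator in \<open>JS_Rec\<close>.\<close>

lemma JS_Rec_Some:
  assumes "JS_low R s t w c p"
  shows "JS_Rec R s t w c = return_pmf (Some (zeros (JS_high R s t c \<ominus>\<^bsub>P\<^esub> p)))"
proof -
  have "(SOME p. JS_low R s t w c p) = p"
    using JS_low_unique assms by (intro some_equality)
  then show ?thesis using assms by (auto simp: JS_Rec_def zeros_def)
qed

end

text \<open>With \<open>v\<close> the second component, \<open>n - v p\<close> vanishes wherever
  \<open>p\<close> agrees with \<open>JS_high\<close>. Its length is at most \<open>D\<close>, hence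
  at most the number of these points, so it is zero.\<close>

lemma interp_low:
  assumes as: "distinct as" "set as \<subseteq> carrier R" "length as = s" and c: "set c \<subseteq> carrier R" "length c = t"
    and ts: "t \<le> s" and low: "JS_low R s t (set as) c p"
  defines "i \<equiv> interp R (s - t) (highpoly R (s - t) c) as"
  shows "lp (fst i) = lp (snd i) \<otimes>\<^bsub>P\<^esub> p" "lp (snd i) \<noteq> \<zero>\<^bsub>P\<^esub>"
    "set (fst i) \<subseteq> carrier R" "set (snd i) \<subseteq> carrier R" "length (snd i) \<le> Suc s"
proof -
  let ?h = "highpoly R (s - t) c" and ?A = "agree s t (set as) c p"
  have cw: "card (set as) = s" using as distinct_card by auto
  note p = low[unfolded JS_low_iff[OF as(2) cw c ts]]
  note h = JS_high_props[OF c(1)]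
  obtain D where D: "kbound (s - t) D i" "2 * D \<le> s - t + 1 + length as"
    "\<And>x. x \<in> set as \<Longrightarrow> discrep R x (lev R x ?h) i = \<zero>"
    "lp (fst i) = \<zero>\<^bsub>P\<^esub> \<Longrightarrow> lp (snd i) \<noteq> \<zero>\<^bsub>P\<^esub>"
    using interp_props[OF h(2) as(2)] unfolding i_def by blast
  show s: "set (fst i) \<subseteq> carrier R" "set (snd i) \<subseteq> carrier R" using D(1) by (auto simp: kbound_def)
  show "length (snd i) \<le> Suc s"
    using length_interp(2)[of R "s - t" ?h as] as(3) by (simp add: i_def)
  define n where "n = lp (fst i)"
  define v where "v = lp (snd i)"
  have nv: "n \<in> carrier P" "v \<in> carrier P" using s by (simp_all add: n_def v_def)
  have ln: "length n \<le> D" using D(1) length_lp[of "fst i"] by (simp add: n_def kbound_def)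
  have lvp: "length (v \<otimes>\<^bsub>P\<^esub> p) \<le> D"
  proof (cases "v = [] \<or> p = []")
    case True
    then have "v \<otimes>\<^bsub>P\<^esub> p = \<zero>\<^bsub>P\<^esub>" using nv p by (auto simp flip: univ_poly_zero[of R "carrier R"])
    then show ?thesis by (simp add: univ_poly_zero)
  next
    case False
    then have "snd i \<noteq> []" by (auto simp: v_def univ_poly_zero)
    then have "length v + (s - t) \<le> Suc D"
      using D(1) length_lp[of "snd i"] by (simp add: v_def kbound_def)
    then show ?thesis using P_mult(2)[OF nv(2), of p] p False by simp
  qed
  have "?A \<subseteq> zeros (n \<ominus>\<^bsub>P\<^esub> v \<otimes>\<^bsub>P\<^esub> p)"
  proof
    fix a assume a: "a \<in> ?A"
    then have a': "a \<in> set as" "a \<in> carrier R" "eval p a = eval (JS_high R s t c) a"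
      using as(2) by (auto simp: agree_def[OF as(2) cw c ts])
    have "lev R a ?h = eval p a" using a' h(2,3) by (simp add: lev_eq)
    then have e0: "eval n a \<oplus> \<ominus> (eval p a \<otimes> eval v a) = \<zero>"
      using D(3)[OF a'(1)] s a' by (simp add: discrep_def lev_eq n_def v_def)
    show "a \<in> zeros (n \<ominus>\<^bsub>P\<^esub> v \<otimes>\<^bsub>P\<^esub> p)"
    proof -
      have "eval (n \<ominus>\<^bsub>P\<^esub> v \<otimes>\<^bsub>P\<^esub> p) a = eval n a \<ominus> eval v a \<otimes> eval p a"
        using a' nv p by (simp add: eval_P_minus eval_P_mult)
      with e0 show ?thesis
        using a' nv p eval_P_closed[of v a] eval_P_closed[of p a] by (simp add: zeros_def a_minus_def m_comm)
    qed
  qed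
  moreover have "length (n \<ominus>\<^bsub>P\<^esub> v \<otimes>\<^bsub>P\<^esub> p) \<le> card ?A"
  proof -
    have "length (n \<ominus>\<^bsub>P\<^esub> v \<otimes>\<^bsub>P\<^esub> p) \<le> D" using length_P_minus_le[OF _ _ ln lvp] nv p P.m_closed by blast
    \<comment> \<open>Here 2 D <= 2 s - t + 1 and 2 s - t <= 2 card ?A; since D and the cardinality
      are integers, the surplus 1 is harmless.\<close>
    moreover have "D \<le> card ?A" using D(2) p as(3) ts by linarith
    ultimately show ?thesis by simp
  qed
  moreover have "n \<ominus>\<^bsub>P\<^esub> v \<otimes>\<^bsub>P\<^esub> p \<in> carrier P" using nv p P.minus_closed P.m_closed by blast
  ultimately have "n \<ominus>\<^bsub>P\<^esub> v \<otimes>\<^bsub>P\<^esub> p = []" using poly_eq_zeroI by blast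
  then have eq: "n = v \<otimes>\<^bsub>P\<^esub> p" using P_minus_cancel nv p P.m_closed by blast
  then show "lp (fst i) = lp (snd i) \<otimes>\<^bsub>P\<^esub> p" by (simp add: n_def v_def)
  \<comment> \<open>If the second component vanished, so would the first, being a multiple of
    it.\<close>
  show "lp (snd i) \<noteq> \<zero>\<^bsub>P\<^esub>" using D(4) eq p by (auto simp: n_def v_def)
qed

text \<open>Whatever \<open>u\<close> the division yields, \<open>check\<close> decides whether it
  is a solution. If a solution exists, \<open>u\<close> equals it; hence a failed check refutes
  existence.\<close>

lemma decode_spec:
  assumes as: "distinct as" "set as \<subseteq> carrier R" "length as = s" and c: "set c \<subseteq> carrier R" "length c = t"
    and ts: "1 \<le> t" "t \<le> s" and N: "Suc s \<le> N"
  shows "case decode R N t as c of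
      None \<Rightarrow> \<forall>p. \<not> JS_low R s t (set as) c p
    | Some f \<Rightarrow> modulus s f \<and> (\<exists>p. JS_low R s t (set as) c p \<and> f = JS_high R s t c \<ominus>\<^bsub>P\<^esub> p)"
proof -
  let ?k = "s - t"
  let ?h = "highpoly R ?k c"
  define i where "i = interp R ?k ?h as"
  define u where "u = psdiv R ?k ((strip_step R ^^ N) i)"
  define f where "f = axpy R \<one> u ?h"
  have cw: "card (set as) = s" using as distinct_card by auto
  note low_iff = JS_low_iff[OF as(2) cw c ts(2)] and ag = agree_def[OF as(2) cw c ts(2)]
  note h = JS_high_props[OF c(1)]
  have dec: "decode R N t as c = (if check R t f as = 0 then None else Some (rev f))"
    by (simp add: decode_def Let_def as(3) f_def u_def i_def)
  have iset: "set (fst i) \<subseteq> carrier R" "set (snd i) \<subseteq> carrier R"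
    using interp_props[OF h(2) as(2), of ?k] unfolding i_def kbound_def by blast+
  have u: "set u \<subseteq> carrier R" "length u = ?k"
    using psdiv_closed strip_props[OF iset] by (simp_all add: u_def)
  have f: "set f \<subseteq> carrier R" "length f = Suc s" "last f = \<one>" "lp f = JS_high R s t c \<ominus>\<^bsub>P\<^esub> lp u"
    using axpy_closed[OF one_closed u(1) h(2)[of ?k]] u c(2) ts h(4) lp_axpy[OF one_closed u(1) h(2)[of ?k]] h(3)[of s t]
    by (simp_all add: f_def last_axpy)
  have rf: "rev f \<in> carrier P" using f(1-3) by (auto simp: carrier_P_iff hd_rev)
  have lpf: "lp f = rev f" by (simp add: lp_def pol_polynomial[OF rf])
  let ?A = "agree s t (set as) c (lp u)"
  have "lev R a f = \<zero> \<longleftrightarrow> eval (lp u) a = eval (JS_high R s t c) a" if "a \<in> set as" for a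
  proof -
    have a: "a \<in> carrier R" using that as(2) by auto
    have "lev R a f = eval (JS_high R s t c) a \<ominus> eval (lp u) a"
      using a f(1) u(1) h(1) by (simp add: lev_eq f(4) eval_P_minus)
    then show ?thesis
      using r_right_minus_eq[of "eval (JS_high R s t c) a" "eval (lp u) a"] a u(1) h(1) eval_P_closed by auto
  qed
  then have "?A = set (filter (\<lambda>a. lev R a f = \<zero>) as)" by (auto simp: ag)
  then have "card ?A = length (filter (\<lambda>a. lev R a f = \<zero>) as)"
    using distinct_card[OF distinct_filter[OF as(1)]] by (simp only:)
  then have "card ?A + length (filter (\<lambda>a. lev R a f \<noteq> \<zero>) as) = s"
    using sum_length_filter_compl[of "\<lambda>a. lev R a f = \<zero>" as] as(3) by simp
  then have "check R t f as = 0 \<longleftrightarrow> \<not> 2 * s \<le> 2 * card ?A + t"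
    unfolding check_def by linarith
  then have check: "check R t f as = 0 \<longleftrightarrow> \<not> JS_low R s t (set as) c (lp u)"
    using u length_lp[of u] by (simp add: low_iff)
  have lpu: "lp u = p" if p: "JS_low R s t (set as) c p" for p
  proof -
    note il = interp_low[OF as c ts(2) p, folded i_def]
    have pc: "p \<in> carrier P" "length p \<le> ?k" using p by (simp_all add: low_iff)
    obtain n' w' where nw: "(strip_step R ^^ N) (fst i, snd i) = (n', w')"
      "lp n' = lp w' \<otimes>\<^bsub>P\<^esub> p" "w' \<noteq> []" "hd w' \<noteq> \<zero>"
      using strip_quotient[OF iset pc(1) il(1,2), of N] il(5) N by auto
    then have e: "(strip_step R ^^ N) i = (n', w')" by simp
    have nws: "set n' \<subseteq> carrier R" "set w' \<subseteq> carrier R" using strip_props[OF iset, of N] e by simp_all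
    \<comment> \<open>\<open>psdiv\<close> returns exactly \<open>s - t\<close> coefficients, so
      \<open>p\<close> is padded with zeros to this length.\<close>
    define q where "q = rev p @ replicate (?k - length p) \<zero>"
    have q: "set q \<subseteq> carrier R" "length q = ?k" "lp q = p"
      using pc P_set[OF pc(1)] by (auto simp: q_def lp_def pol_zeros_append pol_polynomial)
    then show ?thesis
      using psdiv_quotient[OF nws nw(3,4) q(1)] nw(2) by (simp add: u_def e)
  qed
  show ?thesis
  proof (cases "check R t f as = 0")
    case True
    then show ?thesis using dec check lpu by auto
  next
    case False
    have "modulus s (rev f)" using rf f(2) ts by (simp add: modulus_def)
    then show ?thesis using False dec check f(4) lpf by auto
  qed
qed

lemma JS_Rec_eq:
  assumes as: "distinct as" "set as \<subseteq> carrier R" "length as = s" and c: "set c \<subseteq> carrier R" "length c = t"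
    and ts: "1 \<le> t" "t \<le> s" and N: "Suc s \<le> N"
  shows "JS_Rec R s t (set as) c = return_pmf (map_option zeros (decode R N t as c))"
proof -
  have cw: "card (set as) = s" using as distinct_card by auto
  note d = decode_spec[OF assms]
  show ?thesis
  proof (cases "decode R N t as c")
    case None
    then show ?thesis using d by (simp add: JS_Rec_def)
  next
    case (Some f)
    then show ?thesis using d JS_Rec_Some[OF as(2) cw c ts(2)] by auto
  qed
qed

text \<open>The negated lower part of \<open>JS_poly R w\<close> is a solution: subtracting it from
  the high part gives \<open>JS_poly R w\<close>, which vanishes on \<open>w \<inter> w'\<close>, so
  the two parts agree there.\<close>

lemma JS_correct:
  assumes w: "w \<in> SDif R s" "w' \<in> SDif R s" "set_dist w w' \<le> t" and ts: "1 \<le> t" "t \<le> s"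
    and c: "c \<in> set_pmf (JS_SS R s t w)"
  shows "JS_Rec R s t w' c = return_pmf (Some w)"
proof -
  have ws: "w \<subseteq> carrier R" "card w = s" "w' \<subseteq> carrier R" "card w' = s" using w by (simp_all add: SDif_def)
  have fw: "finite w" "finite w'" using ws fin finite_subset by blast+
  then obtain as where as: "set as = w" "distinct as" using finite_distinct_list by blast
  have las: "length as = s" using distinct_card[OF as(2)] as(1) ws by simp
  have as': "set as \<subseteq> carrier R" using as ws by simp
  note rp = rootpoly_props[OF as(2) as', unfolded as(1) las]
  have len: "length (JS_poly R w) = Suc s" using rp(1,2) by (metis length_rev)
  define M where "M = tl (JS_poly R w)"
  have J: "JS_poly R w = \<one> # M" using rp(3) len by (cases "JS_poly R w") (auto simp: M_def)
  have M: "set M \<subseteq> carrier R" "length M = s" using P_set[OF rp(4)] len by (simp_all add: J)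
  have cM: "c = take t M"
    using c JS_SS_eq[OF as(2) as', of t] ts las by (simp add: JS_SS_def as(1) rp(1) M_def)
  have cc: "set c \<subseteq> carrier R" "length c = t"
    using M ts set_take_subset[of t M] by (auto simp: cM)
  note h = JS_high_props(1)[OF cc(1), of s t]
  have dM: "set (drop t M) \<subseteq> carrier R" using M(1) set_drop_subset[of t M] by blast
  have "JS_poly R w = pol (\<one> # take t M @ drop t M)" using rp(4) J by (simp add: pol_polynomial)
  also have "\<dots> = pol (JS_high R s t c) \<oplus>\<^bsub>P\<^esub> pol (drop t M)"
    using pol_append[of "\<one> # take t M" "drop t M"] dM cc M(2) by (simp add: JS_high_def cM)
  finally have Jeq: "JS_poly R w = JS_high R s t c \<oplus>\<^bsub>P\<^esub> pol (drop t M)"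
    using h by (simp add: pol_polynomial)
  define p where "p = \<ominus>\<^bsub>P\<^esub> pol (drop t M)"
  have p: "p \<in> carrier P" "length p \<le> s - t"
    using dM length_pol[of "drop t M"] M(2) univ_poly_a_inv_length[OF sr, of "pol (drop t M)"]
    by (simp_all add: p_def)
  have Jp: "JS_high R s t c \<ominus>\<^bsub>P\<^esub> p = JS_poly R w"
    using dM by (simp add: Jeq p_def a_minus_def)
  have "w \<inter> w' \<subseteq> agree s t w' c p"
  proof
    fix a assume a: "a \<in> w \<inter> w'"
    then have ac: "a \<in> carrier R" using ws by auto
    have "eval (JS_high R s t c) a \<ominus> eval p a = \<zero>"
      using a zerosD(2)[of a "JS_poly R w"] zeros_JS_poly[OF ws(1)]
      by (simp add: Jp flip: eval_P_minus[OF h p(1) ac])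
    then show "a \<in> agree s t w' c p"
      using a r_right_minus_eq[OF eval_P_closed[OF h ac] eval_P_closed[OF p(1) ac]]
      by (auto simp: agree_def[OF ws(3,4) cc ts(2)])
  qed
  then have "card (w \<inter> w') \<le> card (agree s t w' c p)"
    by (intro card_mono finite_agree[OF ws(3,4) cc ts(2)])
  \<comment> \<open>Both differences have the same size, so twice the intersection has
    \<open>2 * s - set_dist w w'\<close> elements.\<close>
  moreover have "card (w - w') + card (w \<inter> w') = s" "card (w' - w) + card (w \<inter> w') = s"
    using card_Diff_subset_Int[of w w'] card_Diff_subset_Int[of w' w] fw ws
      card_mono[of w "w \<inter> w'"] card_mono[of w' "w \<inter> w'"] by (auto simp: Int_commute)
  moreover have "card (w - w') + card (w' - w) = set_dist w w'"
    unfolding set_dist_def using fw by (subst card_Un_disjoint) auto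
  ultimately have "2 * s \<le> 2 * card (agree s t w' c p) + t" using w(3) by linarith
  then have "JS_low R s t w' c p"
    using p by (simp add: JS_low_iff[OF ws(3,4) cc ts(2)])
  then show ?thesis
    using JS_Rec_Some[OF ws(3,4) cc ts(2)] Jp zeros_JS_poly[OF ws(1)] by simp
qed

end


section \<open>Effect of a revealed sketch on the average guessing probability\<close>

section \<open>Entropy loss\<close>

text \<open>The point is P(b) max P(a | b) = max P(a, b), valid also outside the support of the
  second component, where both sides are zero.\<close>

lemma pmf_quotient_SUP:
  fixes p :: "('a \<times> 'b) pmf"
  shows "bdd_above (range (\<lambda>a. pmf p (a, b)))" "0 \<le> (SUP a. pmf p (a, b))"
    "pmf p (a, b) \<le> (SUP a. pmf p (a, b))"
    "pmf (map_pmf snd p) b * (SUP a. pmf p (a, b) / pmf (map_pmf snd p) b) = (SUP a. pmf p (a, b))"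
    "0 \<le> (SUP a. pmf p (a, b) / pmf (map_pmf snd p) b)"
    "(SUP a. pmf p (a, b) / pmf (map_pmf snd p) b) \<le> 1"
proof -
  let ?q = "pmf (map_pmf snd p) b"
  show bdd: "bdd_above (range (\<lambda>a. pmf p (a, b)))"
    by (rule bdd_aboveI[of _ 1]) (auto simp: pmf_le_1)
  show le: "pmf p (a, b) \<le> (SUP a. pmf p (a, b))" for a
    by (rule cSUP_upper[OF UNIV_I bdd])
  show "0 \<le> (SUP a. pmf p (a, b))" by (rule order_trans[OF pmf_nonneg le])
  have leq: "pmf p (a, b) \<le> ?q" for a
  proof -
    have "pmf p (a, b) = measure (measure_pmf p) {(a, b)}" by (simp add: measure_pmf_single)
    also have "\<dots> \<le> measure (measure_pmf p) (snd -` {b})" by (rule measure_pmf.finite_measure_mono) auto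
    also have "\<dots> = ?q" by (simp add: pmf_map)
    finally show ?thesis .
  qed
  have d1: "pmf p (a, b) / ?q \<le> 1" for a
    using leq[of a] by (auto simp: divide_le_eq_1 less_le)
  have bdd': "bdd_above (range (\<lambda>a. pmf p (a, b) / ?q))"
    by (rule bdd_aboveI[of _ 1]) (use d1 in auto)
  show "(SUP a. pmf p (a, b) / ?q) \<le> 1" by (rule cSUP_least) (use d1 in auto)
  show "0 \<le> (SUP a. pmf p (a, b) / ?q)"
    by (rule order_trans[OF _ cSUP_upper[OF UNIV_I bdd', of undefined]]) simp
  show "?q * (SUP a. pmf p (a, b) / ?q) = (SUP a. pmf p (a, b))"
  proof (cases "?q = 0")
    case True
    then have "pmf p (a, b) = 0" for a using leq[of a] pmf_nonneg[of p "(a, b)"] by simp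
    then show ?thesis by simp
  next
    case False
    then have q: "?q > 0" using pmf_nonneg[of "map_pmf snd p" b] by linarith
    show ?thesis
    proof (rule antisym)
      have "(SUP a. pmf p (a, b) / ?q) \<le> (SUP a. pmf p (a, b)) / ?q"
        by (rule cSUP_least) (use q le in \<open>auto intro: divide_right_mono\<close>)
      then show "?q * (SUP a. pmf p (a, b) / ?q) \<le> (SUP a. pmf p (a, b))"
        using q by (simp add: field_simps)
      show "(SUP a. pmf p (a, b)) \<le> ?q * (SUP a. pmf p (a, b) / ?q)"
      proof (rule cSUP_least)
        fix a
        have "pmf p (a, b) / ?q \<le> (SUP a. pmf p (a, b) / ?q)" by (rule cSUP_upper[OF UNIV_I bdd'])
        then show "pmf p (a, b) \<le> ?q * (SUP a. pmf p (a, b) / ?q)" using q by (simp add: field_simps)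
      qed simp
    qed
  qed
qed

text \<open>The argument of the logarithm in the average min-entropy.\<close>

definition guess :: "('a \<times> 'b) pmf \<Rightarrow> ennreal" where
  "guess p = (\<integral>\<^sup>+ b. ennreal (SUP a. pmf p (a, b)) \<partial>count_space UNIV)"

text \<open>Some pair has positive probability, so the argument of the logarithm is positive and the
  logarithm monotone there.\<close>

lemma avg_min_entropy_guess:
  fixes p :: "('a \<times> 'b) pmf"
  obtains e where "guess p = ennreal e" "e > 0" "avg_min_entropy p = - log 2 e"
proof -
  let ?f = "\<lambda>b. SUP a. pmf p (a, b) / pmf (map_pmf snd p) b"
  define e where "e = measure_pmf.expectation (map_pmf snd p) ?f"
  have "integrable (map_pmf snd p) ?f"
    by (rule measure_pmf.integrable_const_bound[where B = 1])
       (use pmf_quotient_SUP(5,6)[of p] in auto)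
  then have "ennreal e = (\<integral>\<^sup>+ b. ennreal (?f b) \<partial>map_pmf snd p)"
    unfolding e_def by (intro nn_integral_eq_integral[symmetric]) (use pmf_quotient_SUP(5)[of p] in auto)
  also have "\<dots> = (\<integral>\<^sup>+ b. ennreal (pmf (map_pmf snd p) b) * ennreal (?f b) \<partial>count_space UNIV)"
    by (rule nn_integral_measure_pmf)
  also have "\<dots> = guess p"
    unfolding guess_def using pmf_quotient_SUP(4,5)[of p]
    by (intro nn_integral_cong) (simp flip: ennreal_mult)
  finally have g: "guess p = ennreal e" by simp
  obtain a b where ab: "(a, b) \<in> set_pmf p" using set_pmf_not_empty[of p] by (metis ex_in_conv surj_pair)
  have "0 < ennreal (pmf p (a, b))" using ab by (simp add: pmf_positive_iff)
  also have "\<dots> \<le> ennreal (SUP a. pmf p (a, b))" by (intro ennreal_leI pmf_quotient_SUP(3))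
  also have "\<dots> \<le> guess p" unfolding guess_def by (rule nn_integral_ge_point) simp
  finally have "e > 0" by (simp add: g)
  then show ?thesis using that[of e] g by (simp add: avg_min_entropy_def e_def)
qed

text \<open>For fixed \<open>i\<close>, each value \<open>c\<close> in \<open>C\<close> contributes
  at most the maximum of \<open>joint\<close> over w, since the new probability at (w, (c, i)) is
  either the old one at (w, i) or zero.\<close>

lemma guess_sketch:
  fixes joint :: "('w \<times> 'i) pmf" and f :: "'w \<Rightarrow> 'c"
  assumes "finite C" "\<And>w i. (w, i) \<in> set_pmf joint \<Longrightarrow> f w \<in> C"
  shows "guess (map_pmf (\<lambda>(w, i). (w, (f w, i))) joint) \<le> of_nat (card C) * guess joint"
proof -
  let ?h = "\<lambda>(w, i). (w, (f w, i))"
  let ?p = "map_pmf ?h joint"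
  have inj: "inj ?h" by (auto simp: inj_def)
  have p: "pmf ?p (w, (c, i)) \<le> indicator C c * pmf joint (w, i)" for w c i
  proof (cases "f w = c")
    case True
    have "pmf ?p (w, (c, i)) = pmf joint (w, i)"
      using pmf_map_inj'[OF inj, of joint "(w, i)"] True by simp
    then show ?thesis using assms(2)[of w i] True by (cases "(w, i) \<in> set_pmf joint") (auto simp: set_pmf_iff)
  next
    case False
    then have "(w, (c, i)) \<notin> set_pmf ?p" by auto
    then have "pmf ?p (w, (c, i)) = 0" by (rule pmf_eq_0_set_pmf[THEN iffD2])
    then show ?thesis by (simp add: indicator_def)
  qed
  have "guess ?p = (\<integral>\<^sup>+ c. \<integral>\<^sup>+ i. ennreal (SUP w. pmf ?p (w, (c, i))) \<partial>count_space UNIV \<partial>count_space UNIV)"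
    unfolding guess_def by (rule nn_integral_fst_count_space[symmetric])
  also have "\<dots> \<le> (\<integral>\<^sup>+ c. \<integral>\<^sup>+ i. indicator C c * ennreal (SUP w. pmf joint (w, i))
      \<partial>count_space UNIV \<partial>count_space UNIV)"
  proof (intro nn_integral_mono)
    fix c :: 'c and i :: 'i
    have "(SUP w. pmf ?p (w, (c, i))) \<le> indicator C c * (SUP w. pmf joint (w, i))"
    proof (rule cSUP_least)
      fix w
      have "indicator C c * pmf joint (w, i) \<le> indicator C c * (SUP w. pmf joint (w, i))"
        by (intro mult_left_mono pmf_quotient_SUP(3)) simp
      then show "pmf ?p (w, (c, i)) \<le> indicator C c * (SUP w. pmf joint (w, i))"
        using p[of w c i] by linarith
    qed simp
    then show "ennreal (SUP w. pmf ?p (w, (c, i))) \<le> indicator C c * ennreal (SUP w. pmf joint (w, i))"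
      by (auto simp: indicator_def ennreal_leI ennreal_neg split: if_splits)
  qed
  also have "\<dots> = (\<integral>\<^sup>+ c. indicator C c * guess joint \<partial>count_space UNIV)"
    by (simp add: nn_integral_cmult guess_def)
  also have "\<dots> = of_nat (card C) * guess joint"
    using assms(1) by (simp add: nn_integral_multc emeasure_count_space_finite)
  finally show ?thesis .
qed

lemma avg_min_entropy_sketch:
  fixes joint :: "('w \<times> 'i) pmf" and f :: "'w \<Rightarrow> 'c"
  assumes "finite C" "\<And>w i. (w, i) \<in> set_pmf joint \<Longrightarrow> f w \<in> C"
  shows "avg_min_entropy joint - log 2 (card C) \<le>
    avg_min_entropy (bind_pmf joint (\<lambda>(w, i). map_pmf (\<lambda>c. (w, (c, i))) (return_pmf (f w))))"
proof -
  let ?p = "map_pmf (\<lambda>(w, i). (w, (f w, i))) joint"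
  have eq: "bind_pmf joint (\<lambda>(w, i). map_pmf (\<lambda>c. (w, (c, i))) (return_pmf (f w))) = ?p"
    by (simp add: map_pmf_def split_def bind_return_pmf)
  obtain e where e: "guess joint = ennreal e" "e > 0" "avg_min_entropy joint = - log 2 e"
    by (rule avg_min_entropy_guess)
  obtain e' where e': "guess ?p = ennreal e'" "e' > 0" "avg_min_entropy ?p = - log 2 e'"
    by (rule avg_min_entropy_guess)
  have "guess ?p \<le> of_nat (card C) * guess joint"
    by (rule guess_sketch[OF assms(1)]) (rule assms(2))
  then have "ennreal e' \<le> ennreal (real (card C) * e)"
    using e(1,2) e'(1) by (simp add: ennreal_mult ennreal_of_nat_eq_real_of_nat)
  then have le: "e' \<le> real (card C) * e" using e(2) by (simp add: ennreal_le_iff)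
  have "card C > 0"
    using assms set_pmf_not_empty[of joint] by (metis card_gt_0_iff empty_iff ex_in_conv surj_pair)
  have "log 2 e' \<le> log 2 (real (card C) * e)" using le e'(2) by (intro log_le_cancel_iff[THEN iffD2]) auto
  also have "\<dots> = log 2 (card C) + log 2 e" using \<open>card C > 0\<close> e(2) by (simp add: log_mult)
  finally show ?thesis using e(3) e'(3) eq by simp
qed


section \<open>The complete programs, with time bounds polynomial in s, t and log n\<close>

section \<open>Implementation and running time\<close>

definition grow :: "exp \<Rightarrow> com" where
  "grow e = Seq (Assign 4 e)
     (While (Var 4) (Seq (Assign 1 (Pair_Exp Nil_Exp (Var 1))) (Assign 4 (Tl (Var 4)))))"

lemma grow_runs_to:
  assumes "eval_exp R e \<tau> = val_list vs" "\<tau> 1 = val_list us" "4 + exp_cost (field_cost R) e + 9 * length vs \<le> B"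
  shows "runs_to R (grow e) \<tau>
    (\<lambda>\<tau>'. \<tau>' 0 = \<tau> 0 \<and> (\<exists>us'. \<tau>' 1 = val_list us' \<and> length us' = length us + length vs)) B"
proof -
  define J where "J = (\<lambda>i (\<tau>' :: nat \<Rightarrow> 'a val). \<tau>' 0 = \<tau> 0 \<and> (\<exists>us'. \<tau>' 1 = val_list us' \<and> length us' + i = length us + length vs) \<and>
     (\<exists>vs' :: 'a val list. \<tau>' 4 = val_list vs' \<and> length vs' = i))"
  have "runs_to R (grow e) \<tau> (J 0) B"
    unfolding grow_def
  proof (rule runs_to_Seq[where Q = "J (length vs)" and b = "1 + exp_cost (field_cost R) e"
        and b' = "2 + length vs * 9"])
    show "runs_to R (Assign 4 e) \<tau> (J (length vs)) (1 + exp_cost (field_cost R) e)"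
      using assms(1,2) by (auto intro!: runs_to_Assign simp: J_def)
    fix \<tau>' :: "nat \<Rightarrow> 'a val" assume "J (length vs) \<tau>'"
    then show "runs_to R (While (Var 4) (Seq (Assign 1 (Pair_Exp Nil_Exp (Var 1))) (Assign 4 (Tl (Var 4)))))
        \<tau>' (J 0) (2 + length vs * 9)"
    proof (rule runs_to_While[where b = 7, rotated 2])
      fix i \<tau>1 assume J: "J (Suc i) \<tau>1"
      then obtain v vs' where v: "\<tau>1 4 = val_list (v # vs')" "length vs' = i"
        by (auto simp: J_def length_Suc_conv)
      obtain us' where us': "\<tau>1 1 = val_list us'" "length us' + Suc i = length us + length vs"
        using J by (auto simp: J_def)
      let ?\<tau>2 = "\<tau>1(1 := VPair VNil (\<tau>1 1), 4 := val_list vs')"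
      have "?\<tau>2 1 = val_list (VNil # us') \<and> length (VNil # us') + i = length us + length vs"
        using us' by simp
      moreover have "?\<tau>2 4 = val_list vs' \<and> length vs' = i" "?\<tau>2 0 = \<tau> 0"
        using v J by (simp_all add: J_def)
      ultimately have J2: "J i ?\<tau>2" unfolding J_def by blast
      have "runs_to R (Seq (Assign 1 (Pair_Exp Nil_Exp (Var 1))) (Assign 4 (Tl (Var 4)))) \<tau>1 (J i) 7"
        by (rule runs_to_Seq[where b = 4 and b' = 3 and Q = "\<lambda>\<tau>2. \<tau>2 = \<tau>1(1 := VPair VNil (\<tau>1 1))"])
           (use J2 v in \<open>auto intro!: runs_to_Assign\<close>)
      then show "eval_exp R (Var 4) \<tau>1 \<noteq> VNil \<and>
         runs_to R (Seq (Assign 1 (Pair_Exp Nil_Exp (Var 1))) (Assign 4 (Tl (Var 4)))) \<tau>1 (J i) 7"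
        using v by simp
    qed (auto simp: J_def)
  qed (use assms(3) in simp)
  then show ?thesis by (rule runs_to_mono) (auto simp: J_def)
qed

text \<open>Builds the list of length N = 8 + s + number of bits of n. The eight spare cells cover
  constant slack such as \<open>5 \<le> N\<close> for the greatest common divisor and
  \<open>length as + 2 \<le> N\<close> for decoding.\<close>

definition setup_loops :: "exp \<Rightarrow> com" where
  "setup_loops e = Seq (Assign 1 (((Pair_Exp Nil_Exp) ^^ 8) Nil_Exp)) (Seq (grow (Hd (Var 0))) (grow e))"

lemma exp_cost_Nils: "exp_cost \<kappa> (((Pair_Exp Nil_Exp) ^^ k) Nil_Exp) = 1 + 2 * k"
  by (induction k) simp_all

lemma eval_exp_Nils: "eval_exp R (((Pair_Exp Nil_Exp) ^^ k) Nil_Exp) \<sigma> = val_list (replicate k VNil)"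
  by (induction k) simp_all

lemma setup_loops_runs_to:
  assumes "v = VPair (elem_list as) v'" "\<And>\<tau>. \<tau> 0 = v \<Longrightarrow> eval_exp R e \<tau> = enc_bits bs"
  shows "runs_to R (setup_loops e) (init v)
    (\<lambda>\<tau>. \<tau> 0 = v \<and> (\<exists>us. \<tau> 1 = val_list us \<and> length us = 8 + length as + length bs))
    (40 + exp_cost (field_cost R) e + 9 * (8 + length as + length bs))"
  unfolding setup_loops_def
proof (rule runs_to_Seq[where b = 18 and Q = "\<lambda>\<tau>. \<tau> = (init v)(1 := val_list (replicate 8 VNil))"])
  show "runs_to R (Assign 1 (((Pair_Exp Nil_Exp) ^^ 8) Nil_Exp)) (init v)
      (\<lambda>\<tau>. \<tau> = (init v)(1 := val_list (replicate 8 VNil))) 18"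
    by (rule runs_to_Assign) (simp_all only: exp_cost_Nils eval_exp_Nils, simp?)
  fix \<tau> :: "nat \<Rightarrow> 'a val" assume \<tau>: "\<tau> = (init v)(1 := val_list (replicate 8 VNil))"
  show "runs_to R (Seq (grow (Hd (Var 0))) (grow e)) \<tau>
     (\<lambda>\<tau>. \<tau> 0 = v \<and> (\<exists>us. \<tau> 1 = val_list us \<and> length us = 8 + length as + length bs))
     (12 + exp_cost (field_cost R) e + 9 * (length as + length bs))"
  proof (rule runs_to_Seq[OF grow_runs_to[where vs = "map VElem as" and us = "replicate 8 VNil" and B = "6 + 9 * length as"]])
    fix \<tau>' :: "nat \<Rightarrow> 'a val" assume t: "\<tau>' 0 = \<tau> 0 \<and> (\<exists>us'. \<tau>' 1 = val_list us' \<and> length us' = length (replicate 8 VNil) + length (map VElem as))"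
    then obtain us' where us': "\<tau>' 1 = val_list us'" "length us' = 8 + length as" by auto
    show "runs_to R (grow e) \<tau>'
      (\<lambda>\<tau>. \<tau> 0 = v \<and> (\<exists>us. \<tau> 1 = val_list us \<and> length us = 8 + length as + length bs))
      (4 + exp_cost (field_cost R) e + 9 * length bs)"
      by (rule runs_to_mono[OF grow_runs_to[where vs = "map encb bs" and us = us']])
         (use t \<tau> us' assms(2)[of \<tau>'] in auto)
  qed (use \<tau> assms(1) in \<open>auto simp: elem_list_def\<close>)
qed simp


subsection \<open>From machine parameters to \<open>s\<close>, \<open>t\<close> and \<open>log n\<close>\<close>

definition poly_time :: "(nat \<Rightarrow> nat \<Rightarrow> nat) \<Rightarrow> real \<Rightarrow> nat \<Rightarrow> bool" where
  "poly_time f C d \<longleftrightarrow> (\<forall>s t n. 1 \<le> t \<and> t \<le> s \<and> 2 \<le> n \<longrightarrow>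
     real (f ((floorlog 2 n)\<^sup>2) (8 + s + length (nbits n))) \<le> C * (real s + real t + log 2 (real n)) ^ d)"

lemma length_nbits_le: "n \<ge> 1 \<Longrightarrow> real (length (nbits n)) \<le> 1 + log 2 (real n)"
proof (induction n rule: nbits.induct)
  case (1 n)
  show ?case
  proof (cases "n = 1")
    case True
    then show ?thesis by (simp add: nbits.simps[of "Suc 0"] nbits.simps[of 0])
  next
    case False
    then have "n div 2 \<ge> 1" "n \<ge> 2" using 1(2) by auto
    then have "real (length (nbits n)) \<le> 2 + log 2 (real (n div 2))"
      using 1 by (simp add: nbits.simps[of n])
    also have "\<dots> = 1 + log 2 (2 * real (n div 2))"
      using \<open>n div 2 \<ge> 1\<close> by (simp add: log_mult)
    also have "2 * real (n div 2) \<le> real n"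
      by (metis of_nat_le_iff of_nat_mult of_nat_numeral times_div_less_eq_dividend)
    then have "1 + log 2 (2 * real (n div 2)) \<le> 1 + log 2 (real n)"
      using \<open>n div 2 \<ge> 1\<close> by (intro add_left_mono log_le_cancel_iff[THEN iffD2]) auto
    finally show ?thesis .
  qed
qed

lemma poly_time_exists:
  assumes "poly_bounded f"
  obtains C d where "poly_time f C d"
proof -
  obtain C d where f: "\<And>\<kappa> N. f \<kappa> N \<le> C * (\<kappa> + N + 1) ^ d" using assms by (auto simp: poly_bounded_def)
  \<comment> \<open>With l = s + t + log n, the field cost is at most l^2 and N at most 4 l, so
    their sum plus one is at most 6 l^2. This explains \<open>6 ^ d\<close> and the exponent
    \<open>2 * d\<close>.\<close>
  have "real (f ((floorlog 2 n)\<^sup>2) (8 + s + length (nbits n)))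
      \<le> (real C * 6 ^ d) * (real s + real t + log 2 (real n)) ^ (2 * d)"
    if h: "1 \<le> t" "t \<le> s" "2 \<le> n" for s t n
  proof -
    define l where "l = real s + real t + log 2 (real n)"
    have log1: "log 2 (real n) \<ge> 1" using h(3) by simp
    have l: "l \<ge> 3" "1 + log 2 (real n) \<le> l" "real s + log 2 (real n) + 1 \<le> l"
      using of_nat_mono[OF h(1), where 'a = real] of_nat_mono[OF h(2), where 'a = real] log1
      unfolding l_def by simp_all
    have "real (floorlog 2 n) \<le> 1 + log 2 (real n)"
      using h(3) log1 by (simp add: floorlog_def)
    then have "(real (floorlog 2 n))\<^sup>2 \<le> l\<^sup>2" using l(2) by (intro power_mono) auto
    moreover have "real (8 + s + length (nbits n)) \<le> 4 * l"
      using length_nbits_le[of n] h l by simp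
    moreover have "4 * l + 1 \<le> 5 * l\<^sup>2"
    proof -
      have "l * 1 \<le> l * l" using l(1) by (intro mult_left_mono) auto
      then show ?thesis unfolding power2_eq_square using l(1) by linarith
    qed
    ultimately have b: "real ((floorlog 2 n)\<^sup>2 + (8 + s + length (nbits n)) + 1) \<le> 6 * l\<^sup>2"
      unfolding of_nat_add of_nat_power of_nat_1 by linarith
    have "real (f ((floorlog 2 n)\<^sup>2) (8 + s + length (nbits n)))
        \<le> real (C * ((floorlog 2 n)\<^sup>2 + (8 + s + length (nbits n)) + 1) ^ d)"
      by (rule of_nat_mono[OF f])
    also have "\<dots> = real C * real ((floorlog 2 n)\<^sup>2 + (8 + s + length (nbits n)) + 1) ^ d"
      by (simp only: of_nat_mult of_nat_power)
    also have "\<dots> \<le> real C * (6 * l\<^sup>2) ^ d"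
      by (intro mult_left_mono power_mono b) auto
    also have "\<dots> = (real C * 6 ^ d) * l ^ (2 * d)"
      by (simp add: power_mult_distrib power_mult)
    finally show ?thesis by (simp add: l_def)
  qed
  then show ?thesis using that[of "real C * 6 ^ d" "2 * d"] by (auto simp: poly_time_def)
qed


subsection \<open>Sketch generation\<close>

definition ss_prog :: com where
  "ss_prog = Seq (setup_loops (Hd (Tl (Tl (Var 0)))))
     (Call 0 (wrap (compile SKETCH)) (Pair_Exp (Var 1) (Var 0)))"

definition ss_time :: "nat \<Rightarrow> nat \<Rightarrow> nat" where
  "ss_time \<kappa> N = 60 + 9 * N + tbound \<kappa> N SKETCH"

lemma poly_bounded_ss_time: "poly_bounded ss_time"
  unfolding ss_time_def[abs_def] by (intro poly_bounded_intros poly_bounded_tbound)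

lemma ss_prog_runs_to:
  assumes "v = SS_input R t as"
  shows "runs_to R ss_prog (init v)
    (\<lambda>\<tau>. \<tau> 0 = call R (8 + length as + length (nbits (order R))) SKETCH v)
    (ss_time (field_cost R) (8 + length as + length (nbits (order R))))"
proof -
  let ?N = "8 + length as + length (nbits (order R))"
  obtain v' where v': "v = VPair (elem_list as) v'" using assms by (simp add: SS_input_def)
  have bits: "eval_exp R (Hd (Tl (Tl (Var 0)))) \<tau> = enc_bits (nbits (order R))" if "\<tau> 0 = v" for \<tau> :: "nat \<Rightarrow> 'a val"
    using that assms by (simp add: SS_input_def binary_eq_enc_bits)
  show ?thesis unfolding ss_prog_def
  proof (rule runs_to_Seq[OF setup_loops_runs_to[OF v' bits]])
    fix \<tau> :: "nat \<Rightarrow> 'a val" assume "\<tau> 0 = v \<and> (\<exists>us. \<tau> 1 = val_list us \<and> length us = ?N)"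
    then obtain us where us: "\<tau> 0 = v" "\<tau> 1 = val_list us" "length us = ?N" by blast
    show "runs_to R (Call 0 (wrap (compile SKETCH)) (Pair_Exp (Var 1) (Var 0))) \<tau>
       (\<lambda>\<tau>. \<tau> 0 = call R ?N SKETCH v) (13 + tbound (field_cost R) ?N SKETCH)"
      by (rule runs_to_Call[where b = "tbound (field_cost R) ?N SKETCH + 9"])
         (use call_runs_to[OF us(3), of R SKETCH v] us(1,2) in simp_all)
  qed (simp_all add: ss_time_def)
qed

lemma runs_to_run:
  assumes "runs_to R c (init v) (\<lambda>\<tau>. \<tau> 0 = u) b"
  shows "outputs R c v = return_spmf u" "expected_time R c v \<le> of_nat b"
proof -
  obtain \<tau> k where e: "exec R c (init v) = return_spmf (\<tau>, k)" "\<tau> 0 = u" "k \<le> b"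
    using assms by (auto simp: runs_to_def)
  then have r: "run R c v = return_spmf (u, k)" by (simp add: run_def)
  show "outputs R c v = return_spmf u" by (simp add: outputs_def r)
  show "expected_time R c v \<le> of_nat b"
    using e(3) by (simp add: expected_time_def r measure_spmf_return_spmf nn_integral_return)
qed

lemma poly_time_ennreal:
  assumes "poly_time f C d" "1 \<le> t" "t \<le> s" "2 \<le> n"
  shows "of_nat (f ((floorlog 2 n)\<^sup>2) (8 + s + length (nbits n)))
    \<le> ennreal (C * (real s + real t + log 2 (real n)) ^ d)"
  using assms unfolding poly_time_def ennreal_of_nat_eq_real_of_nat by (intro ennreal_leI) blast

lemma SS_poly_time: "SS_expected_poly_time (JS_SS :: 'a ring \<Rightarrow> _)"
proof -
  obtain C d where Cd: "poly_time ss_time C d" by (rule poly_time_exists[OF poly_bounded_ss_time])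
  have "outputs R ss_prog (SS_input R t as) = spmf_of_pmf (map_pmf elem_list (JS_SS R s t (set as))) \<and>
      expected_time R ss_prog (SS_input R t as) \<le> ennreal (C * (real s + real t + log 2 (real (order R))) ^ d)"
    if h: "field R" "finite (carrier R)" "1 \<le> t" "t \<le> s" "distinct as" "set as \<in> SDif R s"
    for R :: "'a ring" and s t as
  proof -
    interpret ff R using h(1,2) by (simp add: ff_def ff_axioms_def)
    have as: "set as \<subseteq> carrier R" "length as = s"
      using h(6) distinct_card[OF h(5)] by (simp_all add: SDif_def)
    note r = runs_to_run[OF ss_prog_runs_to[OF refl, of R t as]]
    have "call R (8 + length as + length bits) SKETCH (SS_input R t as)
       = elem_list (take t (tl (rev (rootpoly R as))))"
      using rootpoly_props(2)[OF h(5) as(1)] h(4) as(2) by (intro call_SKETCH) auto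
    also have "take t (tl (rev (rootpoly R as))) = map (\<lambda>j. coeff (JS_poly R (set as)) (s - 1 - j)) [0..<t]"
      using JS_SS_eq[OF h(5) as(1), of t] h(4) as(2) by simp
    finally have "outputs R ss_prog (SS_input R t as) = spmf_of_pmf (map_pmf elem_list (JS_SS R s t (set as)))"
      using r(1) by (simp add: JS_SS_def)
    moreover have "expected_time R ss_prog (SS_input R t as)
        \<le> ennreal (C * (real s + real t + log 2 (real (order R))) ^ d)"
      using order_trans[OF r(2)[unfolded field_cost_def] poly_time_ennreal[OF Cd h(3), of "length as" "order R"]]
        h(4) as(2) order_ge_2 by simp
    ultimately show ?thesis by blast
  qed
  then show ?thesis unfolding SS_expected_poly_time_def by blast
qed


subsection \<open>Recovery\<close>

definition split_body :: com where
  "split_body = Seq (Sample 4) (Call 3 (wrap (compile RSTEP))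
     (Pair_Exp (Var 1) (Pair_Exp (Var 4) (Pair_Exp (Hd (Tl (Tl (Tl (Var 0))))) (Var 3)))))"

definition rec_prog :: com where
  "rec_prog = Seq (Seq (setup_loops (Hd (Tl (Tl (Tl (Var 0))))))
     (Call 3 (wrap (compile RECINIT)) (Pair_Exp (Var 1) (Var 0))))
     (If (Var 3)
       (Seq (Assign 3 (Tl (Var 3)))
         (Seq (While (Hd (Var 3)) split_body)
           (Assign 0 (Pair_Exp Nil_Exp (Tl (Var 3))))))
       (Assign 0 Nil_Exp))"

lemma val_list_inject: "val_list vs = val_list vs' \<longleftrightarrow> vs = vs'"
proof (induction vs arbitrary: vs')
  case Nil
  then show ?case by (cases vs') auto
next
  case (Cons v vs)
  then show ?case by (cases vs') auto
qed

lemma elem_list_inject: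
  fixes as bs :: "'a list"
  shows "elem_list as = elem_list bs \<longleftrightarrow> as = bs"
proof -
  have "inj (VElem :: 'a \<Rightarrow> 'a val)" by (auto simp: inj_def)
  from inj_map_eq_map[OF this] show ?thesis by (simp add: elem_list_def val_list_inject)
qed

text \<open>Injectivity lets \<open>lpot\<close> decode the state from the store and read off its
  potential.\<close>

lemma inj_enc_rstate: "inj enc_rstate"
proof (rule injI)
  have "inj (elem_list :: 'a list \<Rightarrow> 'a val)" by (auto simp: inj_def elem_list_inject)
  from inj_map_eq_map[OF this]
  show "enc_rstate st = enc_rstate st' \<Longrightarrow> st = st'" for st st' :: "'a rstate"
    by (cases st; cases st') (simp add: val_list_inject elem_list_inject)
qed

definition split_cost :: "nat \<Rightarrow> nat \<Rightarrow> nat" where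
  "split_cost \<kappa> N = 30 + \<kappa> + tbound \<kappa> N RSTEP"

context ff
begin

definition stepped :: "nat \<Rightarrow> (nat \<Rightarrow> 'a val) \<Rightarrow> 'a \<Rightarrow> nat \<Rightarrow> 'a val" where
  "stepped N \<tau> a = \<tau>(4 := VElem a,
     3 := call R N RSTEP (VPair (VElem a) (VPair (val_hd (val_tl (val_tl (val_tl (\<tau> 0))))) (\<tau> 3))))"

lemma exec_split_body:
  assumes "\<tau> 1 = val_list us" "length us = N"
  shows "\<exists>k. (\<forall>a. k a \<le> split_cost (field_cost R) N) \<and>
    exec R split_body \<tau> = map_spmf (\<lambda>a. (stepped N \<tau> a, k a)) (spmf_of_set (carrier R))"
proof -
  let ?c = "Call 3 (wrap (compile RSTEP))
     (Pair_Exp (Var 1) (Pair_Exp (Var 4) (Pair_Exp (Hd (Tl (Tl (Tl (Var 0))))) (Var 3))))"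
  have "runs_to R ?c (\<tau>(4 := VElem a)) (\<lambda>\<tau>'. \<tau>' = stepped N \<tau> a) (25 + tbound (field_cost R) N RSTEP)" for a
  proof (rule runs_to_Call)
    show "runs_to R (wrap (compile RSTEP)) (init (eval_exp R (Pair_Exp (Var 1) (Pair_Exp (Var 4)
        (Pair_Exp (Hd (Tl (Tl (Tl (Var 0))))) (Var 3)))) (\<tau>(4 := VElem a))))
        (\<lambda>\<tau>'. (\<tau>(4 := VElem a))(3 := \<tau>' 0) = stepped N \<tau> a) (tbound (field_cost R) N RSTEP + 9)"
      using assms(1) by (auto simp: stepped_def intro!: runs_to_mono[OF call_runs_to[OF assms(2)]])
  qed simp
  then have "\<forall>a. \<exists>k. exec R ?c (\<tau>(4 := VElem a)) = return_spmf (stepped N \<tau> a, k) \<and>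
      k \<le> 25 + tbound (field_cost R) N RSTEP"
    by (auto simp: runs_to_def)
  then obtain k where k: "\<And>a. exec R ?c (\<tau>(4 := VElem a)) = return_spmf (stepped N \<tau> a, k a)"
    "\<And>a. k a \<le> 25 + tbound (field_cost R) N RSTEP" by metis
  have "exec R split_body \<tau> = map_spmf (\<lambda>a. (stepped N \<tau> a, 1 + field_cost R + k a)) (spmf_of_set (carrier R))"
    unfolding split_body_def exec.simps(4) exec.simps(3)
    by (simp add: bind_map_spmf o_def k(1) map_spmf_conv_bind_spmf del: exec.simps(7) One_nat_def)
  moreover have "1 + field_cost R + k a \<le> split_cost (field_cost R) N" for a
    using k(2)[of a] by (simp add: split_cost_def)
  ultimately show ?thesis by (intro exI[of _ "\<lambda>a. 1 + field_cost R + k a"]) blast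
qed

definition linv :: "nat \<Rightarrow> 'a val \<Rightarrow> 'a set \<Rightarrow> (nat \<Rightarrow> 'a val) \<Rightarrow> bool" where
  "linv N v W \<tau> \<longleftrightarrow> \<tau> 0 = v \<and> (\<exists>us. \<tau> 1 = val_list us \<and> length us = N) \<and>
     (\<exists>st. \<tau> 3 = enc_rstate st \<and> rinv N W st)"

definition lpot :: "(nat \<Rightarrow> 'a val) \<Rightarrow> nat" where
  "lpot \<tau> = rpot (the_inv enc_rstate (\<tau> 3))"

lemma lpot_eq: "\<tau> 3 = enc_rstate st \<Longrightarrow> lpot \<tau> = rpot st"
  by (simp add: lpot_def the_inv_f_f[OF inj_enc_rstate])

text \<open>A round draws one uniform element, so its probability of progress is the fraction of the
  elements counted in \<open>rstep_progress\<close>.\<close>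

lemma split_loop:
  assumes v: "val_hd (val_tl (val_tl (val_tl v))) = enc_bits bits"
    and N: "5 \<le> N" "length bits \<le> N"
  shows "progressing_loop (\<lambda>\<tau>. eval_exp R (Hd (Var 3)) \<tau> \<noteq> VNil) (exec R split_body)
    (linv N v W) lpot (split_cost (field_cost R) N)"
proof -
  have main: "\<exists>k g gs out. \<tau> 3 = enc_rstate (g # gs, out) \<and> rinv N W (g # gs, out) \<and>
      (\<forall>a. k a \<le> split_cost (field_cost R) N) \<and>
      exec R split_body \<tau> = map_spmf (\<lambda>a. (stepped N \<tau> a, k a)) (spmf_of_set (carrier R)) \<and>
      (\<forall>a. stepped N \<tau> a 3 = enc_rstate (rstep R N bits a (g # gs, out)))"
    if \<tau>: "linv N v W \<tau>" "eval_exp R (Hd (Var 3)) \<tau> \<noteq> VNil" for \<tau>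
  proof -
    obtain us st where us: "\<tau> 0 = v" "\<tau> 1 = val_list us" "length us = N" "\<tau> 3 = enc_rstate st" "rinv N W st"
      using \<tau>(1) by (auto simp: linv_def simp del: One_nat_def)
    obtain g gs out where st: "st = (g # gs, out)"
      using \<tau>(2) us(4) by (cases st; cases "fst st") auto
    have g: "sized N g" "tl g \<noteq> []"
      using us(5) by (cases g; auto simp: st rinv_def sized_def)+
    have "call R N RSTEP (VPair (VElem a) (VPair (enc_bits bits) (\<tau> 3))) = enc_rstate (rstep R N bits a (g # gs, out))" for a
      unfolding us(4) st using call_RSTEP[OF N(2) g(1) _ g(2)] N(1) by simp
    then have "stepped N \<tau> a 3 = enc_rstate (rstep R N bits a (g # gs, out))" for a
      by (simp add: stepped_def us(1) v)
    then show ?thesis using exec_split_body[of \<tau>, OF us(2,3)] us(4,5) st by blast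
  qed
  show ?thesis
  proof
    fix \<tau> assume \<tau>: "linv N v W \<tau>" "eval_exp R (Hd (Var 3)) \<tau> \<noteq> VNil"
    from main[OF \<tau>] obtain k g gs out where m: "\<tau> 3 = enc_rstate (g # gs, out)" "rinv N W (g # gs, out)"
      "\<And>a. k a \<le> split_cost (field_cost R) N"
      "exec R split_body \<tau> = map_spmf (\<lambda>a. (stepped N \<tau> a, k a)) (spmf_of_set (carrier R))"
      "\<And>a. stepped N \<tau> a 3 = enc_rstate (rstep R N bits a (g # gs, out))" by blast
    have l: "lpot \<tau> = rpot (g # gs, out)"
      "\<And>a. lpot (stepped N \<tau> a) = rpot (rstep R N bits a (g # gs, out))"
      using lpot_eq m(1,5) by blast+
    have ne: "carrier R \<noteq> {}" by auto
    show "lossless_spmf (exec R split_body \<tau>)"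
      using fin ne by (simp add: m(4))
    show "linv N v W \<tau>' \<and> lpot \<tau>' \<le> lpot \<tau> \<and> k' \<le> split_cost (field_cost R) N"
      if \<tau>': "(\<tau>', k') \<in> set_spmf (exec R split_body \<tau>)" for \<tau>' k'
    proof -
      obtain a where a: "a \<in> carrier R" "\<tau>' = stepped N \<tau> a" "k' = k a"
        using \<tau>' fin unfolding m(4) set_map_spmf set_spmf_of_set by (auto split: if_splits)
      have "stepped N \<tau> a 0 = \<tau> 0" "stepped N \<tau> a 1 = \<tau> 1" by (simp_all add: stepped_def)
      moreover have "rinv N W (rstep R N bits a (g # gs, out))"
        "rpot (rstep R N bits a (g # gs, out)) \<le> rpot (g # gs, out)"
        using rstep_inv[OF m(2) a(1) N(1)] by blast+
      ultimately show ?thesis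
        using \<tau>(1) m(3) l m(5)[of a] unfolding linv_def a(2,3) by metis
    qed
    let ?S = "{a \<in> carrier R. rpot (rstep R N bits a (g # gs, out)) < rpot (g # gs, out)}"
    have "measure (measure_spmf (exec R split_body \<tau>)) {y. lpot (fst y) < lpot \<tau>} = card ?S / order R"
      unfolding m(4) measure_map_spmf
      by (simp add: vimage_def l measure_spmf_of_set order_def Int_def del: rstep.simps)
    moreover have "1 / 3 \<le> real (card ?S) / real (order R)"
    proof -
      have "real (order R) \<le> 3 * real (card ?S)"
        using of_nat_mono[OF rstep_progress[OF m(2) N(1)], where 'a = real] by simp
      moreover have "real (order R) > 0" using order_ge_2 by simp
      ultimately show ?thesis by (simp only: le_divide_eq) simp
    qed
    ultimately show "1 / 3 \<le> measure (measure_spmf (exec R split_body \<tau>)) {y. lpot (fst y) < lpot \<tau>}"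
      by simp
  qed
qed

end

text \<open>The last summand is the potential part of \<open>cost_bound\<close>, with 3 for the loop
  test and at most \<open>2 * N\<close> for the initial potential.\<close>

definition rec_time :: "nat \<Rightarrow> nat \<Rightarrow> nat" where
  "rec_time \<kappa> N = 100 + 9 * N + tbound \<kappa> N RECINIT + 3 * (3 + split_cost \<kappa> N) * (2 * N)"

lemma poly_bounded_rec_time: "poly_bounded rec_time"
  unfolding rec_time_def[abs_def] split_cost_def by (intro poly_bounded_intros poly_bounded_tbound)

lemma nn_integral_add_const_spmf:
  assumes "lossless_spmf p"
  shows "(\<integral>\<^sup>+ y. of_nat (m + g y) \<partial>measure_spmf p) = of_nat m + (\<integral>\<^sup>+ y. of_nat (g y) \<partial>measure_spmf p)"
proof -
  have "emeasure (measure_spmf p) (space (measure_spmf p)) = 1"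
    using assms by (simp add: measure_spmf.emeasure_eq_measure lossless_spmf_def)
  then show ?thesis by (simp add: nn_integral_add del: space_measure_spmf)
qed

lemma rec_prog_correct:
  fixes R :: "'a ring"
  assumes h: "field R" "finite (carrier R)" "1 \<le> t" "t \<le> s" "distinct as" "set as \<in> SDif R s"
    "length c = t" "set c \<subseteq> carrier R"
  defines "v \<equiv> Rec_input R t as c" and "N \<equiv> 8 + s + length (nbits (order R))"
  shows "rel_spmf represents (outputs R rec_prog v) (spmf_of_pmf (JS_Rec R s t (set as) c)) \<and>
    expected_time R rec_prog v \<le> of_nat (rec_time (field_cost R) N)"
proof -
  interpret ff R using h(1,2) by (simp add: ff_def ff_axioms_def)
  have as: "set as \<subseteq> carrier R" "length as = s"
    using h(6) distinct_card[OF h(5)] by (simp_all add: SDif_def)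
  have rec: "JS_Rec R s t (set as) c = return_pmf (map_option zeros (decode R N t as c))"
    by (rule JS_Rec_eq[OF h(5) as(1,2) h(8,7,3,4)]) (simp add: N_def)
  obtain v' where v': "v = VPair (elem_list as) v'" by (simp add: v_def Rec_input_def)
  have bits: "eval_exp R (Hd (Tl (Tl (Tl (Var 0))))) \<tau> = enc_bits bits" if "\<tau> 0 = v" for \<tau> :: "nat \<Rightarrow> 'a val"
    using that by (simp add: v_def Rec_input_def binary_eq_enc_bits)
  let ?T = "tbound (field_cost R) N RECINIT"
  have init: "call R N RECINIT v = enc_opt enc_rstate (recinit R N t as c)"
    unfolding v_def by (rule call_RECINIT) (use as h N_def in auto)
  let ?pre = "Seq (setup_loops (Hd (Tl (Tl (Tl (Var 0))))))
     (Call 3 (wrap (compile RECINIT)) (Pair_Exp (Var 1) (Var 0)))"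
  have "runs_to R ?pre (init v) (\<lambda>\<tau>. \<tau> 0 = v \<and> (\<exists>us. \<tau> 1 = val_list us \<and> length us = N) \<and>
      \<tau> 3 = call R N RECINIT v) (60 + 9 * N + ?T)"
  proof (rule runs_to_Seq[OF setup_loops_runs_to[OF v' bits]])
    fix \<tau> :: "nat \<Rightarrow> 'a val"
    assume "\<tau> 0 = v \<and> (\<exists>us. \<tau> 1 = val_list us \<and> length us = 8 + length as + length bits)"
    then obtain us where us: "\<tau> 0 = v" "\<tau> 1 = val_list us" "length us = N" by (auto simp: N_def as(2))
    show "runs_to R (Call 3 (wrap (compile RECINIT)) (Pair_Exp (Var 1) (Var 0))) \<tau>
      (\<lambda>\<tau>. \<tau> 0 = v \<and> (\<exists>us. \<tau> 1 = val_list us \<and> length us = N) \<and> \<tau> 3 = call R N RECINIT v) (13 + ?T)"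
    proof (rule runs_to_Call)
      show "runs_to R (wrap (compile RECINIT)) (init (eval_exp R (Pair_Exp (Var 1) (Var 0)) \<tau>))
          (\<lambda>\<tau>'. (\<tau>(3 := \<tau>' 0)) 0 = v \<and> (\<exists>us. (\<tau>(3 := \<tau>' 0)) 1 = val_list us \<and> length us = N) \<and>
            (\<tau>(3 := \<tau>' 0)) 3 = call R N RECINIT v) (?T + 9)"
        using us by (auto intro!: runs_to_mono[OF call_runs_to[OF us(3)]])
    qed simp
  qed (simp_all add: N_def as(2))
  then obtain \<tau>1 k1 where pre: "exec R ?pre (init v) = return_spmf (\<tau>1, k1)" "\<tau>1 0 = v"
    "\<exists>us. \<tau>1 1 = val_list us \<and> length us = N" "\<tau>1 3 = call R N RECINIT v" "k1 \<le> 60 + 9 * N + ?T"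
    by (auto simp: runs_to_def)
  show ?thesis
  proof (cases "decode R N t as c")
    case None
    then have "\<tau>1 3 = VNil" using pre(4) init by (simp add: recinit_def)
    then have "exec R rec_prog (init v) = return_spmf (\<tau>1(0 := VNil), k1 + 4)"
      unfolding rec_prog_def exec.simps(4)[of R ?pre] pre(1) by simp
    then have "runs_to R rec_prog (init v) (\<lambda>\<tau>. \<tau> 0 = VNil) (rec_time (field_cost R) N)"
      using pre(5) by (simp add: runs_to_def rec_time_def)
    from runs_to_run[OF this] show ?thesis
      by (simp add: rec None represents_def)
  next
    case (Some f)
    have f: "modulus s f" using decode_spec[OF h(5) as(1,2) h(8,7,3,4), of N] Some by (auto simp: N_def)
    define st where "st = rinit R N bits f"
    have lf: "length f \<le> N" using modulusD(4)[OF f] by (simp add: N_def)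
    have N5: "5 \<le> N" "length bits \<le> N" by (simp_all add: N_def)
    have st: "rinv N (zeros f) st" "rpot st \<le> 2 * N"
      using rinit_inv[OF f lf N5(1)] lf by (simp_all add: st_def)
    have t3: "\<tau>1 3 = VPair VNil (enc_rstate st)"
      using pre(4) init Some by (simp add: recinit_def st_def)
    define \<tau>2 where "\<tau>2 = \<tau>1(3 := enc_rstate st)"
    let ?it = "iterate (\<lambda>\<tau>. eval_exp R (Hd (Var 3)) \<tau> \<noteq> VNil) 3 (exec R split_body)"
    have while: "exec R (While (Hd (Var 3)) split_body) \<tau> = ?it \<tau>" for \<tau>
      by (simp add: numeral_3_eq_3)
    let ?m = "k1 + 10"
    have exec: "exec R rec_prog (init v) =
        map_spmf (\<lambda>y. ((fst y)(0 := VPair VNil (val_tl (fst y 3))), ?m + snd y)) (?it \<tau>2)"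
    proof -
      have 1: "exec R (Seq (While (Hd (Var 3)) split_body) (Assign 0 (Pair_Exp Nil_Exp (Tl (Var 3))))) \<tau>2 =
         map_spmf (\<lambda>y. ((fst y)(0 := VPair VNil (val_tl (fst y 3))), snd y + 5)) (?it \<tau>2)"
        unfolding exec.simps(4) while
        by (simp add: split_def map_spmf_conv_bind_spmf eval_nat_numeral)
      have 2: "exec R (Seq (Assign 3 (Tl (Var 3))) (Seq (While (Hd (Var 3)) split_body)
          (Assign 0 (Pair_Exp Nil_Exp (Tl (Var 3)))))) \<tau>1 =
         map_spmf (\<lambda>y. ((fst y)(0 := VPair VNil (val_tl (fst y 3))), 3 + (snd y + 5))) (?it \<tau>2)"
        unfolding exec.simps(4)[of R "Assign 3 (Tl (Var 3))"]
        using 1 by (simp add: t3 \<tau>2_def spmf.map_comp o_def split_def del: exec.simps(4))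
      show ?thesis
        unfolding rec_prog_def exec.simps(4)[of R ?pre] pre(1) exec.simps(5)
        using 2 t3 by (simp add: spmf.map_comp o_def split_def add_ac del: exec.simps(4))
    qed
    interpret loop: progressing_loop "\<lambda>\<tau>. eval_exp R (Hd (Var 3)) \<tau> \<noteq> VNil" 3 "exec R split_body"
      "linv N v (zeros f)" lpot "split_cost (field_cost R) N"
      by (rule split_loop[OF _ N5]) (simp add: v_def Rec_input_def binary_eq_enc_bits)
    have I: "linv N v (zeros f) \<tau>2"
      using pre(2,3) st(1) by (auto simp: linv_def \<tau>2_def simp del: split_paired_Ex)
    have pot: "lpot \<tau>2 \<le> 2 * N" using st(2) lpot_eq[of \<tau>2 st] by (simp add: \<tau>2_def)
    have run: "run R rec_prog v = map_spmf (\<lambda>y. (VPair VNil (val_tl (fst y 3)), ?m + snd y)) (?it \<tau>2)"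
      unfolding run_def exec by (simp add: spmf.map_comp o_def split_def)
    have ll: "lossless_spmf (?it \<tau>2)" by (rule loop.iterate_lossless[OF I])
    have "represents (VPair VNil (val_tl (fst y 3))) (Some (zeros f))" if y: "y \<in> set_spmf (?it \<tau>2)" for y
    proof -
      obtain st' where st': "fst y 3 = enc_rstate st'" "rinv N (zeros f) st'" "val_hd (fst y 3) = VNil"
        using loop.iterate_set[OF I y] by (auto simp: linv_def)
      obtain out where out: "st' = ([], out)"
        using st'(1,3) by (cases st') auto
      \<comment> \<open>The cardinality clause of \<open>rinv\<close> makes \<open>out\<close>
        duplicate-free, as \<open>represents\<close> demands.\<close>
      have "zeros f = set out" "card (zeros f) = length out"
        using st'(2) by (auto simp: out rinv_def)
      then show ?thesis
        using st'(1) card_distinct[of out] by (auto simp: represents_def out)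
    qed
    then have "rel_spmf represents (outputs R rec_prog v) (spmf_of_pmf (JS_Rec R s t (set as) c))"
      using ll by (simp add: outputs_def run rec Some rel_spmf_return_spmf2 spmf.map_comp o_def)
    moreover have "expected_time R rec_prog v \<le> of_nat (rec_time (field_cost R) N)"
    proof -
      have "expected_time R rec_prog v = (\<integral>\<^sup>+ y. of_nat (?m + snd y) \<partial>measure_spmf (?it \<tau>2))"
        using ll by (simp add: expected_time_def run split_def o_def)
      also have "\<dots> = of_nat ?m + (\<integral>\<^sup>+ y. of_nat (snd y) \<partial>measure_spmf (?it \<tau>2))"
        by (rule nn_integral_add_const_spmf[OF ll])
      also have "\<dots> \<le> of_nat ?m + of_nat (loop.cost_bound \<tau>2)"
        by (intro add_left_mono loop.iterate_expected_cost[OF I])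
      also have "\<dots> = of_nat (?m + loop.cost_bound \<tau>2)" by simp
      also have "\<dots> \<le> of_nat (rec_time (field_cost R) N)"
      proof (intro of_nat_mono)
        have "3 * (3 + split_cost (field_cost R) N) * lpot \<tau>2 \<le> 3 * (3 + split_cost (field_cost R) N) * (2 * N)"
          using pot by (rule mult_left_mono) simp
        then show "?m + loop.cost_bound \<tau>2 \<le> rec_time (field_cost R) N"
          using pre(5) unfolding rec_time_def by linarith
      qed
      finally show ?thesis .
    qed
    ultimately show ?thesis by blast
  qed
qed

lemma Rec_poly_time: "Rec_expected_poly_time (JS_Rec :: 'a ring \<Rightarrow> _)"
proof -
  obtain C d where Cd: "poly_time rec_time C d" by (rule poly_time_exists[OF poly_bounded_rec_time])
  have "rel_spmf represents (outputs R rec_prog (Rec_input R t as c)) (spmf_of_pmf (JS_Rec R s t (set as) c)) \<and>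
      expected_time R rec_prog (Rec_input R t as c)
        \<le> ennreal (C * (real s + real t + log 2 (real (order R))) ^ d)"
    if h: "field R" "finite (carrier R)" "1 \<le> t" "t \<le> s" "distinct as" "set as \<in> SDif R s"
      "length c = t" "set c \<subseteq> carrier R"
    for R :: "'a ring" and s t as c
  proof -
    have "2 \<le> order R" using ff.order_ge_2[of R] h(1,2) by (simp add: ff_def ff_axioms_def)
    note r = rec_prog_correct[OF h]
    show ?thesis
      using r order_trans[OF conjunct2[OF r, unfolded field_cost_def] poly_time_ennreal[OF Cd h(3,4) \<open>2 \<le> order R\<close>]]
      by blast
  qed
  then show ?thesis unfolding Rec_expected_poly_time_def by blast
qed

text \<open>All sketches lie in the set of lists of length \<open>t\<close> over the field. It has
  n^t elements, whose logarithm is t log n.\<close>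

lemma JS_secure_sketch:
  assumes R: "field R" "finite (carrier R)" and ts: "1 \<le> t" "t \<le> s"
  shows "avg_case_secure_sketch (SDif R s) set_dist m (m - real t * log 2 (real (order R))) t
      (JS_SS R s t) (JS_Rec R s t)"
    and "w \<in> SDif R s \<Longrightarrow> c \<in> set_pmf (JS_SS R s t w) \<Longrightarrow>
      set c \<subseteq> carrier R \<and> sketch_bits R c \<le> real t * log 2 (real (order R))"
proof -
  interpret ff R using R by (simp add: ff_def ff_axioms_def)
  define C where "C = {c. set c \<subseteq> carrier R \<and> length c = t}"
  define f where "f = (\<lambda>w. map (\<lambda>j. coeff (JS_poly R w) (s - 1 - j)) [0..<t])"
  have SS: "JS_SS R s t = (\<lambda>w. return_pmf (f w))" by (simp add: JS_SS_def f_def fun_eq_iff)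
  have fC: "f w \<in> C" if "w \<in> SDif R s" for w
  proof -
    have w: "w \<subseteq> carrier R" using that by (simp add: SDif_def)
    then obtain as where as: "set as = w" "distinct as" using finite_distinct_list finite_subset fin by blast
    have "set (JS_poly R w) \<subseteq> carrier R"
      using rootpoly_props(4)[OF as(2)] P_set as(1) w by blast
    then show ?thesis by (auto simp: C_def f_def)
  qed
  have card: "finite C" "card C = order R ^ t"
    using finite_lists_length_eq[OF fin] card_lists_length_eq[OF fin] by (auto simp: C_def order_def)
  have log: "log 2 (real (card C)) = real t * log 2 (real (order R))"
    using order_ge_2 by (simp add: card log_nat_power)
  show "avg_case_secure_sketch (SDif R s) set_dist m (m - real t * log 2 (real (order R))) t
      (JS_SS R s t) (JS_Rec R s t)"
    unfolding avg_case_secure_sketch_def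
  proof (intro conjI ballI allI impI)
    show "JS_Rec R s t w' c = return_pmf (Some w)"
      if "w \<in> SDif R s" "w' \<in> SDif R s" "set_dist w w' \<le> t" "c \<in> set_pmf (JS_SS R s t w)" for w w' c
      using JS_correct[OF that(1-3) ts that(4)] .
    fix joint :: "('a set \<times> bool list) pmf"
    assume j: "fst ` set_pmf joint \<subseteq> SDif R s \<and> m \<le> avg_min_entropy joint"
    have "f w \<in> C" if "(w, i) \<in> set_pmf joint" for w i using j that fC by force
    then have "avg_min_entropy joint - log 2 (card C) \<le>
        avg_min_entropy (bind_pmf joint (\<lambda>(w, i). map_pmf (\<lambda>c. (w, (c, i))) (return_pmf (f w))))"
      by (intro avg_min_entropy_sketch card(1))
    then show "m - real t * log 2 (real (order R)) \<le>
        avg_min_entropy (bind_pmf joint (\<lambda>(w, i). map_pmf (\<lambda>c. (w, (c, i))) (JS_SS R s t w)))"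
      using j log by (simp add: SS case_prod_unfold)
  qed
  assume "w \<in> SDif R s" "c \<in> set_pmf (JS_SS R s t w)"
  then have "c \<in> C" using fC by (simp add: SS)
  then show "set c \<subseteq> carrier R \<and> sketch_bits R c \<le> real t * log 2 (real (order R))"
    by (simp add: C_def sketch_bits_def)
qed

theorem theorem6p1:
  shows "(\<forall>(R :: 'a ring) n s t.
            field R \<and> finite (carrier R) \<and> order R = n \<and> 1 \<le> t \<and> t \<le> s \<and> s \<le> n \<longrightarrow>
              (\<forall>m :: real.
                 avg_case_secure_sketch (SDif R s) set_dist m (m - real t * log 2 (real n)) t
                   (JS_SS R s t) (JS_Rec R s t) \<and>
                 entropy_loss m (m - real t * log 2 (real n)) \<le> real t * log 2 (real n)) \<and>
              (\<forall>w \<in> SDif R s. \<forall>c \<in> set_pmf (JS_SS R s t w).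
                 set c \<subseteq> carrier R \<and> sketch_bits R c \<le> real t * log 2 (real n))) \<and>
         SS_expected_poly_time (JS_SS :: 'a ring \<Rightarrow> _) \<and>
         Rec_expected_poly_time (JS_Rec :: 'a ring \<Rightarrow> _)"
proof (intro conjI SS_poly_time Rec_poly_time allI impI ballI; elim conjE)
  fix R :: "'a ring" and n s t :: nat and m :: real
  assume h: "field R" "finite (carrier R)" "order R = n" "1 \<le> t" "t \<le> s"
  show "avg_case_secure_sketch (SDif R s) set_dist m (m - real t * log 2 (real n)) t
      (JS_SS R s t) (JS_Rec R s t)"
    using JS_secure_sketch(1)[OF h(1,2,4,5)] unfolding h(3) .
  show "entropy_loss m (m - real t * log 2 (real n)) \<le> real t * log 2 (real n)"
    by (simp add: entropy_loss_def)
  fix w c assume "w \<in> SDif R s" "c \<in> set_pmf (JS_SS R s t w)"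
  from JS_secure_sketch(2)[OF h(1,2,4,5) this]
  show "set c \<subseteq> carrier R" "sketch_bits R c \<le> real t * log 2 (real n)"
    unfolding h(3) by simp_all
qed

end
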